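(* Let $T>0$, $\sigma>0$, and let $\mathcal X_t=\mathcal Y_t+\sigma\mathcal Z_t$, $0\le t\le T$, where $\mathcal Z$ is a standard fractional Brownian motion with Hurst index $0<H<1$. Suppose that for some $1\le p<1/H$, $$\limsup_{n\to\infty}\sum_{k=1}^n\big|\mathcal Y_{Tk/n}-\mathcal Y_{T(k-1)/n}\big|^p<\infty\quad\text{with probability one.}$$ Let $\bm X=(X_1,\dots,X_n)$ with $X_k=(T/n)^{-H}(\mathcal X_{Tk/n}-\mathcal X_{T(k-1)/n})$. Let $\bm\psi$ be either the deterministic or the random proxy (defined in the context) with $\Psi=\Phi$ the standard normal distribution function, and let $\bm w=\omega(\bm\psi)$, where $\omega:\mathbb{R}\to[0,1]$ is continuous, satisfies $\sup_{x\in\mathbb{R}}x^2\omega(x)<\infty$ and is not identically zero. Then, for $r=1,2$, the estimator $\Sigma_r$ is consistent (i.e. $\Sigma_r\to\sigma$ in probability as $n\to\infty$) and satisfies $$|\Sigma_r-\sigma|=O_{\mathbb P}\Big(n^{-\min\{(1/p-H)r,\;1-H,\;1/2\}/r}\Big).$$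
   Context: $\bm x^{\uparrow}$ is the non-decreasing rearrangement of $\bm x\in\mathbb{R}^n$; functions of vectors are applied coordinatewise. Deterministic proxy: $\psi_k=\Phi^{-1}(k/(n+1))$, $1\le k\le n$. Random proxy: $\bm\psi=\bm\xi^{\uparrow}$, where $\bm\xi$ is an auxiliary i.i.d. sample of size $n$ from the standard normal law, generated independently of $\bm X$. The estimator $\Sigma_r$ is a minimizer over $s\in\mathbb{R}$ of $\sum_{k=1}^n w_k|X_k^{\uparrow}-s\psi_k|^r$. No assumption is made on the dependence between $\mathcal Y$ and $\mathcal Z$. $\zeta_n=O_{\mathbb P}(\beta_n)$ means that $\zeta_n/\beta_n$ is bounded in probability (tight) as $n\to\infty$. *)

theory Defs
  imports "HOL-Probability.Probability"
begin

text \<open>Normal law with mean m and standard deviation s, including the degenerate case s = 0,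
  where the library's \<^const>\<open>normal_density\<close> is not a probability density.\<close>

definition normal_law :: "real \<Rightarrow> real \<Rightarrow> real measure" where
  "normal_law m s = (if s = 0 then return borel m else density lborel (normal_density m s))"

definition gaussian_process :: "'a measure \<Rightarrow> real set \<Rightarrow> (real \<Rightarrow> 'a \<Rightarrow> real) \<Rightarrow> bool" where
  "gaussian_process M I G \<longleftrightarrow>
     (\<forall>t\<in>I. G t \<in> borel_measurable M) \<and>
     (\<forall>J c. finite J \<and> J \<subseteq> I \<longrightarrow>
        (\<exists>m s. 0 \<le> s \<and> distr M borel (\<lambda>x. \<Sum>t\<in>J. c t * G t x) = normal_law m s))"

text \<open>Standard fractional Brownian motion on [0, T] as a centred Gaussian process with the
  covariance below. Continuity of the paths is not demanded, since only finite-dimensional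
  distributions are used here.\<close>

definition standard_fBm :: "'a measure \<Rightarrow> real \<Rightarrow> real \<Rightarrow> (real \<Rightarrow> 'a \<Rightarrow> real) \<Rightarrow> bool" where
  "standard_fBm M T H Z \<longleftrightarrow>
     gaussian_process M {0..T} Z \<and>
     (\<forall>t\<in>{0..T}. integral\<^sup>L M (Z t) = 0) \<and>
     (\<forall>s\<in>{0..T}. \<forall>t\<in>{0..T}. integral\<^sup>L M (\<lambda>x. Z s x * Z t x)
        = (s powr (2 * H) + t powr (2 * H) - \<bar>s - t\<bar> powr (2 * H)) / 2)"

definition scaled_increment ::
  "real \<Rightarrow> real \<Rightarrow> (real \<Rightarrow> 'a \<Rightarrow> real) \<Rightarrow> nat \<Rightarrow> nat \<Rightarrow> 'a \<Rightarrow> real" where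
  "scaled_increment T H XX n k x =
     (T / real n) powr (- H) * (XX (T * real k / real n) x - XX (T * (real k - 1) / real n) x)"

text \<open>Vectors of length n are functions on the indices 1, ..., n; \<open>rearr n v k\<close> is the k-th
  coordinate of the non-decreasing rearrangement of \<open>v\<close>, for 1 \<le> k \<le> n.\<close>

definition rearr :: "nat \<Rightarrow> (nat \<Rightarrow> real) \<Rightarrow> nat \<Rightarrow> real" where
  "rearr n v k = sort (map v [1..<Suc n]) ! (k - 1)"

text \<open>The normal distribution function is a bijection from the reals onto the open unit interval,
  so \<open>inv\<close> is its genuine inverse at the arguments k/(n+1) with 1 \<le> k \<le> n.\<close>

definition deterministic_proxy :: "'a measure \<Rightarrow> (nat \<Rightarrow> nat \<Rightarrow> 'a \<Rightarrow> real) \<Rightarrow> bool" where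
  "deterministic_proxy M \<psi> \<longleftrightarrow>
     (\<forall>n. \<forall>k\<in>{1..n}. \<forall>x\<in>space M.
        \<psi> n k x = inv (cdf std_normal_distribution) (real k / real (n + 1)))"

text \<open>The auxiliary samples for different sizes n need not be related to each other; for each n,
  the sample is independent of the vector \<open>(X n 1, ..., X n n)\<close>.\<close>

definition random_proxy ::
  "'a measure \<Rightarrow> (nat \<Rightarrow> nat \<Rightarrow> 'a \<Rightarrow> real) \<Rightarrow> (nat \<Rightarrow> nat \<Rightarrow> 'a \<Rightarrow> real) \<Rightarrow> bool" where
  "random_proxy M X \<psi> \<longleftrightarrow>
     (\<exists>\<xi> :: nat \<Rightarrow> nat \<Rightarrow> 'a \<Rightarrow> real. \<forall>n.
        prob_space.indep_vars M (\<lambda>_. borel) (\<xi> n) {1..n} \<and>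
        (\<forall>k\<in>{1..n}. distr M borel (\<xi> n k) = std_normal_distribution) \<and>
        prob_space.indep_var M
          (Pi\<^sub>M {1..n} (\<lambda>_. borel)) (\<lambda>x. \<lambda>k\<in>{1..n}. \<xi> n k x)
          (Pi\<^sub>M {1..n} (\<lambda>_. borel)) (\<lambda>x. \<lambda>k\<in>{1..n}. X n k x) \<and>
        (\<forall>k\<in>{1..n}. \<forall>x\<in>space M. \<psi> n k x = rearr n (\<lambda>j. \<xi> n j x) k))"

definition objective ::
  "nat \<Rightarrow> nat \<Rightarrow> (nat \<Rightarrow> real) \<Rightarrow> (nat \<Rightarrow> real) \<Rightarrow> (nat \<Rightarrow> real) \<Rightarrow> real \<Rightarrow> real" where
  "objective r n w v \<psi> s = (\<Sum>k=1..n. w k * \<bar>rearr n v k - s * \<psi> k\<bar> ^ r)"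

definition converges_in_prob :: "'a measure \<Rightarrow> (nat \<Rightarrow> 'a \<Rightarrow> real) \<Rightarrow> real \<Rightarrow> bool" where
  "converges_in_prob M \<zeta> l \<longleftrightarrow>
     (\<forall>\<epsilon>>0. (\<lambda>n. measure M {x \<in> space M. \<bar>\<zeta> n x - l\<bar> > \<epsilon>}) \<longlonglongrightarrow> 0)"

text \<open>Each single real random variable is tight, so tightness of the whole sequence is the same as
  boundedness in probability as n tends to infinity; terms with \<open>\<beta> n = 0\<close> (such as n = 0 for
  negative powers of n) contribute the point mass at 0.\<close>

definition bigO_prob :: "'a measure \<Rightarrow> (nat \<Rightarrow> 'a \<Rightarrow> real) \<Rightarrow> (nat \<Rightarrow> real) \<Rightarrow> bool" where
  "bigO_prob M \<zeta> \<beta> \<longleftrightarrow> tight (\<lambda>n. distr M borel (\<lambda>x. \<zeta> n x / \<beta> n))"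

end

theory Submission
  imports Defs
begin

text \<open>The estimator error is controlled pathwise: both for \<open>r = 1\<close> (minimality) and for \<open>r = 2\<close>
  (normal equation, where the bounded factor \<open>w |\<psi>|\<close> makes outliers enter only linearly), it is at
  most a constant times \<open>1/n \<Sum> |X\<^sub>k\<up> - \<sigma> \<psi>\<^sub>k|\<close>, provided the proxy is close to the normal law. Sorting is the
  optimal coupling on the line, so this mean is bounded by the contribution of \<open>\<Y>\<close>, which is of order
  \<open>n\<close> to the power \<open>H - 1/p\<close> by the power mean inequality, plus the \<open>L\<^sup>1\<close>-distances to \<open>\<Phi>\<close> of the empirical
  distribution functions of the fractional Gaussian noise and of the proxy.

  For the latter, the \<open>L\<^sup>1\<close>-distance is dominated by an \<open>L\<^sup>2\<close>-distance with weight \<open>1 + x\<^sup>2\<close>. Since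
  \<open>W(x) = x + x\<^sup>3/3\<close> is a primitive of the weight, the expected squared weighted distance equals a constant
  minus half the average over all pairs of \<open>E |W(G\<^sub>i) - W(G\<^sub>j)|\<close>. For a Gaussian pair this is an
  explicit function of the correlation, and the deficit is \<open>O(|\<rho>|)\<close>. So the rate is that of
  \<open>1/n\<^sup>2 \<Sum> |\<rho>\<^sub>i\<^sub>j|\<close>. The correlations of fractional Gaussian noise have constant sign off the
  diagonal, whence this sum telescopes.\<close>

section \<open>Counting functions and sorted vectors\<close>

text \<open>The weight has to meet two demands: its reciprocal must be integrable, so that an L2
  bound yields an L1 bound, and its primitive must be a polynomial, so that the expected distance of
  the transformed variables is a Gaussian moment. \<open>1 + x^2\<close> does both, at the price of
  the mixed moment \<open>E |A - B| (A + B)^2\<close>. The obstacle there is that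
  \<open>gaussian_process\<close> provides laws of linear combinations and no joint density, so this
  moment has to be extracted from one-dimensional ones.

  A bound linear in the correlation is all that is required of the deficit: it already produces the
  exponent \<open>1 - H\<close> under long memory and \<open>1/2\<close> otherwise.

  Chance enters through three events only (noise, proxy, variation sums of \<open>Y\<close>), joined
  by a union bound; hence \<open>Y\<close> and \<open>Z\<close> may depend on each other in any way.
  The exponent reached is the minimum of \<open>1/p - H\<close>, \<open>1 - H\<close> and
  \<open>1/2\<close> for both values of \<open>r\<close>; for \<open>r = 2\<close> it is at least as
  large as the claimed one.\<close>

definition ecount :: "nat \<Rightarrow> (nat \<Rightarrow> real) \<Rightarrow> real \<Rightarrow> real" where
  "ecount n v x = (\<Sum>k=1..n. indicator {v k..} x)"

lemma ecount_measurable [measurable]: "ecount n v \<in> borel_measurable borel"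
  unfolding ecount_def[abs_def] by measurable

lemma ecount_nonneg: "0 \<le> ecount n v x"
  unfolding ecount_def by (intro sum_nonneg) auto

lemma ecount_le: "ecount n v x \<le> real n"
proof -
  have "ecount n v x \<le> (\<Sum>k=1..n. 1)"
    unfolding ecount_def by (intro sum_mono) (auto simp: indicator_def)
  then show ?thesis by simp
qed

lemma ecount_mono: "x \<le> y \<Longrightarrow> ecount n v x \<le> ecount n v y"
  unfolding ecount_def by (intro sum_mono) (auto simp: indicator_def)

lemma sum_rearr: "(\<Sum>k=1..n. f (rearr n v k)) = (\<Sum>k=1..n. f (v k))"
proof -
  let ?xs = "map v [1..<Suc n]"
  have "(\<Sum>k=1..n. f (rearr n v k)) = (\<Sum>i<n. f (sort ?xs ! i))"
    by (rule sum.reindex_bij_witness[of _ Suc "\<lambda>k. k - 1"]) (auto simp: rearr_def)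
  also have "\<dots> = sum_list (map f (sort ?xs))"
    by (subst sum_list_sum_nth) (auto simp: atLeast0LessThan simp del: upt_Suc)
  also have "\<dots> = sum_list (map f ?xs)"
    by (metis mset_map mset_sort sum_mset_sum_list)
  also have "\<dots> = (\<Sum>k=1..n. f (v k))"
    by (simp add: interv_sum_list_conv_sum_set_nat atLeastLessThanSuc_atLeastAtMost del: upt_Suc)
  finally show ?thesis .
qed

lemma mono_on_rearr: "mono_on {1..n} (rearr n v)"
proof (rule mono_onI)
  fix i j assume "i \<in> {1..n}" "j \<in> {1..n}" "i \<le> j"
  then show "rearr n v i \<le> rearr n v j"
    unfolding rearr_def by (intro sorted_nth_mono) (auto simp del: upt_Suc)
qed

lemma ecount_rearr: "ecount n (rearr n v) = ecount n v"
proof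
  fix x :: real
  have "indicator {u..} x = (indicator {..x} u :: real)" for u
    by (auto simp: indicator_def)
  then show "ecount n (rearr n v) x = ecount n v x"
    unfolding ecount_def using sum_rearr[of "\<lambda>u. indicator {..x} u" n v] by simp
qed

text \<open>The thresholds separating \<open>a\<close> from \<open>b\<close> form a half-open
  interval. Integrating over thresholds turns distances of points into distances of counting
  functions.\<close>

lemma nn_integral_abs_diff_indicator:
  "(\<integral>\<^sup>+x. ennreal \<bar>indicator {a..} x - indicator {b..} x\<bar> \<partial>lborel) = ennreal \<bar>a - b\<bar>" for a b :: real
proof -
  have "(\<integral>\<^sup>+x. ennreal \<bar>indicator {a..} x - indicator {b..} x\<bar> \<partial>lborel)
      = (\<integral>\<^sup>+x. indicator {min a b..<max a b} x \<partial>lborel)"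
    by (intro nn_integral_cong) (auto simp: indicator_def min_def max_def)
  also have "\<dots> = ennreal \<bar>a - b\<bar>"
    by (auto simp: min_def max_def ennreal_minus)
  finally show ?thesis .
qed

text \<open>At a fixed threshold, the indicator differences of two sorted vectors all have the same
  sign, so the absolute value can be moved outside the sum over \<open>k\<close>. This is the
  equality case of optimal coupling on the line.\<close>

lemma sum_abs_diff_mono_on:
  assumes a: "mono_on {1..n} a" and b: "mono_on {1..n} b"
  shows "ennreal (\<Sum>k=1..n. \<bar>a k - b k\<bar>) = (\<integral>\<^sup>+x. ennreal \<bar>ecount n a x - ecount n b x\<bar> \<partial>lborel)"
proof -
  have *: "(\<Sum>k=1..n. \<bar>indicator {a k..} x - indicator {b k..} x\<bar>) = \<bar>ecount n a x - ecount n b x\<bar>" for x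
  proof (cases "\<exists>k\<in>{1..n}. a k \<le> x \<and> x < b k")
    case True
    then obtain k where k: "k \<in> {1..n}" "a k \<le> x" "x < b k" by blast
    \<comment> \<open>One index \<open>k\<close> where \<open>a\<close> has passed \<open>x\<close>
      and \<open>b\<close> has not fixes the sign everywhere: from \<open>k\<close> on,
      \<open>b\<close> lies beyond \<open>x\<close>, and up to \<open>k\<close>, \<open>a\<close>
      lies at or below \<open>x\<close>.\<close>
    have "a j \<le> x" if "j \<in> {1..n}" "b j \<le> x" for j
    proof (cases "k \<le> j")
      case True
      then have "b k \<le> b j" using b k that by (auto simp: mono_on_def)
      with k that show ?thesis by simp
    next
      case False
      then have "a j \<le> a k" using a k that by (auto simp: mono_on_def)
      with k that show ?thesis by simp
    qed
    then have le: "indicator {b j..} x \<le> (indicator {a j..} x :: real)" if "j \<in> {1..n}" for j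
      using that by (auto simp: indicator_def)
    have "(\<Sum>k=1..n. \<bar>indicat_real {a k..} x - indicator {b k..} x\<bar>) =
        (\<Sum>k=1..n. indicator {a k..} x - indicator {b k..} x)"
      by (intro sum.cong refl abs_of_nonneg) (simp add: le)
    also have "\<dots> = ecount n a x - ecount n b x"
      by (simp add: ecount_def sum_subtractf)
    also have "\<dots> = \<bar>ecount n a x - ecount n b x\<bar>"
      using sum_mono[OF le, of "{1..n}" "\<lambda>k. k"] by (simp add: ecount_def)
    finally show ?thesis .
  next
    case False
    then have le: "indicator {a j..} x \<le> (indicator {b j..} x :: real)" if "j \<in> {1..n}" for j
      using that by (auto simp: indicator_def)
    have "(\<Sum>k=1..n. \<bar>indicat_real {a k..} x - indicator {b k..} x\<bar>) =
        (\<Sum>k=1..n. indicator {b k..} x - indicator {a k..} x)"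
      by (intro sum.cong refl) (simp add: le abs_of_nonpos)
    also have "\<dots> = ecount n b x - ecount n a x"
      by (simp add: ecount_def sum_subtractf)
    also have "\<dots> = \<bar>ecount n a x - ecount n b x\<bar>"
      using sum_mono[OF le, of "{1..n}" "\<lambda>k. k"] by (simp add: ecount_def)
    finally show ?thesis .
  qed
  have "ennreal (\<Sum>k=1..n. \<bar>a k - b k\<bar>) = (\<Sum>k=1..n. ennreal \<bar>a k - b k\<bar>)"
    by (simp add: sum_ennreal)
  also have "\<dots> = (\<Sum>k=1..n. \<integral>\<^sup>+x. ennreal \<bar>indicator {a k..} x - indicator {b k..} x\<bar> \<partial>lborel)"
    by (simp add: nn_integral_abs_diff_indicator)
  also have "\<dots> = (\<integral>\<^sup>+x. (\<Sum>k=1..n. ennreal \<bar>indicator {a k..} x - indicator {b k..} x\<bar>) \<partial>lborel)"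
    by (rule nn_integral_sum[symmetric]) measurable
  also have "\<dots> = (\<integral>\<^sup>+x. ennreal \<bar>ecount n a x - ecount n b x\<bar> \<partial>lborel)"
    unfolding *[symmetric] by (simp add: sum_ennreal)
  finally show ?thesis .
qed

text \<open>The integral of the difference of counting functions sees only the multisets. It equals
  the cost of the sorted pairing and, by the triangle inequality under the integral, is at most the
  cost of any other pairing. Positivity of \<open>\<sigma>\<close> keeps the scaled vector
  sorted.\<close>

lemma sum_abs_diff_rearr_le:
  assumes "0 < \<sigma>"
  shows "(\<Sum>k=1..n. \<bar>rearr n u k - \<sigma> * rearr n v k\<bar>) \<le> (\<Sum>k=1..n. \<bar>u k - \<sigma> * v k\<bar>)"
proof -
  have scale: "ecount n (\<lambda>k. \<sigma> * y k) x = ecount n y (x / \<sigma>)" for y x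
    using assms by (auto simp: ecount_def indicator_def field_simps intro!: sum.cong)
  have "mono_on {1..n} (\<lambda>k. \<sigma> * rearr n v k)"
    using mono_on_rearr[of n v] assms by (auto simp: mono_on_def)
  then have "ennreal (\<Sum>k=1..n. \<bar>rearr n u k - \<sigma> * rearr n v k\<bar>)
      = (\<integral>\<^sup>+x. ennreal \<bar>ecount n (rearr n u) x - ecount n (\<lambda>k. \<sigma> * rearr n v k) x\<bar> \<partial>lborel)"
    by (intro sum_abs_diff_mono_on mono_on_rearr)
  also have "\<dots> = (\<integral>\<^sup>+x. ennreal \<bar>ecount n u x - ecount n (\<lambda>k. \<sigma> * v k) x\<bar> \<partial>lborel)"
    by (simp only: scale ecount_rearr)
  also have "\<dots> \<le> (\<integral>\<^sup>+x. (\<Sum>k=1..n. ennreal \<bar>indicator {u k..} x - indicator {\<sigma> * v k..} x\<bar>) \<partial>lborel)"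
    by (intro nn_integral_mono)
       (auto simp: ecount_def sum_ennreal sum_subtractf[symmetric] intro!: ennreal_leI sum_abs)
  also have "\<dots> = (\<Sum>k=1..n. \<integral>\<^sup>+x. ennreal \<bar>indicator {u k..} x - indicator {\<sigma> * v k..} x\<bar> \<partial>lborel)"
    by (rule nn_integral_sum) measurable
  also have "\<dots> = ennreal (\<Sum>k=1..n. \<bar>u k - \<sigma> * v k\<bar>)"
    by (simp add: nn_integral_abs_diff_indicator sum_ennreal)
  finally show ?thesis
    by (subst (asm) ennreal_le_iff) (auto intro: sum_nonneg)
qed

section \<open>The standard normal distribution function\<close>

abbreviation \<Phi> :: "real \<Rightarrow> real" where
  "\<Phi> \<equiv> cdf std_normal_distribution"

interpretation std_normal: real_distribution std_normal_distribution
  by (rule real_dist_normal_dist)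

lemma Phi_nonneg: "0 \<le> \<Phi> x" and Phi_le_1: "\<Phi> x \<le> 1"
  by (auto intro: std_normal.cdf_nonneg std_normal.cdf_bounded_prob)

text \<open>The density is positive everywhere, so an interval without mass would be a Lebesgue null
  set.\<close>

lemma Phi_strict_mono: "x < y \<Longrightarrow> \<Phi> x < \<Phi> y"
proof -
  assume "x < y"
  have "measure std_normal_distribution {x<..y} \<noteq> 0"
  proof
    assume "measure std_normal_distribution {x<..y} = 0"
    then have "emeasure std_normal_distribution {x<..y} = 0"
      by (simp add: std_normal.emeasure_eq_measure)
    moreover have "\<not> std_normal_density u \<le> 0" for u
      by (simp add: not_le normal_density_pos)
    ultimately have "AE u in lborel. u \<notin> {x<..y}"
      by (subst (asm) emeasure_density)
         (auto simp: nn_integral_0_iff_AE indicator_def ennreal_eq_0_iff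
            elim!: eventually_mono split: if_splits)
    then have "emeasure lborel {x<..y} = 0"
      by (subst (asm) AE_iff_measurable[OF _ refl]) (auto simp: greaterThanAtMost_def greaterThan_def atMost_def Int_def)
    with \<open>x < y\<close> show False by simp
  qed
  then have "0 < measure std_normal_distribution {x<..y}"
    by (simp add: zero_less_measure_iff)
  then show ?thesis
    using std_normal.cdf_diff_eq[OF \<open>x < y\<close>] by simp
qed

lemma Phi_mono: "x \<le> y \<Longrightarrow> \<Phi> x \<le> \<Phi> y"
  by (rule std_normal.cdf_nondecreasing)

lemma Phi_pos: "0 < \<Phi> x" and Phi_less_1: "\<Phi> x < 1"
  using Phi_strict_mono[of "x - 1" x] Phi_strict_mono[of x "x + 1"] Phi_nonneg[of "x - 1"] Phi_le_1[of "x + 1"]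
  by auto

lemma Phi_measurable [measurable]: "\<Phi> \<in> borel_measurable borel"
  by (intro borel_measurable_mono monoI Phi_mono)

lemma isCont_Phi: "isCont \<Phi> x"
proof -
  have "emeasure std_normal_distribution {x} = 0"
    by (subst emeasure_density) (auto simp: nn_integral_0_iff_AE intro: AE_I[where N="{x}"])
  then show ?thesis
    by (simp add: std_normal.isCont_cdf measure_def)
qed

lemma Phi_inv: 
  assumes "0 < u" "u < 1"
  shows "\<Phi> (inv \<Phi> u) = u"
proof -
  have "eventually (\<lambda>x. \<Phi> x < u) at_bot"
    using std_normal.cdf_lim_at_bot assms(1) by (rule order_tendstoD(2))
  then obtain a where a: "\<Phi> a < u"
    by (auto simp: eventually_at_bot_linorder)
  have "eventually (\<lambda>x. u < \<Phi> x) at_top"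
    using std_normal.cdf_lim_at_top_prob assms(2) by (rule order_tendstoD(1))
  then obtain b where b: "u < \<Phi> b"
    by (auto simp: eventually_at_top_linorder)
  have "a \<le> b"
    using a b Phi_mono[of b a] by linarith
  then have "\<exists>x. a \<le> x \<and> x \<le> b \<and> \<Phi> x = u"
    using a b isCont_Phi by (intro IVT) auto
  then show ?thesis
    by (intro f_inv_into_f) auto
qed

lemma inv_Phi_le_iff:
  assumes "0 < u" "u < 1"
  shows "inv \<Phi> u \<le> x \<longleftrightarrow> u \<le> \<Phi> x"
  using Phi_inv[OF assms] Phi_mono[of "inv \<Phi> u" x] Phi_strict_mono[of x "inv \<Phi> u"]
  by (metis not_le)

section \<open>Absolute moments of Gaussian pairs\<close>

text \<open>The exponent is odd, hence positive, so the closed form vanishes at \<open>s = 0\<close>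
  and covers the point mass as well. Below it serves with \<open>k = 0\<close> and
  \<open>k = 1\<close>, that is for first and third absolute moments.\<close>

lemma normal_law_abs_moment:
  assumes "0 \<le> s" and [measurable]: "L \<in> borel_measurable M"
    and L: "distr M borel L = normal_law 0 s"
  shows "has_bochner_integral M (\<lambda>x. \<bar>L x\<bar> ^ (2 * k + 1)) (2 ^ k * s ^ (2 * k + 1) * fact k * sqrt (2 / pi))"
proof -
  have "has_bochner_integral (distr M borel L) (\<lambda>y. \<bar>y\<bar> ^ (2 * k + 1))
      (2 ^ k * s ^ (2 * k + 1) * fact k * sqrt (2 / pi))"
  proof (cases "s = 0")
    case True
    interpret prob_space "return borel (0::real)"
      by (rule prob_space_return) simp
    have "AE y in return borel (0::real). \<bar>y\<bar> ^ (2 * k + 1) = 0"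
      by (subst AE_return) auto
    then have "has_bochner_integral (return borel 0) (\<lambda>y::real. \<bar>y\<bar> ^ (2 * k + 1)) 0"
      by (subst has_bochner_integral_cong_AE[where g = "\<lambda>_. 0"]) (auto simp: has_bochner_integral_zero)
    with True L show ?thesis by (simp add: normal_law_def)
  next
    case False
    with assms(1) have "0 < s" by simp
    then show ?thesis
      using normal_moment_abs_odd[of s 0 k] False
      by (subst L) (simp add: normal_law_def has_bochner_integral_density)
  qed
  then show ?thesis
    by (simp add: has_bochner_integral_iff integrable_distr_eq integral_distr)
qed

text \<open>Only the laws of linear combinations enter, as in \<open>gaussian_process\<close>; the joint law of the pair
  is never used.\<close>

definition gaussian_pair :: "'a measure \<Rightarrow> ('a \<Rightarrow> real) \<Rightarrow> ('a \<Rightarrow> real) \<Rightarrow> real \<Rightarrow> bool" where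
  "gaussian_pair M A B \<rho> \<longleftrightarrow> A \<in> borel_measurable M \<and> B \<in> borel_measurable M \<and> \<bar>\<rho>\<bar> \<le> 1 \<and>
     (\<forall>a b. distr M borel (\<lambda>x. a * A x + b * B x) = normal_law 0 (sqrt (a\<^sup>2 + b\<^sup>2 + 2 * a * b * \<rho>)))"

lemma gaussian_pair_abs_moment:
  assumes G: "gaussian_pair M A B \<rho>"
  shows "has_bochner_integral M (\<lambda>x. \<bar>a * A x + b * B x\<bar> ^ (2 * k + 1))
    (2 ^ k * sqrt (a\<^sup>2 + b\<^sup>2 + 2 * a * b * \<rho>) ^ (2 * k + 1) * fact k * sqrt (2 / pi))"
proof -
  have [measurable]: "A \<in> borel_measurable M" "B \<in> borel_measurable M" and \<rho>: "\<bar>\<rho>\<bar> \<le> 1"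
    and L: "distr M borel (\<lambda>x. a * A x + b * B x) = normal_law 0 (sqrt (a\<^sup>2 + b\<^sup>2 + 2 * a * b * \<rho>))"
    using G by (auto simp: gaussian_pair_def)
  have "\<bar>2 * a * b * \<rho>\<bar> \<le> 2 * \<bar>a\<bar> * \<bar>b\<bar> * 1"
    using \<rho> unfolding abs_mult by (intro mult_mono) auto
  moreover have "0 \<le> (\<bar>a\<bar> - \<bar>b\<bar>)\<^sup>2" by simp
  ultimately have "0 \<le> a\<^sup>2 + b\<^sup>2 + 2 * a * b * \<rho>"
    by (simp add: power2_diff)
  with L show ?thesis
    by (intro normal_law_abs_moment) auto
qed

text \<open>The second difference of \<open>|.|^3\<close> with step \<open>y\<close> is exactly
  \<open>6 |v| y^2\<close> unless the step crosses the origin; in that case the defect is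
  \<open>2 (|y| - |v|)^3\<close>. By symmetry in the signs it suffices to treat nonnegative
  \<open>v\<close> and \<open>y\<close>.\<close>

lemma cube_second_difference:
  fixes v y :: real
  shows "\<bar>\<bar>v + y\<bar> ^ 3 + \<bar>v - y\<bar> ^ 3 - 2 * \<bar>v\<bar> ^ 3 - 6 * \<bar>v\<bar> * y\<^sup>2\<bar> \<le> 2 * \<bar>y\<bar> ^ 3"
proof -
  have *: "\<bar>(v + y) ^ 3 + \<bar>v - y\<bar> ^ 3 - 2 * v ^ 3 - 6 * v * y\<^sup>2\<bar> \<le> 2 * y ^ 3"
    if "0 \<le> v" "0 \<le> y" for v y :: real
  proof (cases "y \<le> v")
    case True
    then have "(v + y) ^ 3 + \<bar>v - y\<bar> ^ 3 - 2 * v ^ 3 - 6 * v * y\<^sup>2 = 0"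
      by (simp add: power3_eq_cube power2_eq_square algebra_simps)
    with that show ?thesis by simp
  next
    case False
    then have eq: "(v + y) ^ 3 + \<bar>v - y\<bar> ^ 3 - 2 * v ^ 3 - 6 * v * y\<^sup>2 = 2 * (y - v) ^ 3"
      by (simp add: power3_eq_cube power2_eq_square algebra_simps)
    have "(y - v) ^ 3 \<le> y ^ 3" "0 \<le> (y - v) ^ 3"
      using False that by (auto intro: power_mono)
    then show ?thesis unfolding eq by simp
  qed
  have "\<bar>v + y\<bar> ^ 3 + \<bar>v - y\<bar> ^ 3 = (\<bar>v\<bar> + \<bar>y\<bar>) ^ 3 + \<bar>\<bar>v\<bar> - \<bar>y\<bar>\<bar> ^ 3"
  proof -
    have "\<bar>v\<bar> + \<bar>y\<bar> = \<bar>v + y\<bar> \<and> \<bar>\<bar>v\<bar> - \<bar>y\<bar>\<bar> = \<bar>v - y\<bar> \<or>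
        \<bar>v\<bar> + \<bar>y\<bar> = \<bar>v - y\<bar> \<and> \<bar>\<bar>v\<bar> - \<bar>y\<bar>\<bar> = \<bar>v + y\<bar>"
      by arith
    then show ?thesis by auto
  qed
  with *[of "\<bar>v\<bar>" "\<bar>y\<bar>"] show ?thesis by simp
qed

text \<open>Second-order expansion in \<open>t\<close> of the third moment of a variable with
  variance \<open>q^2\<close>, with a cubic error that is uniform in \<open>s\<close> down to the
  degenerate case \<open>s = 0\<close>. Writing \<open>t^2 \<tau>^2\<close> as
  \<open>(q - s) (q + s)\<close> exhibits both sides of the estimate as products of nonnegative
  factors.\<close>

lemma sqrt_cube_diff_bound:
  fixes s \<tau> t :: real
  assumes "0 \<le> s" "0 \<le> \<tau>" "0 \<le> t"
  defines "q \<equiv> sqrt (s\<^sup>2 + t\<^sup>2 * \<tau>\<^sup>2)"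
  shows "\<bar>q ^ 3 - s ^ 3 - 3 / 2 * s * (t\<^sup>2 * \<tau>\<^sup>2)\<bar> \<le> 3 / 2 * (t * \<tau>) ^ 3"
proof -
  have q0: "0 \<le> q" and q2: "q\<^sup>2 = s\<^sup>2 + (t * \<tau>)\<^sup>2"
    by (auto simp: q_def power_mult_distrib)
  have "s \<le> q"
    by (rule power2_le_imp_le) (use q2 q0 in auto)
  have "q \<le> s + t * \<tau>"
    by (rule power2_le_imp_le) (use q2 assms(1-3) in \<open>auto simp: power2_sum\<close>)
  have y2: "t\<^sup>2 * \<tau>\<^sup>2 = (q - s) * (q + s)"
    using q2 by (simp add: power_mult_distrib power2_eq_square algebra_simps)
  have lo: "q ^ 3 - s ^ 3 - 3 / 2 * s * (t\<^sup>2 * \<tau>\<^sup>2) = (q - s) * ((2 * q + s) * (q - s)) / 2"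
    unfolding y2 by (simp add: power3_eq_cube power2_eq_square field_simps)
  have hi: "3 / 2 * (q - s) * (t\<^sup>2 * \<tau>\<^sup>2) - (q ^ 3 - s ^ 3 - 3 / 2 * s * (t\<^sup>2 * \<tau>\<^sup>2))
      = (q - s) * ((q - s) * (q + 2 * s)) / 2"
    unfolding y2 by (simp add: power3_eq_cube power2_eq_square field_simps)
  have "0 \<le> q ^ 3 - s ^ 3 - 3 / 2 * s * (t\<^sup>2 * \<tau>\<^sup>2)"
    unfolding lo using \<open>s \<le> q\<close> q0 assms(1) by simp
  moreover have "0 \<le> (q - s) * ((q - s) * (q + 2 * s)) / 2"
    using \<open>s \<le> q\<close> q0 assms(1) by simp
  moreover have "3 / 2 * (q - s) * (t\<^sup>2 * \<tau>\<^sup>2) \<le> 3 / 2 * (t * \<tau>) * (t\<^sup>2 * \<tau>\<^sup>2)"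
    using \<open>q \<le> s + t * \<tau>\<close> by (intro mult_right_mono) auto
  moreover have "3 / 2 * (t * \<tau>) * (t\<^sup>2 * \<tau>\<^sup>2) = 3 / 2 * (t * \<tau>) ^ 3"
    by (simp add: power3_eq_cube power2_eq_square)
  ultimately show ?thesis
    using hi by linarith
qed

text \<open>With \<open>U = A + B\<close> and \<open>V = A - B\<close>, the moment \<open>E |V| U\<^sup>2\<close> is read off from the second difference
  in \<open>t\<close> of \<open>E |V + t U|\<^sup>3\<close>, which depends only on the variance of \<open>V + t U\<close>.\<close>

lemma gaussian_pair_mixed_moment:
  assumes G: "gaussian_pair M A B \<rho>"
  shows "has_bochner_integral M (\<lambda>x. \<bar>A x - B x\<bar> * (A x + B x)\<^sup>2)
    (sqrt (2 / pi) * sqrt (2 - 2 * \<rho>) * (2 + 2 * \<rho>))"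
proof -
  have [measurable]: "A \<in> borel_measurable M" "B \<in> borel_measurable M" and \<rho>: "\<bar>\<rho>\<bar> \<le> 1"
    using G by (auto simp: gaussian_pair_def)
  define U V where "U = (\<lambda>x. A x + B x)" and "V = (\<lambda>x. A x - B x)"
  have [measurable]: "U \<in> borel_measurable M" "V \<in> borel_measurable M"
    by (auto simp: U_def V_def)
  \<comment> \<open>\<open>s^2\<close> and \<open>\<tau>^2\<close> are the variances of
    \<open>V\<close> and \<open>U\<close>, and \<open>c\<close> is the third absolute moment of the
    standard normal law.\<close>
  define s \<tau> c where "s = sqrt (2 - 2 * \<rho>)" and "\<tau> = sqrt (2 + 2 * \<rho>)" and "c = 2 * sqrt (2 / pi)"
  have s0: "0 \<le> s" "s\<^sup>2 = 2 - 2 * \<rho>" and \<tau>0: "0 \<le> \<tau>" "\<tau>\<^sup>2 = 2 + 2 * \<rho>" and c0: "0 \<le> c"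
    using \<rho> by (auto simp: s_def \<tau>_def c_def)
  \<comment> \<open>\<open>U\<close> and \<open>V\<close> are uncorrelated, because \<open>A\<close>
    and \<open>B\<close> have equal variance; hence the variance of \<open>V + t U\<close> has no
    term linear in \<open>t\<close>.\<close>
  have shift: "has_bochner_integral M (\<lambda>x. \<bar>V x + t * U x\<bar> ^ 3) (c * sqrt (s\<^sup>2 + t\<^sup>2 * \<tau>\<^sup>2) ^ 3)" for t
  proof -
    have "(1 + t)\<^sup>2 + (t - 1)\<^sup>2 + 2 * (1 + t) * (t - 1) * \<rho> = s\<^sup>2 + t\<^sup>2 * \<tau>\<^sup>2"
      unfolding s0 \<tau>0 by (simp add: power2_eq_square algebra_simps)
    moreover have "V x + t * U x = (1 + t) * A x + (t - 1) * B x" for x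
      by (simp add: U_def V_def algebra_simps)
    ultimately show ?thesis
      using gaussian_pair_abs_moment[OF G, of "1 + t" "t - 1" 1] by (simp add: c_def numeral_3_eq_3 mult_ac)
  qed
  have V3: "has_bochner_integral M (\<lambda>x. \<bar>V x\<bar> ^ 3) (c * s ^ 3)"
    using shift[of 0] s0(1) by simp
  have U3: "has_bochner_integral M (\<lambda>x. \<bar>U x\<bar> ^ 3) (c * \<tau> ^ 3)"
  proof -
    have "sqrt (1 + 1 + 2 * \<rho>) = \<tau>"
      by (simp add: \<tau>_def)
    then show ?thesis
      using gaussian_pair_abs_moment[OF G, of 1 1 1] by (simp add: U_def c_def numeral_3_eq_3 mult_ac)
  qed
  have int: "integrable M (\<lambda>x. \<bar>V x\<bar> * (U x)\<^sup>2)"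
  proof (rule Bochner_Integration.integrable_bound)
    show "integrable M (\<lambda>x. \<bar>V x\<bar> ^ 3 + \<bar>U x\<bar> ^ 3)"
      using U3 V3 by (auto simp: has_bochner_integral_iff)
    have "\<bar>v\<bar> * u\<^sup>2 \<le> \<bar>v\<bar> ^ 3 + \<bar>u\<bar> ^ 3" for u v :: real
    proof (cases "\<bar>u\<bar> \<le> \<bar>v\<bar>")
      case True
      then have "u\<^sup>2 \<le> \<bar>v\<bar>\<^sup>2" by (metis abs_ge_zero power2_abs power_mono)
      then have "\<bar>v\<bar> * u\<^sup>2 \<le> \<bar>v\<bar> * \<bar>v\<bar>\<^sup>2" by (intro mult_left_mono) auto
      also have "\<dots> = \<bar>v\<bar> ^ 3" by (simp add: power3_eq_cube power2_eq_square)
      finally show ?thesis by (simp add: add_increasing2)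
    next
      case False
      then have "\<bar>v\<bar> * u\<^sup>2 \<le> \<bar>u\<bar> * u\<^sup>2" by (intro mult_right_mono) auto
      also have "\<dots> = \<bar>u\<bar> ^ 3" by (simp add: power3_eq_cube power2_eq_square)
      finally show ?thesis by (simp add: add_increasing)
    qed
    then show "AE x in M. norm (\<bar>V x\<bar> * (U x)\<^sup>2) \<le> norm (\<bar>V x\<bar> ^ 3 + \<bar>U x\<bar> ^ 3)"
      by (auto simp: abs_mult)
  qed measurable
  define e where "e = integral\<^sup>L M (\<lambda>x. \<bar>V x\<bar> * (U x)\<^sup>2)"
  have e: "has_bochner_integral M (\<lambda>x. \<bar>V x\<bar> * (U x)\<^sup>2) e"
    using int by (simp add: e_def has_bochner_integral_integrable)
  \<comment> \<open>Both sides of the second difference are expanded to order \<open>t^2\<close>.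
    The constant 5 adds the error 2 of the pointwise expansion and the error 3 of the expansion of
    the moment.\<close>
  have bound: "\<bar>6 * e - 3 * c * s * \<tau>\<^sup>2\<bar> \<le> t * (5 * c * \<tau> ^ 3)" if "0 < t" for t
  proof -
    define q where "q = sqrt (s\<^sup>2 + t\<^sup>2 * \<tau>\<^sup>2)"
    define f where "f = (\<lambda>x. \<bar>V x + t * U x\<bar> ^ 3 + \<bar>V x + (- t) * U x\<bar> ^ 3 - 2 * \<bar>V x\<bar> ^ 3 - 6 * t\<^sup>2 * (\<bar>V x\<bar> * (U x)\<^sup>2))"
    have f: "has_bochner_integral M f (c * q ^ 3 + c * q ^ 3 - 2 * (c * s ^ 3) - 6 * t\<^sup>2 * e)"
      unfolding f_def q_def
      by (intro has_bochner_integral_diff has_bochner_integral_add has_bochner_integral_mult_right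
           e V3 shift impI shift[of "- t", simplified power2_minus])
    have t3: "has_bochner_integral M (\<lambda>x. 2 * t ^ 3 * \<bar>U x\<bar> ^ 3) (2 * t ^ 3 * (c * \<tau> ^ 3))"
      by (intro has_bochner_integral_mult_right U3)
    have "\<bar>f x\<bar> \<le> 2 * t ^ 3 * \<bar>U x\<bar> ^ 3" for x
      using cube_second_difference[of "V x" "t * U x"] \<open>0 < t\<close>
      by (simp add: f_def abs_mult power_mult_distrib mult_ac)
    then have "\<bar>integral\<^sup>L M f\<bar> \<le> integral\<^sup>L M (\<lambda>x. 2 * t ^ 3 * \<bar>U x\<bar> ^ 3)"
      using f t3 by (intro order_trans[OF integral_abs_bound integral_mono]) (auto simp: has_bochner_integral_iff)
    then have 1: "\<bar>c * q ^ 3 + c * q ^ 3 - 2 * (c * s ^ 3) - 6 * t\<^sup>2 * e\<bar> \<le> 2 * t ^ 3 * (c * \<tau> ^ 3)"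
      by (simp only: has_bochner_integral_integral_eq[OF f] has_bochner_integral_integral_eq[OF t3])
    have "\<bar>q ^ 3 - s ^ 3 - 3 / 2 * s * (t\<^sup>2 * \<tau>\<^sup>2)\<bar> \<le> 3 / 2 * (t * \<tau>) ^ 3"
      unfolding q_def using s0 \<tau>0 \<open>0 < t\<close> by (intro sqrt_cube_diff_bound) auto
    then have "2 * c * \<bar>q ^ 3 - s ^ 3 - 3 / 2 * s * (t\<^sup>2 * \<tau>\<^sup>2)\<bar> \<le> 2 * c * (3 / 2 * (t * \<tau>) ^ 3)"
      using c0 by (intro mult_left_mono) auto
    then have "\<bar>2 * c * (q ^ 3 - s ^ 3 - 3 / 2 * s * (t\<^sup>2 * \<tau>\<^sup>2))\<bar> \<le> 2 * c * (3 / 2 * (t * \<tau>) ^ 3)"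
      using c0 by (simp add: abs_mult)
    with 1 have "\<bar>6 * t\<^sup>2 * e - 2 * c * (3 / 2 * s * (t\<^sup>2 * \<tau>\<^sup>2))\<bar>
        \<le> 2 * t ^ 3 * (c * \<tau> ^ 3) + 2 * c * (3 / 2 * (t * \<tau>) ^ 3)"
      by (simp add: algebra_simps)
    then have "\<bar>t\<^sup>2 * (6 * e - 3 * c * s * \<tau>\<^sup>2)\<bar> \<le> t\<^sup>2 * (t * (5 * c * \<tau> ^ 3))"
      by (simp add: algebra_simps power3_eq_cube power2_eq_square)
    then show ?thesis
      using \<open>0 < t\<close> by (simp add: abs_mult)
  qed
  \<comment> \<open>This is the limit \<open>t -> 0\<close>, taken by choosing \<open>t\<close>
    proportional to \<open>\<epsilon>\<close>. If the error constant is zero, any \<open>t\<close>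
    will do.\<close>
  have "\<bar>6 * e - 3 * c * s * \<tau>\<^sup>2\<bar> \<le> 0 + \<epsilon>" if "0 < \<epsilon>" for \<epsilon>
  proof (cases "c * \<tau> ^ 3 = 0")
    case True
    then show ?thesis using bound[of 1] that by auto
  next
    case False
    define C where "C = 5 * c * \<tau> ^ 3"
    have "0 < C" using False c0 \<tau>0 by (simp add: less_le C_def)
    then show ?thesis using bound[of "\<epsilon> / C", folded C_def] that by simp
  qed
  then have "\<bar>6 * e - 3 * c * s * \<tau>\<^sup>2\<bar> \<le> 0"
    by (rule field_le_epsilon)
  then have "e = sqrt (2 / pi) * s * \<tau>\<^sup>2"
    by (simp add: c_def)
  with e show ?thesis
    unfolding \<tau>0 by (simp add: s_def U_def V_def)
qed

text \<open>The difference of the two cubics is \<open>a - b\<close> times a positive quadratic in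
  \<open>a + b\<close> and \<open>a - b\<close>. The absolute value therefore falls on
  \<open>a - b\<close> alone, and the expectation splits into a first, a mixed and a third
  moment.\<close>

lemma gaussian_pair_cubic_distance:
  assumes G: "gaussian_pair M A B \<rho>"
  shows "has_bochner_integral M (\<lambda>x. \<bar>(A x + A x ^ 3 / 3) - (B x + B x ^ 3 / 3)\<bar>)
    (sqrt (2 / pi) * sqrt (2 - 2 * \<rho>) * (11 + \<rho>) / 6)"
proof -
  have \<rho>: "\<bar>\<rho>\<bar> \<le> 1"
    using G by (auto simp: gaussian_pair_def)
  define s where "s = sqrt (2 - 2 * \<rho>)"
  have s: "s\<^sup>2 = 2 - 2 * \<rho>" using \<rho> by (auto simp: s_def)
  have V1: "has_bochner_integral M (\<lambda>x. \<bar>A x - B x\<bar>) (sqrt (2 / pi) * s)"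
    using gaussian_pair_abs_moment[OF G, of 1 "- 1" 0] by (simp add: s_def mult_ac)
  have V3: "has_bochner_integral M (\<lambda>x. \<bar>A x - B x\<bar> ^ 3) (2 * sqrt (2 / pi) * s ^ 3)"
    using gaussian_pair_abs_moment[OF G, of 1 "- 1" 1] by (simp add: s_def numeral_3_eq_3 mult_ac)
  have "\<bar>(a + a ^ 3 / 3) - (b + b ^ 3 / 3)\<bar> = \<bar>a - b\<bar> + \<bar>a - b\<bar> * (a + b)\<^sup>2 / 4 + \<bar>a - b\<bar> ^ 3 / 12" for a b :: real
  proof -
    have "(a + a ^ 3 / 3) - (b + b ^ 3 / 3) = (a - b) * (1 + (a + b)\<^sup>2 / 4 + (a - b)\<^sup>2 / 12)"
      by (simp add: power3_eq_cube power2_eq_square field_simps)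
    then have "\<bar>(a + a ^ 3 / 3) - (b + b ^ 3 / 3)\<bar> = \<bar>a - b\<bar> * (1 + (a + b)\<^sup>2 / 4 + \<bar>a - b\<bar>\<^sup>2 / 12)"
      by (simp add: abs_mult)
    then show ?thesis
      by (simp add: power3_eq_cube power2_eq_square algebra_simps del: power2_abs abs_mult_self_eq)
  qed
  moreover have "has_bochner_integral M
     (\<lambda>x. \<bar>A x - B x\<bar> + \<bar>A x - B x\<bar> * (A x + B x)\<^sup>2 / 4 + \<bar>A x - B x\<bar> ^ 3 / 12)
     (sqrt (2 / pi) * s + sqrt (2 / pi) * s * (2 + 2 * \<rho>) / 4 + 2 * sqrt (2 / pi) * s ^ 3 / 12)"
    using gaussian_pair_mixed_moment[OF G] V1 V3 unfolding s_def[symmetric]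
    by (intro has_bochner_integral_add has_bochner_integral_divide_zero) auto
  \<comment> \<open>The factor is
    \<open>1 + (1 + \<rho>)/2 + (1 - \<rho>)/3 = (11 + \<rho>)/6\<close>, using
    \<open>s^2 = 2 - 2 \<rho>\<close> in the cubic term.\<close>
  moreover have "sqrt (2 / pi) * s + sqrt (2 / pi) * s * (2 + 2 * \<rho>) / 4 + 2 * sqrt (2 / pi) * s ^ 3 / 12
      = sqrt (2 / pi) * s * (11 + \<rho>) / 6"
  proof -
    have "s ^ 3 = s * (2 - 2 * \<rho>)"
      unfolding s[symmetric] by (simp add: power3_eq_cube power2_eq_square)
    then show ?thesis by (simp only:) (simp add: field_simps)
  qed
  ultimately show ?thesis
    unfolding s_def[symmetric] by (simp only:)
qed

text \<open>The bound has to stay linear up to \<open>\<rho> = 1\<close>, where the square root has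
  infinite slope; equality holds there, so the constant cannot be lowered. For
  \<open>\<rho> \<ge> 0\<close> a number in the unit interval is at most its square root; for
  \<open>\<rho> < 0\<close> the square root exceeds 1.\<close>

lemma cubic_distance_deficit:
  fixes \<rho> :: real
  assumes "\<bar>\<rho>\<bar> \<le> 1"
  shows "sqrt 2 * 11 - sqrt (2 - 2 * \<rho>) * (11 + \<rho>) \<le> 11 * sqrt 2 * \<bar>\<rho>\<bar>"
proof -
  have "11 - sqrt (1 - \<rho>) * (11 + \<rho>) \<le> 11 * \<bar>\<rho>\<bar>"
  proof (cases "0 \<le> \<rho>")
    case True
    have "(1 - \<rho>)\<^sup>2 \<le> 1 - \<rho>"
      using True assms by (simp add: power2_eq_square mult_left_le)
    then have "1 - \<rho> \<le> sqrt (1 - \<rho>)"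
      by (rule real_le_rsqrt)
    then have "(1 - \<rho>) * (11 + \<rho>) \<le> sqrt (1 - \<rho>) * (11 + \<rho>)"
      using True by (intro mult_right_mono) auto
    moreover have "\<rho> * \<rho> \<le> \<rho>" using True assms by (simp add: mult_left_le)
    ultimately show ?thesis using True by (simp add: algebra_simps)
  next
    case False
    then have "1 * (11 + \<rho>) \<le> sqrt (1 - \<rho>) * (11 + \<rho>)"
      using assms by (intro mult_right_mono) auto
    then show ?thesis using False by simp
  qed
  then have "sqrt 2 * (11 - sqrt (1 - \<rho>) * (11 + \<rho>)) \<le> sqrt 2 * (11 * \<bar>\<rho>\<bar>)"
    by (intro mult_left_mono) auto
  moreover have "sqrt (2 - 2 * \<rho>) = sqrt 2 * sqrt (1 - \<rho>)"
    by (simp add: real_sqrt_mult[symmetric] algebra_simps)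
  ultimately show ?thesis by (simp add: algebra_simps)
qed

section \<open>Weighted distance to the normal distribution function\<close>

lemma nn_integral_arctan: "(\<integral>\<^sup>+x. ennreal (1 / (1 + x\<^sup>2)) \<partial>lborel) = ennreal pi"
proof -
  have pos: "(\<integral>\<^sup>+x. ennreal (1 / (1 + x\<^sup>2)) * indicator {0..} x \<partial>lborel) = ennreal (pi / 2 - arctan 0)"
  proof (rule nn_integral_FTC_atLeast)
    show "(arctan has_real_derivative 1 / (1 + x\<^sup>2)) (at x)" if "0 \<le> x" for x
      using DERIV_arctan[of x] by (simp add: inverse_eq_divide)
    show "(arctan \<longlongrightarrow> pi / 2) at_top"
      by (rule tendsto_arctan_at_top)
  qed auto
  have "(\<integral>\<^sup>+x. ennreal (1 / (1 + x\<^sup>2)) * indicator {..0} x \<partial>lborel)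
      = (\<integral>\<^sup>+x. ennreal (1 / (1 + x\<^sup>2)) * indicator {..0} x \<partial>distr lborel borel uminus)"
    by (simp only: lborel_distr_uminus)
  also have "\<dots> = (\<integral>\<^sup>+x. ennreal (1 / (1 + x\<^sup>2)) * indicator {0..} x \<partial>lborel)"
    by (subst nn_integral_distr) (auto intro!: nn_integral_cong simp: indicator_def)
  finally have neg: "(\<integral>\<^sup>+x. ennreal (1 / (1 + x\<^sup>2)) * indicator {..0} x \<partial>lborel) = ennreal (pi / 2)"
    using pos by simp
  have "(\<integral>\<^sup>+x. ennreal (1 / (1 + x\<^sup>2)) \<partial>lborel)
      = (\<integral>\<^sup>+x. ennreal (1 / (1 + x\<^sup>2)) * indicator {0..} x + ennreal (1 / (1 + x\<^sup>2)) * indicator {..0} x \<partial>lborel)"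
    by (intro nn_integral_cong_AE AE_I[where N = "{0}"]) (auto simp: indicator_def)
  also have "\<dots> = ennreal (pi / 2) + ennreal (pi / 2)"
    by (subst nn_integral_add) (auto simp: pos neg)
  finally show ?thesis
    by (simp flip: ennreal_plus)
qed

text \<open>For \<open>n \<ge> 1\<close> this is the Wasserstein-1 distance between the empirical
  law of the vector and the standard normal law, in its one-dimensional form.\<close>

definition cdf_dist :: "nat \<Rightarrow> (nat \<Rightarrow> real) \<Rightarrow> ennreal" where
  "cdf_dist n v = (\<integral>\<^sup>+x. ennreal \<bar>ecount n v x / real n - \<Phi> x\<bar> \<partial>lborel)"

text \<open>A distance of Cramer-von Mises type, taken against Lebesgue measure with a growing
  weight in place of the normal law.\<close>

definition cdf_sqdist :: "nat \<Rightarrow> (nat \<Rightarrow> real) \<Rightarrow> ennreal" where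
  "cdf_sqdist n v = (\<integral>\<^sup>+x. ennreal ((1 + x\<^sup>2) * (ecount n v x / real n - \<Phi> x)\<^sup>2) \<partial>lborel)"

lemma cdf_dist_rearr: "cdf_dist n (rearr n v) = cdf_dist n v"
  by (simp add: cdf_dist_def ecount_rearr)

text \<open>Cauchy-Schwarz in additive form: the arithmetic-geometric mean inequality at each
  \<open>x\<close>, with a free parameter \<open>d\<close>. Being linear in
  \<open>cdf_sqdist\<close>, the bound survives taking expectations; \<open>d\<close> is afterwards
  set to the rate. The factor \<open>pi\<close> is the integral of the reciprocal weight.\<close>

lemma cdf_dist_le:
  assumes "0 < d"
  shows "cdf_dist n v \<le> ennreal (d * pi / 2) + ennreal (1 / (2 * d)) * cdf_sqdist n v"
proof -
  have "\<bar>f\<bar> \<le> d / 2 * (1 / (1 + x\<^sup>2)) + 1 / (2 * d) * ((1 + x\<^sup>2) * f\<^sup>2)" for f x :: real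
  proof -
    define w where "w = 1 + x\<^sup>2"
    have "0 < w" by (simp add: w_def add_pos_nonneg)
    have "0 \<le> (d - w * \<bar>f\<bar>)\<^sup>2" by simp
    then have "2 * d * w * \<bar>f\<bar> \<le> d\<^sup>2 + w\<^sup>2 * f\<^sup>2"
      by (simp add: power2_diff power_mult_distrib)
    then have "\<bar>f\<bar> \<le> (d\<^sup>2 + w\<^sup>2 * f\<^sup>2) / (2 * d * w)"
      using \<open>0 < w\<close> assms by (simp add: pos_le_divide_eq mult_ac)
    also have "\<dots> = d / 2 * (1 / w) + 1 / (2 * d) * (w * f\<^sup>2)"
      using \<open>0 < w\<close> assms by (simp add: field_simps power2_eq_square)
    finally show ?thesis by (simp add: w_def)
  qed
  then have "cdf_dist n v \<le> (\<integral>\<^sup>+x. ennreal (d / 2) * ennreal (1 / (1 + x\<^sup>2)) +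
      ennreal (1 / (2 * d)) * ennreal ((1 + x\<^sup>2) * (ecount n v x / real n - \<Phi> x)\<^sup>2) \<partial>lborel)"
    unfolding cdf_dist_def using assms
    by (intro nn_integral_mono) (simp add: ennreal_mult[symmetric] ennreal_plus[symmetric] del: ennreal_plus)
  also have "\<dots> = ennreal (d / 2) * ennreal pi + ennreal (1 / (2 * d)) * cdf_sqdist n v"
    by (subst nn_integral_add) (simp_all add: nn_integral_cmult nn_integral_arctan cdf_sqdist_def)
  also have "ennreal (d / 2) * ennreal pi = ennreal (d * pi / 2)"
    using assms by (simp add: ennreal_mult[symmetric])
  finally show ?thesis .
qed

text \<open>Weighted counterpart of the interval length: the primitive of the weight is increasing,
  so the weighted length of the separating interval is the distance of its values at the
  endpoints.\<close>

lemma nn_integral_square_weight_indicator: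
  fixes a b :: real
  shows "(\<integral>\<^sup>+x. ennreal ((1 + x\<^sup>2) * \<bar>indicator {a..} x - indicator {b..} x\<bar>) \<partial>lborel)
    = ennreal \<bar>(a + a ^ 3 / 3) - (b + b ^ 3 / 3)\<bar>"
proof -
  have *: "(\<integral>\<^sup>+x. ennreal ((1 + x\<^sup>2) * \<bar>indicator {a..} x - indicator {b..} x\<bar>) \<partial>lborel)
    = ennreal \<bar>(a + a ^ 3 / 3) - (b + b ^ 3 / 3)\<bar>" if "a \<le> b" for a b :: real
  proof -
    have "a + a ^ 3 / 3 \<le> b + b ^ 3 / 3"
      using that power_mono_odd[of 3 a b] by simp
    have "(\<integral>\<^sup>+x. ennreal ((1 + x\<^sup>2) * \<bar>indicator {a..} x - indicator {b..} x\<bar>) \<partial>lborel)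
      = (\<integral>\<^sup>+x. ennreal (1 + x\<^sup>2) * indicator {a..b} x \<partial>lborel)"
      using that by (intro nn_integral_cong_AE AE_I[where N = "{b}"]) (auto simp: indicator_def split: if_splits)
    also have "\<dots> = ennreal ((b + b ^ 3 / 3) - (a + a ^ 3 / 3))"
      using that by (intro nn_integral_FTC_Icc) (auto intro!: derivative_eq_intros simp: add_nonneg_nonneg)
    finally show ?thesis
      using \<open>a + a ^ 3 / 3 \<le> b + b ^ 3 / 3\<close> by (simp add: abs_minus_commute)
  qed
  show ?thesis
    using *[of a b] *[of b a] by (cases "a \<le> b") (simp_all add: abs_minus_commute)
qed

lemma borel_measurable_indicator_atLeast [measurable]:
  fixes f g :: "'a \<Rightarrow> real"
  assumes [measurable]: "f \<in> borel_measurable N" "g \<in> borel_measurable N"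
  shows "(\<lambda>z. indicat_real {f z..} (g z)) \<in> borel_measurable N"
proof -
  have "(\<lambda>z. indicat_real {f z..} (g z)) = (\<lambda>z. if f z \<le> g z then 1 else 0)"
    by (auto simp: indicator_def)
  then show ?thesis by simp
qed

lemma borel_measurable_ecount [measurable]:
  fixes f :: "nat \<Rightarrow> 'a \<Rightarrow> real"
  assumes "\<And>k. k \<in> {1..n} \<Longrightarrow> f k \<in> borel_measurable N" and [measurable]: "g \<in> borel_measurable N"
  shows "(\<lambda>z. ecount n (\<lambda>k. f k z) (g z)) \<in> borel_measurable N"
  unfolding ecount_def by (intro borel_measurable_sum borel_measurable_indicator_atLeast assms)

text \<open>By Fubini, the probability that \<open>x\<close> separates \<open>A\<close> and
  \<open>B\<close>, integrated over \<open>x\<close>, becomes an expected distance, which is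
  computable for Gaussian pairs.\<close>

lemma (in prob_space) nn_integral_separation:
  assumes [measurable]: "A \<in> borel_measurable M" "B \<in> borel_measurable M"
  shows "(\<integral>\<^sup>+x. ennreal ((1 + x\<^sup>2) * expectation (\<lambda>\<omega>. \<bar>indicator {A \<omega>..} x - indicator {B \<omega>..} x\<bar>)) \<partial>lborel)
    = (\<integral>\<^sup>+\<omega>. ennreal \<bar>(A \<omega> + A \<omega> ^ 3 / 3) - (B \<omega> + B \<omega> ^ 3 / 3)\<bar> \<partial>M)"
proof -
  have "(\<integral>\<^sup>+x. ennreal ((1 + x\<^sup>2) * expectation (\<lambda>\<omega>. \<bar>indicator {A \<omega>..} x - indicator {B \<omega>..} x\<bar>)) \<partial>lborel)
      = (\<integral>\<^sup>+x. (\<integral>\<^sup>+\<omega>. ennreal ((1 + x\<^sup>2) * \<bar>indicator {A \<omega>..} x - indicator {B \<omega>..} x\<bar>) \<partial>M) \<partial>lborel)"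
  proof (intro nn_integral_cong)
    fix x :: real
    have "integrable M (\<lambda>\<omega>. (1 + x\<^sup>2) * \<bar>indicat_real {A \<omega>..} x - indicat_real {B \<omega>..} x\<bar>)"
      by (intro integrable_const_bound[where B = "1 + x\<^sup>2"]) (auto simp: indicator_def abs_mult)
    then show "ennreal ((1 + x\<^sup>2) * expectation (\<lambda>\<omega>. \<bar>indicator {A \<omega>..} x - indicator {B \<omega>..} x\<bar>))
      = (\<integral>\<^sup>+\<omega>. ennreal ((1 + x\<^sup>2) * \<bar>indicator {A \<omega>..} x - indicator {B \<omega>..} x\<bar>) \<partial>M)"
      by (subst nn_integral_eq_integral) auto
  qed
  also have "\<dots> = (\<integral>\<^sup>+\<omega>. (\<integral>\<^sup>+x. ennreal ((1 + x\<^sup>2) * \<bar>indicator {A \<omega>..} x - indicator {B \<omega>..} x\<bar>) \<partial>lborel) \<partial>M)"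
  proof -
    interpret pair_sigma_finite M "lborel :: real measure" ..
    show ?thesis by (rule Fubini') measurable
  qed
  finally show ?thesis
    by (simp add: nn_integral_square_weight_indicator)
qed

section \<open>Independent standard normal pairs and the variance integral of
  \<open>\<Phi>\<close>\<close>

lemma normal_law_scale:
  assumes "prob_space M" and "A \<in> borel_measurable M" and A: "distr M borel A = std_normal_distribution"
  shows "distr M borel (\<lambda>x. a * A x) = normal_law 0 \<bar>a\<bar>"
proof (cases "a = 0")
  case True
  interpret prob_space M by fact
  have "distr M borel (\<lambda>x. 0 :: real) = return borel 0"
    by (rule distr_const) simp
  with True show ?thesis by (simp add: normal_law_def)
next
  case False
  interpret prob_space M by fact
  have "distributed M lborel A (normal_density 0 1)"
    using assms by (auto simp: distributed_def cong: distr_cong)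
  from normal_density_affine[OF this, of a 0] False show ?thesis
    by (auto simp: normal_law_def distributed_def cong: distr_cong)
qed

lemma (in prob_space) gaussian_pair_indep:
  assumes indep: "indep_var borel A borel B"
    and A: "distr M borel A = std_normal_distribution" and B: "distr M borel B = std_normal_distribution"
  shows "gaussian_pair M A B 0"
proof -
  have [measurable]: "A \<in> borel_measurable M" "B \<in> borel_measurable M"
    using indep by (auto dest: indep_var_rv1 indep_var_rv2)
  have "distr M borel (\<lambda>x. a * A x + b * B x) = normal_law 0 (sqrt (a\<^sup>2 + b\<^sup>2))" for a b
  \<comment> \<open>With a vanishing coefficient the sum is a scaled normal variable or a point
    mass; only for nonzero \<open>a\<close> and \<open>b\<close> is it a convolution of two
    densities.\<close>
  proof (cases "a = 0 \<or> b = 0")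
    case True
    then show ?thesis
      using normal_law_scale[OF prob_space_axioms _ A, of a] normal_law_scale[OF prob_space_axioms _ B, of b] by auto
  next
    case False
    have A': "distributed M lborel A (normal_density 0 1)" and B': "distributed M lborel B (normal_density 0 1)"
      using A B by (auto simp: distributed_def cong: distr_cong)
    have "indep_var borel ((\<lambda>u. a * u) \<circ> A) borel ((\<lambda>u. b * u) \<circ> B)"
      by (rule indep_var_compose[OF indep]) auto
    then have "distributed M lborel (\<lambda>x. a * A x + b * B x) (normal_density (0 + 0) (sqrt (\<bar>a\<bar>\<^sup>2 + \<bar>b\<bar>\<^sup>2)))"
      using normal_density_affine[OF A', of a 0] normal_density_affine[OF B', of b 0] False
      by (intro add_indep_normal) (auto simp: comp_def)
    moreover have "sqrt (a\<^sup>2 + b\<^sup>2) \<noteq> 0"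
      using False by (simp add: add_nonneg_eq_0_iff)
    ultimately show ?thesis
      by (auto simp: normal_law_def distributed_def cong: distr_cong)
  qed
  then show ?thesis by (simp add: gaussian_pair_def)
qed

lemma gaussian_pair_distr_fst:
  assumes "gaussian_pair M A B \<rho>"
  shows "distr M borel A = std_normal_distribution"
proof -
  have "distr M borel (\<lambda>x. 1 * A x + 0 * B x) = normal_law 0 (sqrt (1\<^sup>2 + 0\<^sup>2 + 2 * 1 * 0 * \<rho>))"
    using assms unfolding gaussian_pair_def by blast
  then show ?thesis by (simp add: normal_law_def)
qed

lemma (in prob_space) expectation_indicator_Phi:
  assumes [measurable]: "A \<in> borel_measurable M" and A: "distr M borel A = std_normal_distribution"
  shows "expectation (\<lambda>\<omega>. indicator {A \<omega>..} x) = \<Phi> x"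
proof -
  have "\<Phi> x = measure (distr M borel A) {..x}"
    by (simp add: A cdf_def)
  also have "\<dots> = prob (A -` {..x} \<inter> space M)"
    by (rule measure_distr) auto
  also have "\<dots> = expectation (indicator (A -` {..x} \<inter> space M))"
    by simp
  also have "\<dots> = expectation (\<lambda>\<omega>. indicator {A \<omega>..} x)"
    by (intro Bochner_Integration.integral_cong) (auto simp: indicator_def)
  finally show ?thesis by simp
qed

text \<open>\<open>2 \<Phi>(x) (1 - \<Phi>(x))\<close> is the probability that \<open>x\<close> separates two independent normal variables.\<close>

lemma nn_integral_Phi_variance:
  "(\<integral>\<^sup>+x. ennreal ((1 + x\<^sup>2) * (\<Phi> x * (1 - \<Phi> x))) \<partial>lborel) = ennreal (sqrt (2 / pi) * sqrt 2 * 11 / 12)"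
proof -
  let ?N = "std_normal_distribution"
  \<comment> \<open>The product space serves as a concrete model of two independent standard normal
    variables, so that the integral can be read off from the Gaussian pair formula at correlation
    zero.\<close>
  interpret NN: pair_prob_space ?N ?N ..
  let ?P = "?N \<Otimes>\<^sub>M ?N"
  have fst: "distr ?P borel fst = ?N"
    using std_normal.distr_pair_fst[of ?N] by (simp cong: distr_cong)
  have "distr ?P ?N snd = distr (distr ?P ?P (\<lambda>(x, y). (y, x))) ?N snd"
    using NN.distr_pair_swap by simp
  also have "\<dots> = distr ?P ?N (snd \<circ> (\<lambda>(x, y). (y, x)))"
    by (rule distr_distr) auto
  also have "snd \<circ> (\<lambda>(x, y). (y, x)) = (fst :: real \<times> real \<Rightarrow> real)"
    by auto
  finally have snd: "distr ?P borel snd = ?N"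
    using std_normal.distr_pair_fst[of ?N] by (simp cong: distr_cong)
  have meas [measurable]: "fst \<in> borel_measurable ?P" "snd \<in> borel_measurable ?P"
    by (simp_all cong: measurable_cong_sets)
  have "distr ?P (borel \<Otimes>\<^sub>M borel) (\<lambda>z. (fst z, snd z)) = ?P"
    by (simp add: distr_id2 cong: sets_pair_measure_cong)
  then have indep: "NN.indep_var borel fst borel snd"
    by (simp add: NN.indep_var_distribution_eq fst snd)
  have pair: "gaussian_pair ?P fst snd 0"
    by (rule NN.gaussian_pair_indep[OF indep fst snd])
  have sep: "NN.expectation (\<lambda>z. \<bar>indicator {fst z..} x - indicator {snd z..} x\<bar>) = 2 * (\<Phi> x * (1 - \<Phi> x))" for x
  proof -
    have e: "\<bar>indicator {a..} x - indicator {b..} x\<bar> = indicator {a..} x + indicator {b..} x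
        - 2 * (indicat_real {a..} x * indicator {b..} x)" for a b
      by (auto simp: indicator_def)
    have int: "integrable ?P (\<lambda>z. indicat_real {fst z..} x)" "integrable ?P (\<lambda>z. indicat_real {snd z..} x)"
      by (auto intro!: NN.integrable_const_bound[where B = 1] simp: indicator_def)
    have "NN.indep_var borel ((\<lambda>a. indicat_real {a..} x) \<circ> fst) borel ((\<lambda>a. indicat_real {a..} x) \<circ> snd)"
      by (rule NN.indep_var_compose[OF indep]) auto
    then have ind: "NN.indep_var borel (\<lambda>z. indicat_real {fst z..} x) borel (\<lambda>z. indicat_real {snd z..} x)"
      by (simp add: comp_def)
    have "NN.expectation (\<lambda>z. indicat_real {fst z..} x * indicat_real {snd z..} x) = \<Phi> x * \<Phi> x"
      using NN.indep_var_lebesgue_integral[OF ind int]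
        NN.expectation_indicator_Phi[OF _ fst] NN.expectation_indicator_Phi[OF _ snd] by simp
    moreover have "integrable ?P (\<lambda>z. indicat_real {fst z..} x * indicat_real {snd z..} x)"
      using NN.indep_var_integrable[OF ind int] .
    ultimately show ?thesis
      unfolding e using int NN.expectation_indicator_Phi[OF _ fst] NN.expectation_indicator_Phi[OF _ snd]
      by (simp add: algebra_simps)
  qed
  have "2 * (\<integral>\<^sup>+x. ennreal ((1 + x\<^sup>2) * (\<Phi> x * (1 - \<Phi> x))) \<partial>lborel)
      = (\<integral>\<^sup>+x. ennreal ((1 + x\<^sup>2) * (2 * (\<Phi> x * (1 - \<Phi> x)))) \<partial>lborel)"
    by (subst nn_integral_cmult[symmetric])
       (auto intro!: nn_integral_cong simp: ennreal_mult'[symmetric] ennreal_numeral[symmetric] mult_ac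
         simp del: ennreal_numeral)
  also have "\<dots> = (\<integral>\<^sup>+z. ennreal \<bar>(fst z + fst z ^ 3 / 3) - (snd z + snd z ^ 3 / 3)\<bar> \<partial>?P)"
    using NN.nn_integral_separation[OF meas] by (simp only: sep)
  also have "\<dots> = ennreal (sqrt (2 / pi) * sqrt (2 - 2 * 0) * (11 + 0) / 6)"
    using gaussian_pair_cubic_distance[OF pair]
    by (subst nn_integral_eq_integral) (auto simp: has_bochner_integral_iff)
  also have "\<dots> = 2 * ennreal (sqrt (2 / pi) * sqrt 2 * 11 / 12)"
    by (simp add: ennreal_mult'[symmetric] ennreal_numeral[symmetric] del: ennreal_numeral)
  finally show ?thesis
    by (simp add: ennreal_mult_cancel_left)
qed

section \<open>Expected weighted distance of Gaussian samples and of normal quantiles\<close>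

lemma sqrt_two_over_pi_le: "sqrt (2 / pi) * sqrt 2 \<le> 2"
proof -
  have "sqrt (2 / pi) * sqrt 2 = sqrt (4 / pi)"
    by (simp add: real_sqrt_mult[symmetric])
  also have "\<dots> \<le> sqrt 4"
    using pi_ge_two by (intro real_sqrt_le_mono) (simp add: field_simps)
  finally show ?thesis by simp
qed

text \<open>For values 0 and 1, a product is half the sum minus half the distance. Pair correlations
  of indicators, which would be bivariate normal probabilities, are thereby traded for separations,
  whose weighted integral has a closed form.\<close>

lemma ecount_square:
  "(ecount n v x)\<^sup>2 = real n * ecount n v x
    - (\<Sum>i=1..n. \<Sum>j=1..n. \<bar>indicator {v i..} x - indicator {v j..} x\<bar>) / 2"
proof -
  have "(ecount n v x)\<^sup>2 = (\<Sum>i=1..n. \<Sum>j=1..n. indicator {v i..} x * indicator {v j..} x)"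
    by (simp add: power2_eq_square ecount_def sum_product)
  also have "\<dots> = (\<Sum>i=1..n. \<Sum>j=1..n. (indicator {v i..} x + indicator {v j..} x) / 2
      - \<bar>indicator {v i..} x - indicator {v j..} x\<bar> / 2)"
    by (intro sum.cong) (auto simp: indicator_def)
  also have "\<dots> = real n * ecount n v x
    - (\<Sum>i=1..n. \<Sum>j=1..n. \<bar>indicator {v i..} x - indicator {v j..} x\<bar>) / 2"
    by (simp add: sum_subtractf sum.distrib sum_divide_distrib[symmetric] ecount_def sum_distrib_left[symmetric])
  finally show ?thesis .
qed

text \<open>At every threshold, the mean square error plus half the average separation probability
  equals \<open>\<Phi> (1 - \<Phi>)\<close>, whatever the dependence. After integration each pair
  contributes the gap between its expected distance and that of an independent pair, which is linear
  in the correlation. The diagonal pairs account for the order \<open>1/n\<close> of independent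
  sampling.\<close>

lemma (in prob_space) expected_cdf_sqdist_le:
  assumes n: "1 \<le> n"
    and G: "\<And>i j. i \<in> {1..n} \<Longrightarrow> j \<in> {1..n} \<Longrightarrow> gaussian_pair M (G i) (G j) (\<rho> i j)"
  shows "(\<integral>\<^sup>+\<omega>. cdf_sqdist n (\<lambda>k. G k \<omega>) \<partial>M) \<le> ennreal (2 * (\<Sum>i=1..n. \<Sum>j=1..n. \<bar>\<rho> i j\<bar>) / (real n)\<^sup>2)"
proof -
  have meas [measurable]: "G k \<in> borel_measurable M" if "k \<in> {1..n}" for k
    using G[OF that that] by (simp add: gaussian_pair_def)
  have ecm [measurable]: "(\<lambda>z. ecount n (\<lambda>k. G k (a z)) (b z)) \<in> borel_measurable N"
    if "a \<in> measurable N M" "b \<in> borel_measurable N" for a b and N :: "'c measure"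
    using measurable_compose[OF that(1) meas] that(2) by (intro borel_measurable_ecount) auto
  \<comment> \<open>\<open>p i j x\<close> is the probability that \<open>x\<close> separates the
    two variables, \<open>Q i j\<close> its weighted integral, \<open>E x\<close> the mean square
    error at \<open>x\<close>; \<open>2 * K\<close> is the value of \<open>Q\<close> at correlation
    zero.\<close>
  define p where "p i j x = expectation (\<lambda>\<omega>. \<bar>indicat_real {G i \<omega>..} x - indicator {G j \<omega>..} x\<bar>)" for i j and x :: real
  define Q where "Q i j = sqrt (2 / pi) * sqrt (2 - 2 * \<rho> i j) * (11 + \<rho> i j) / 6" for i j
  define E where "E x = expectation (\<lambda>\<omega>. (ecount n (\<lambda>k. G k \<omega>) x / real n - \<Phi> x)\<^sup>2)" for x
  define K where "K = sqrt (2 / pi) * sqrt 2 * 11 / 12"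
  have int: "integrable M (\<lambda>\<omega>. indicat_real {G k \<omega>..} x)" if "k \<in> {1..n}" for k x
    using that by (intro integrable_const_bound[where B = 1]) (auto simp: indicator_def)
  have \<rho>: "\<bar>\<rho> i j\<bar> \<le> 1" if "i \<in> {1..n}" "j \<in> {1..n}" for i j
    using G[OF that] by (simp add: gaussian_pair_def)
  have Q0: "0 \<le> Q i j" if "i \<in> {1..n}" "j \<in> {1..n}" for i j
    using \<rho>[OF that] by (simp add: Q_def)
  have p0: "0 \<le> p i j x" for i j x
    by (simp add: p_def)
  have p: "(\<integral>\<^sup>+x. ennreal ((1 + x\<^sup>2) * p i j x) \<partial>lborel) = ennreal (Q i j)"
    if "i \<in> {1..n}" "j \<in> {1..n}" for i j
  proof -
    have "has_bochner_integral M (\<lambda>\<omega>. \<bar>(G i \<omega> + G i \<omega> ^ 3 / 3) - (G j \<omega> + G j \<omega> ^ 3 / 3)\<bar>) (Q i j)"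
      unfolding Q_def by (rule gaussian_pair_cubic_distance[OF G[OF that]])
    then show ?thesis
      unfolding p_def nn_integral_separation[OF meas[OF that(1)] meas[OF that(2)]]
      by (subst nn_integral_eq_integral) (auto simp: has_bochner_integral_iff)
  qed
  have pm [measurable]: "p i j \<in> borel_measurable lborel" if "i \<in> {1..n}" "j \<in> {1..n}" for i j
  proof -
    have [measurable]: "G i \<in> borel_measurable M" "G j \<in> borel_measurable M"
      using that by auto
    show ?thesis unfolding p_def by measurable
  qed
  \<comment> \<open>Once the square of the count is rewritten, the remaining terms are linear in the
    count, so their expectation depends on the marginal laws alone.\<close>
  have E: "E x + (\<Sum>i=1..n. \<Sum>j=1..n. p i j x) / (2 * (real n)\<^sup>2) = \<Phi> x * (1 - \<Phi> x)" for x
  proof -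
    have "(ecount n v x / real n - \<Phi> x)\<^sup>2 = (1 - 2 * \<Phi> x) / real n * ecount n v x + (\<Phi> x)\<^sup>2
        - (\<Sum>i=1..n. \<Sum>j=1..n. \<bar>indicator {v i..} x - indicator {v j..} x\<bar>) / (2 * (real n)\<^sup>2)" for v
    proof -
      have "(ecount n v x / real n - \<Phi> x)\<^sup>2 = (ecount n v x)\<^sup>2 / (real n)\<^sup>2 - 2 * \<Phi> x / real n * ecount n v x + (\<Phi> x)\<^sup>2"
        by (simp add: power2_diff power_divide)
      also have "(ecount n v x)\<^sup>2 / (real n)\<^sup>2 = ecount n v x / real n
        - (\<Sum>i=1..n. \<Sum>j=1..n. \<bar>indicator {v i..} x - indicator {v j..} x\<bar>) / (2 * (real n)\<^sup>2)"
        unfolding ecount_square using n by (simp add: diff_divide_distrib power2_eq_square)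
      finally show ?thesis by (simp add: diff_divide_distrib algebra_simps)
    qed
    then have "E x = expectation (\<lambda>\<omega>. (1 - 2 * \<Phi> x) / real n * ecount n (\<lambda>k. G k \<omega>) x + (\<Phi> x)\<^sup>2
        - (\<Sum>i=1..n. \<Sum>j=1..n. \<bar>indicator {G i \<omega>..} x - indicator {G j \<omega>..} x\<bar>) / (2 * (real n)\<^sup>2))"
      unfolding E_def by simp
    also have "\<dots> = (1 - 2 * \<Phi> x) / real n * (\<Sum>k=1..n. \<Phi> x) + (\<Phi> x)\<^sup>2
        - (\<Sum>i=1..n. \<Sum>j=1..n. p i j x) / (2 * (real n)\<^sup>2)"
    proof (rule has_bochner_integral_integral_eq, intro has_bochner_integral_diff has_bochner_integral_add
        has_bochner_integral_mult_right has_bochner_integral_divide_zero has_bochner_integral_sum impI)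
      show "has_bochner_integral M (\<lambda>\<omega>. ecount n (\<lambda>k. G k \<omega>) x) (\<Sum>k=1..n. \<Phi> x)"
        unfolding ecount_def
      proof (rule has_bochner_integral_sum)
        fix k assume k: "k \<in> {1..n}"
        show "has_bochner_integral M (\<lambda>\<omega>. indicat_real {G k \<omega>..} x) (\<Phi> x)"
          using int[OF k] expectation_indicator_Phi[OF meas[OF k] gaussian_pair_distr_fst[OF G[OF k k]]]
          by (simp add: has_bochner_integral_iff)
      qed
      show "has_bochner_integral M (\<lambda>\<omega>. (\<Phi> x)\<^sup>2) ((\<Phi> x)\<^sup>2)"
        by (simp add: has_bochner_integral_iff prob_space)
      fix i j assume "i \<in> {1..n}" "j \<in> {1..n}"
      then show "has_bochner_integral M (\<lambda>\<omega>. \<bar>indicator {G i \<omega>..} x - indicator {G j \<omega>..} x\<bar>) (p i j x)"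
        unfolding p_def by (intro has_bochner_integral_integrable integrable_abs Bochner_Integration.integrable_diff int)
    qed
    finally have "E x = (1 - 2 * \<Phi> x) * \<Phi> x + (\<Phi> x)\<^sup>2 - (\<Sum>i=1..n. \<Sum>j=1..n. p i j x) / (2 * (real n)\<^sup>2)"
      using n by simp
    then show ?thesis by (simp add: algebra_simps power2_eq_square)
  qed
  have E0: "0 \<le> E x" for x by (simp add: E_def)
  have [measurable]: "E \<in> borel_measurable lborel"
    unfolding E_def by measurable
  have "(\<integral>\<^sup>+\<omega>. cdf_sqdist n (\<lambda>k. G k \<omega>) \<partial>M)
      = (\<integral>\<^sup>+x. (\<integral>\<^sup>+\<omega>. ennreal ((1 + x\<^sup>2) * (ecount n (\<lambda>k. G k \<omega>) x / real n - \<Phi> x)\<^sup>2) \<partial>M) \<partial>lborel)"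
  proof -
    interpret pair_sigma_finite M "lborel :: real measure" ..
    show ?thesis unfolding cdf_sqdist_def by (rule Fubini'[symmetric]) measurable
  qed
  also have "\<dots> = (\<integral>\<^sup>+x. ennreal ((1 + x\<^sup>2) * E x) \<partial>lborel)"
  proof (intro nn_integral_cong)
    fix x :: real
    have "0 \<le> ecount n v x / real n" "ecount n v x / real n \<le> 1" for v
      using ecount_nonneg[of n v x] ecount_le[of n v x] n by simp_all
    then have "\<bar>ecount n v x / real n - \<Phi> x\<bar> \<le> 1" for v
      using Phi_nonneg[of x] Phi_le_1[of x] by (smt (verit))
    then have "(ecount n v x / real n - \<Phi> x)\<^sup>2 \<le> 1" for v
      by (simp add: abs_square_le_1)
    then have "integrable M (\<lambda>\<omega>. (ecount n (\<lambda>k. G k \<omega>) x / real n - \<Phi> x)\<^sup>2)"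
      by (intro integrable_const_bound[where B = 1]) auto
    then show "(\<integral>\<^sup>+\<omega>. ennreal ((1 + x\<^sup>2) * (ecount n (\<lambda>k. G k \<omega>) x / real n - \<Phi> x)\<^sup>2) \<partial>M) = ennreal ((1 + x\<^sup>2) * E x)"
      by (subst nn_integral_eq_integral) (auto simp: E_def)
  qed
  finally have EJ: "(\<integral>\<^sup>+\<omega>. cdf_sqdist n (\<lambda>k. G k \<omega>) \<partial>M) = (\<integral>\<^sup>+x. ennreal ((1 + x\<^sup>2) * E x) \<partial>lborel)" .
  \<comment> \<open>The identity is integrated as a sum, since subtraction of extended nonnegative
    numbers truncates; the finite term with \<open>Q\<close> is cancelled only at the end.\<close>
  have "(\<integral>\<^sup>+x. ennreal ((1 + x\<^sup>2) * E x) \<partial>lborel) + (\<Sum>i=1..n. \<Sum>j=1..n. ennreal (1 / (2 * (real n)\<^sup>2)) * ennreal (Q i j))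
      = (\<integral>\<^sup>+x. ennreal ((1 + x\<^sup>2) * E x) + (\<Sum>i=1..n. \<Sum>j=1..n. ennreal (1 / (2 * (real n)\<^sup>2)) * ennreal ((1 + x\<^sup>2) * p i j x)) \<partial>lborel)"
  proof -
    let ?f = "\<lambda>i j x. ennreal (1 / (2 * (real n)\<^sup>2)) * ennreal ((1 + x\<^sup>2) * p i j x)"
    have f [measurable]: "?f i j \<in> borel_measurable lborel" if "i \<in> {1..n}" "j \<in> {1..n}" for i j
      using pm[OF that] by measurable
    have "(\<Sum>i=1..n. \<Sum>j=1..n. ennreal (1 / (2 * (real n)\<^sup>2)) * ennreal (Q i j)) = (\<Sum>i=1..n. \<Sum>j=1..n. \<integral>\<^sup>+x. ?f i j x \<partial>lborel)"
      using pm by (intro sum.cong refl) (simp add: nn_integral_cmult p)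
    also have "\<dots> = (\<Sum>i=1..n. \<integral>\<^sup>+x. (\<Sum>j=1..n. ?f i j x) \<partial>lborel)"
      by (intro sum.cong refl nn_integral_sum[symmetric] f)
    also have "\<dots> = (\<integral>\<^sup>+x. (\<Sum>i=1..n. \<Sum>j=1..n. ?f i j x) \<partial>lborel)"
      by (intro nn_integral_sum[symmetric] borel_measurable_sum f)
    finally show ?thesis
      by (subst nn_integral_add) (auto intro!: borel_measurable_sum f simp del: sum_ennreal)
  qed
  also have "\<dots> = (\<integral>\<^sup>+x. ennreal ((1 + x\<^sup>2) * (\<Phi> x * (1 - \<Phi> x))) \<partial>lborel)"
  proof (intro nn_integral_cong)
    fix x :: real
    have "(\<Sum>i=1..n. \<Sum>j=1..n. ennreal (1 / (2 * (real n)\<^sup>2)) * ennreal ((1 + x\<^sup>2) * p i j x))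
        = ennreal (\<Sum>i=1..n. \<Sum>j=1..n. 1 / (2 * (real n)\<^sup>2) * ((1 + x\<^sup>2) * p i j x))"
      by (simp add: ennreal_mult[symmetric] p0 sum_nonneg)
    also have "(\<Sum>i=1..n. \<Sum>j=1..n. 1 / (2 * (real n)\<^sup>2) * ((1 + x\<^sup>2) * p i j x))
        = (1 + x\<^sup>2) * ((\<Sum>i=1..n. \<Sum>j=1..n. p i j x) / (2 * (real n)\<^sup>2))"
      by (simp add: sum_distrib_left sum_divide_distrib mult_ac)
    finally show "ennreal ((1 + x\<^sup>2) * E x) + (\<Sum>i=1..n. \<Sum>j=1..n. ennreal (1 / (2 * (real n)\<^sup>2)) * ennreal ((1 + x\<^sup>2) * p i j x))
       = ennreal ((1 + x\<^sup>2) * (\<Phi> x * (1 - \<Phi> x)))"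
      unfolding E[symmetric] distrib_left
      by (subst ennreal_plus) (auto simp: E0 intro!: mult_nonneg_nonneg divide_nonneg_nonneg sum_nonneg p0)
  qed
  also have "\<dots> = ennreal K"
    by (simp add: nn_integral_Phi_variance K_def)
  also have "(\<Sum>i=1..n. \<Sum>j=1..n. ennreal (1 / (2 * (real n)\<^sup>2)) * ennreal (Q i j))
      = (\<Sum>i=1..n. \<Sum>j=1..n. ennreal (1 / (2 * (real n)\<^sup>2) * Q i j))"
    by (intro sum.cong refl ennreal_mult[symmetric]) (auto simp: Q0)
  also have "\<dots> = ennreal (\<Sum>i=1..n. \<Sum>j=1..n. 1 / (2 * (real n)\<^sup>2) * Q i j)"
  proof -
    let ?c = "1 / (2 * (real n)\<^sup>2)"
    have c: "0 \<le> ?c * Q i j" if "i \<in> {1..n}" "j \<in> {1..n}" for i j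
      using Q0[OF that] by simp
    have "(\<Sum>i=1..n. \<Sum>j=1..n. ennreal (?c * Q i j)) = (\<Sum>i=1..n. ennreal (\<Sum>j=1..n. ?c * Q i j))"
      by (intro sum.cong refl sum_ennreal c)
    also have "\<dots> = ennreal (\<Sum>i=1..n. \<Sum>j=1..n. ?c * Q i j)"
      by (intro sum_ennreal sum_nonneg c)
    finally show ?thesis .
  qed
  finally have "(\<integral>\<^sup>+x. ennreal ((1 + x\<^sup>2) * E x) \<partial>lborel)
      + ennreal (\<Sum>i=1..n. \<Sum>j=1..n. 1 / (2 * (real n)\<^sup>2) * Q i j) = ennreal K" .
  from arg_cong[OF this, of "\<lambda>a. a - ennreal (\<Sum>i=1..n. \<Sum>j=1..n. 1 / (2 * (real n)\<^sup>2) * Q i j)"]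
  have "(\<integral>\<^sup>+x. ennreal ((1 + x\<^sup>2) * E x) \<partial>lborel)
     = ennreal K - ennreal (\<Sum>i=1..n. \<Sum>j=1..n. 1 / (2 * (real n)\<^sup>2) * Q i j)"
    by (simp only: ennreal_add_diff_cancel_right[OF ennreal_neq_top])
  also have "\<dots> = ennreal (K - (\<Sum>i=1..n. \<Sum>j=1..n. 1 / (2 * (real n)\<^sup>2) * Q i j))"
    using Q0 by (intro ennreal_minus sum_nonneg) auto
  also have "K - (\<Sum>i=1..n. \<Sum>j=1..n. 1 / (2 * (real n)\<^sup>2) * Q i j) = (\<Sum>i=1..n. \<Sum>j=1..n. 1 / (2 * (real n)\<^sup>2) * (2 * K - Q i j))"
    using n by (simp add: right_diff_distrib sum_subtractf power2_eq_square)
  \<comment> \<open>The deficit lemma gives the factor \<open>11/6 * sqrt (2/pi) * sqrt 2\<close>,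
    at most \<open>11/3\<close>, which is rounded up to 4.\<close>
  also have "\<dots> \<le> (\<Sum>i=1..n. \<Sum>j=1..n. 1 / (2 * (real n)\<^sup>2) * (4 * \<bar>\<rho> i j\<bar>))"
  proof (intro sum_mono mult_left_mono)
    fix i j assume "i \<in> {1..n}" "j \<in> {1..n}"
    from cubic_distance_deficit[OF \<rho>[OF this]]
    have "sqrt (2 / pi) / 6 * (sqrt 2 * 11 - sqrt (2 - 2 * \<rho> i j) * (11 + \<rho> i j)) \<le> sqrt (2 / pi) / 6 * (11 * sqrt 2 * \<bar>\<rho> i j\<bar>)"
      by (intro mult_left_mono) auto
    moreover have "2 * K - Q i j = sqrt (2 / pi) / 6 * (sqrt 2 * 11 - sqrt (2 - 2 * \<rho> i j) * (11 + \<rho> i j))"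
      by (simp add: K_def Q_def field_simps)
    moreover have "sqrt (2 / pi) / 6 * (11 * sqrt 2 * \<bar>\<rho> i j\<bar>) \<le> 4 * \<bar>\<rho> i j\<bar>"
    proof -
      have "sqrt (2 / pi) * sqrt 2 * \<bar>\<rho> i j\<bar> \<le> 2 * \<bar>\<rho> i j\<bar>"
        by (intro mult_right_mono sqrt_two_over_pi_le) auto
      moreover have "sqrt (2 / pi) / 6 * (11 * sqrt 2 * \<bar>\<rho> i j\<bar>) = 11 / 6 * (sqrt (2 / pi) * sqrt 2 * \<bar>\<rho> i j\<bar>)"
        by simp
      ultimately show ?thesis
        using abs_ge_zero[of "\<rho> i j"] by linarith
    qed
    ultimately show "2 * K - Q i j \<le> 4 * \<bar>\<rho> i j\<bar>" by linarith
  qed auto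
  also have "\<dots> = 2 * (\<Sum>i=1..n. \<Sum>j=1..n. \<bar>\<rho> i j\<bar>) / (real n)\<^sup>2"
    by (simp add: sum_distrib_left sum_divide_distrib)
  finally show ?thesis
    unfolding EJ by (simp add: ennreal_leI)
qed

text \<open>The number of quantiles up to \<open>x\<close> is the integer part of
  \<open>(n + 1) \<Phi>(x)\<close>. Its squared error is at most the variance
  \<open>\<Phi> (1 - \<Phi>) / n\<close> of an empirical distribution function, so the same variance
  integral applies.\<close>

lemma deterministic_cdf_sqdist_le:
  assumes n: "1 \<le> n" and v: "\<And>k. k \<in> {1..n} \<Longrightarrow> v k = inv \<Phi> (real k / real (n + 1))"
  shows "cdf_sqdist n v \<le> ennreal (2 / real n)"
proof -
  have sq: "(ecount n v x / real n - \<Phi> x)\<^sup>2 \<le> \<Phi> x * (1 - \<Phi> x) / real n" for x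
  proof -
    define u where "u = \<Phi> x"
    have u: "0 < u" "u < 1" by (auto simp: u_def Phi_pos Phi_less_1)
    define m where "m = nat \<lfloor>real (n + 1) * u\<rfloor>"
    have m: "real m \<le> real (n + 1) * u" "real (n + 1) * u < real m + 1"
      using u by (auto simp: m_def)
    have "real (n + 1) * u < real (n + 1)" using u by simp
    with m(1) have "m \<le> n" by linarith
    have "indicator {v k..} x = (if k \<le> m then 1 else 0 :: real)" if "k \<in> {1..n}" for k
    proof -
      have "v k \<le> x \<longleftrightarrow> real k / real (n + 1) \<le> u"
        using that unfolding v[OF that] u_def by (intro inv_Phi_le_iff) auto
      also have "\<dots> \<longleftrightarrow> real k \<le> real (n + 1) * u"
        by (simp add: pos_divide_le_eq mult.commute)
      also have "\<dots> \<longleftrightarrow> k \<le> m"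
        using m by linarith
      finally show ?thesis by (simp add: indicator_def)
    qed
    then have "ecount n v x = (\<Sum>k=1..n. if k \<le> m then 1 else 0)"
      unfolding ecount_def by (intro sum.cong) auto
    also have "\<dots> = real (card ({1..n} \<inter> {k. k \<le> m}))"
      by (simp add: sum.If_cases)
    also have "{1..n} \<inter> {k. k \<le> m} = {1..m}"
      using \<open>m \<le> n\<close> by auto
    finally have ec: "ecount n v x = real m" by simp
    have n0: "0 < real n" using n by simp
    \<comment> \<open>Rounding puts \<open>D\<close> between \<open>u - 1\<close> and
      \<open>u\<close>, while \<open>0 \<le> m \<le> n\<close> puts it between \<open>- n u\<close>
      and \<open>n (1 - u)\<close>. Multiplying one bound of each kind gives the binomial
      variance.\<close>
    define D where "D = real m - real n * u"
    have "D\<^sup>2 \<le> real n * (u * (1 - u))"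
    proof (cases "0 \<le> D")
      case True
      have "D * D \<le> u * (real n * (1 - u))"
        using True m \<open>m \<le> n\<close> u by (intro mult_mono) (auto simp: D_def algebra_simps)
      then show ?thesis by (simp add: power2_eq_square mult_ac)
    next
      case False
      have "(- D) * (- D) \<le> (1 - u) * (real n * u)"
        using False m u by (intro mult_mono) (auto simp: D_def algebra_simps)
      then show ?thesis by (simp add: power2_eq_square mult_ac)
    qed
    then have "D\<^sup>2 / (real n)\<^sup>2 \<le> real n * (u * (1 - u)) / (real n)\<^sup>2"
      by (intro divide_right_mono) auto
    moreover have "(ecount n v x / real n - u)\<^sup>2 = D\<^sup>2 / (real n)\<^sup>2"
      using n0 by (simp add: ec D_def power_divide[symmetric] diff_divide_distrib)
    moreover have "real n * (u * (1 - u)) / (real n)\<^sup>2 = u * (1 - u) / real n"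
      using n0 by (simp add: power2_eq_square)
    ultimately show ?thesis by (simp add: u_def)
  qed
  have "cdf_sqdist n v \<le> (\<integral>\<^sup>+x. ennreal (1 / real n) * ennreal ((1 + x\<^sup>2) * (\<Phi> x * (1 - \<Phi> x))) \<partial>lborel)"
    unfolding cdf_sqdist_def
  proof (intro nn_integral_mono)
    fix x :: real
    have "(1 + x\<^sup>2) * (ecount n v x / real n - \<Phi> x)\<^sup>2 \<le> (1 + x\<^sup>2) * (\<Phi> x * (1 - \<Phi> x) / real n)"
      using sq by (intro mult_left_mono) auto
    then show "ennreal ((1 + x\<^sup>2) * (ecount n v x / real n - \<Phi> x)\<^sup>2)
        \<le> ennreal (1 / real n) * ennreal ((1 + x\<^sup>2) * (\<Phi> x * (1 - \<Phi> x)))"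
      by (simp add: ennreal_mult'[symmetric] ennreal_leI mult_ac)
  qed
  also have "\<dots> = ennreal (1 / real n * (sqrt (2 / pi) * sqrt 2 * 11 / 12))"
    by (subst nn_integral_cmult) (auto simp: nn_integral_Phi_variance ennreal_mult'[symmetric])
  also have "\<dots> \<le> ennreal (2 / real n)"
  proof (rule ennreal_leI)
    have "sqrt (2 / pi) * sqrt 2 * 11 / 12 \<le> 2"
      using sqrt_two_over_pi_le by simp
    then have "1 / real n * (sqrt (2 / pi) * sqrt 2 * 11 / 12) \<le> 1 / real n * 2"
      by (intro mult_left_mono) auto
    then show "1 / real n * (sqrt (2 / pi) * sqrt 2 * 11 / 12) \<le> 2 / real n" by simp
  qed
  finally show ?thesis .
qed

section \<open>Fractional Gaussian noise\<close>

text \<open>\<open>gaussian_process\<close> only asserts that some mean and deviation exist. These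
  two moments let the covariance formula pin them down, and they supply the integrability under
  which integrals are additive.\<close>

lemma normal_law_moments:
  assumes "0 \<le> s"
  shows "has_bochner_integral (normal_law m s) (\<lambda>y. y) m"
    and "has_bochner_integral (normal_law m s) (\<lambda>y. y\<^sup>2) (m\<^sup>2 + s\<^sup>2)"
proof -
  have "has_bochner_integral (normal_law m s) (\<lambda>y. y) m \<and> has_bochner_integral (normal_law m s) (\<lambda>y. y\<^sup>2) (m\<^sup>2 + s\<^sup>2)"
  proof (cases "s = 0")
    case True
    have dirac: "has_bochner_integral (return borel m) f (f m)" if [measurable]: "f \<in> borel_measurable borel" for f :: "real \<Rightarrow> real"
    proof -
      interpret prob_space "return borel m"
        by (rule prob_space_return) simp
      have "AE y in return borel m. f y = f m"
        by (subst AE_return) auto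
      then have "has_bochner_integral (return borel m) f (f m) \<longleftrightarrow> has_bochner_integral (return borel m) (\<lambda>_. f m) (f m)"
        by (intro has_bochner_integral_cong_AE) auto
      then show ?thesis
        using prob_space by (simp add: has_bochner_integral_iff)
    qed
    have "normal_law m s = return borel m" "m\<^sup>2 + s\<^sup>2 = m\<^sup>2"
      using True by (simp_all add: normal_law_def)
    then show ?thesis
      by (simp only:) (intro conjI dirac borel_measurable_power measurable_ident_sets refl)
  next
    case False
    with assms have s: "0 < s" by simp
    have 1: "has_bochner_integral lborel (\<lambda>y. normal_density m s y * y) m"
      by (rule normal_moment_nz_1[OF s])
    have 2: "has_bochner_integral lborel (\<lambda>y. normal_density m s y * (y - m) ^ (2 * 1)) (fact (2 * 1) / ((2 / s\<^sup>2) ^ 1 * fact 1))"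
      by (rule normal_moment_even[OF s])
    have 0: "has_bochner_integral lborel (\<lambda>y. normal_density m s y) 1"
      using s by (simp add: has_bochner_integral_iff)
    have "has_bochner_integral lborel (\<lambda>y. normal_density m s y * (y - m) ^ (2 * 1) + 2 * m * (normal_density m s y * y) - m\<^sup>2 * normal_density m s y)
        (fact (2 * 1) / ((2 / s\<^sup>2) ^ 1 * fact 1) + 2 * m * m - m\<^sup>2 * 1)"
      by (intro has_bochner_integral_add has_bochner_integral_diff has_bochner_integral_mult_right 0 1 2)
    moreover have "normal_density m s y * (y - m) ^ (2 * 1) + 2 * m * (normal_density m s y * y) - m\<^sup>2 * normal_density m s y
        = normal_density m s y * y\<^sup>2" for y
      by (simp add: power2_eq_square algebra_simps)
    moreover have "fact (2 * 1) / ((2 / s\<^sup>2) ^ 1 * fact 1) + 2 * m * m - m\<^sup>2 * 1 = m\<^sup>2 + s\<^sup>2"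
      by (simp add: power2_eq_square)
    ultimately have 3: "has_bochner_integral lborel (\<lambda>y. normal_density m s y * y\<^sup>2) (m\<^sup>2 + s\<^sup>2)"
      by (simp only:)
    show ?thesis
      using 1 3 False by (simp add: normal_law_def has_bochner_integral_density)
  qed
  then show "has_bochner_integral (normal_law m s) (\<lambda>y. y) m"
    and "has_bochner_integral (normal_law m s) (\<lambda>y. y\<^sup>2) (m\<^sup>2 + s\<^sup>2)"
    by auto
qed

lemma normal_law_distr_moments:
  assumes "0 \<le> s" and [measurable]: "L \<in> borel_measurable M" and L: "distr M borel L = normal_law m s"
  shows "has_bochner_integral M L m" and "has_bochner_integral M (\<lambda>x. (L x)\<^sup>2) (m\<^sup>2 + s\<^sup>2)"
  using normal_law_moments[OF \<open>0 \<le> s\<close>, of m] unfolding L[symmetric]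
  by (simp_all add: has_bochner_integral_iff integrable_distr_eq integral_distr)

text \<open>The unknown parameters of the Gaussian law are identified by integrating the combination
  and its square. Times are indexed by \<open>K\<close> rather than collected in a set, so
  repetitions are allowed.\<close>

lemma fBm_combination:
  fixes d t :: "'i \<Rightarrow> real"
  assumes Z: "standard_fBm M T H Z" and K: "finite K" "t ` K \<subseteq> {0..T}"
  defines "R \<equiv> \<lambda>s t. (s powr (2 * H) + t powr (2 * H) - \<bar>s - t\<bar> powr (2 * H)) / 2"
  defines "V \<equiv> \<Sum>m\<in>K. \<Sum>l\<in>K. d m * d l * R (t m) (t l)"
  shows "distr M borel (\<lambda>x. \<Sum>m\<in>K. d m * Z (t m) x) = normal_law 0 (sqrt V)" and "0 \<le> V"
proof -
  have GP: "gaussian_process M {0..T} Z" and mean: "\<And>s. s \<in> {0..T} \<Longrightarrow> integral\<^sup>L M (Z s) = 0"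
    and cov: "\<And>s u. s \<in> {0..T} \<Longrightarrow> u \<in> {0..T} \<Longrightarrow> integral\<^sup>L M (\<lambda>x. Z s x * Z u x) = R s u"
    using Z by (auto simp: standard_fBm_def R_def)
  have meas [measurable]: "Z s \<in> borel_measurable M" if "s \<in> {0..T}" for s
    using GP that by (auto simp: gaussian_process_def)
  have comb: "\<exists>m s. 0 \<le> s \<and> distr M borel (\<lambda>x. \<Sum>t\<in>J. c t * Z t x) = normal_law m s"
    if "finite J" "J \<subseteq> {0..T}" for J c
    using GP that by (auto simp: gaussian_process_def)
  have int: "integrable M (Z s)" and sq: "integrable M (\<lambda>x. (Z s x)\<^sup>2)" if s: "s \<in> {0..T}" for s
  proof -
    obtain m v where "0 \<le> v" "distr M borel (Z s) = normal_law m v"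
      using comb[of "{s}" "\<lambda>_. 1"] s by auto
    from normal_law_distr_moments[OF this(1) meas[OF s] this(2)]
    show "integrable M (Z s)" "integrable M (\<lambda>x. (Z s x)\<^sup>2)"
      by (auto simp: has_bochner_integral_iff)
  qed
  have prod: "integrable M (\<lambda>x. Z s x * Z u x)" if su: "s \<in> {0..T}" "u \<in> {0..T}" for s u
  proof (rule Bochner_Integration.integrable_bound)
    show "integrable M (\<lambda>x. (Z s x)\<^sup>2 + (Z u x)\<^sup>2)"
      using sq su by auto
    have "\<bar>a * b\<bar> \<le> \<bar>a\<^sup>2 + b\<^sup>2\<bar>" for a b :: real
    proof -
      have "0 \<le> \<bar>a\<bar> * \<bar>b\<bar>" by simp
      then show ?thesis
        using sum_squares_bound[of "\<bar>a\<bar>" "\<bar>b\<bar>"]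
        unfolding abs_mult power2_abs by linarith
    qed
    then show "AE x in M. norm (Z s x * Z u x) \<le> norm ((Z s x)\<^sup>2 + (Z u x)\<^sup>2)"
      by auto
  qed (use su in measurable)
  define L where "L = (\<lambda>x. \<Sum>m\<in>K. d m * Z (t m) x)"
  have tK: "t m \<in> {0..T}" if "m \<in> K" for m
    using K(2) that by auto
  have Lm: "L \<in> borel_measurable M"
    unfolding L_def using tK by measurable
  \<comment> \<open>Equal times are merged, because \<open>gaussian_process\<close> takes a set of
    times with one coefficient each.\<close>
  have "L = (\<lambda>x. \<Sum>s\<in>t ` K. (\<Sum>m | m \<in> K \<and> t m = s. d m) * Z s x)"
    unfolding L_def
    by (intro ext, subst sum.image_gen[OF K(1), of _ t]) (auto simp: sum_distrib_right intro!: sum.cong)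
  then obtain m v where v: "0 \<le> v" "distr M borel L = normal_law m v"
    using comb[of "t ` K" "\<lambda>s. \<Sum>m | m \<in> K \<and> t m = s. d m"] K by auto
  note mom = normal_law_distr_moments[OF v(1) Lm v(2)]
  have "integral\<^sup>L M L = (\<Sum>m\<in>K. d m * 0)"
    unfolding L_def using int mean tK by (subst Bochner_Integration.integral_sum) (auto intro!: sum.cong)
  then have "m = 0"
    using mom(1) by (simp add: has_bochner_integral_iff)
  have "(L x)\<^sup>2 = (\<Sum>m\<in>K. \<Sum>l\<in>K. d m * d l * (Z (t m) x * Z (t l) x))" for x
    by (simp add: L_def power2_eq_square sum_product mult_ac)
  then have "integral\<^sup>L M (\<lambda>x. (L x)\<^sup>2) = integral\<^sup>L M (\<lambda>x. \<Sum>m\<in>K. \<Sum>l\<in>K. d m * d l * (Z (t m) x * Z (t l) x))"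
    by simp
  also have "\<dots> = V"
    unfolding V_def using prod tK
    by (subst Bochner_Integration.integral_sum)
       (auto intro!: sum.cong Bochner_Integration.integrable_sum simp: cov Bochner_Integration.integral_sum)
  finally have "v\<^sup>2 = V"
    using mom(2) \<open>m = 0\<close> by (simp add: has_bochner_integral_iff)
  with v \<open>m = 0\<close> show "distr M borel (\<lambda>x. \<Sum>m\<in>K. d m * Z (t m) x) = normal_law 0 (sqrt V)" "0 \<le> V"
    by (auto simp: L_def real_sqrt_unique)
qed

text \<open>Autocovariance of fractional Gaussian noise with unit steps: half the second difference
  of \<open>|x|^(2H)\<close> at lag \<open>i - j\<close>.\<close>

definition fgn_cov :: "real \<Rightarrow> nat \<Rightarrow> nat \<Rightarrow> real" where
  "fgn_cov H i j = (\<bar>real i - real j + 1\<bar> powr (2 * H) + \<bar>real i - real j - 1\<bar> powr (2 * H)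
     - 2 * \<bar>real i - real j\<bar> powr (2 * H)) / 2"

text \<open>Self-similarity: the normalisation by \<open>(T/n)^(-H)\<close> cancels the mesh from
  all covariances, leaving unit variances and a correlation that depends on the lag only.\<close>

lemma fgn_gaussian_pair:
  assumes Z: "standard_fBm M T H Z" and T: "0 < T"
    and ij: "i \<in> {1..n}" "j \<in> {1..n}"
  shows "gaussian_pair M (scaled_increment T H Z n i) (scaled_increment T H Z n j) (fgn_cov H i j)"
proof -
  define h where "h = T / real n"
  define \<kappa> where "\<kappa> = h powr (- H)"
  have h: "0 < h" using T ij by (simp add: h_def)
  have \<kappa>: "\<kappa> * \<kappa> * h powr (2 * H) = 1"
    using h by (simp add: \<kappa>_def powr_add[symmetric])
  \<comment> \<open>The four endpoints are listed with multiplicity: they coincide partly for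
    neighbouring indices and in pairs for \<open>i = j\<close>.\<close>
  define t where "t m = [h * real i, h * (real i - 1), h * real j, h * (real j - 1)] ! m" for m
  have "h * y \<in> {0..T}" if "0 \<le> y" "y \<le> real n" for y
    using T h that ij mult_left_mono[OF that(2), of h] by (simp add: h_def)
  then have tT: "t ` {..<4} \<subseteq> {0..T}"
    using ij by (auto simp: t_def numeral_eq_Suc less_Suc_eq)
  define D where "D y = \<bar>y\<bar> powr (2 * H)" for y
  have D: "\<bar>h * y - h * z\<bar> powr (2 * H) = h powr (2 * H) * D (y - z)" for y z
    using h by (simp add: D_def right_diff_distrib[symmetric] abs_mult powr_mult)
  have D_minus: "D (y - z) = D (z - y)" for y z
    by (simp add: D_def abs_minus_commute)
  have sum4: "(\<Sum>m<4. f m) = f 0 + f 1 + f 2 + f (3::nat)" for f :: "nat \<Rightarrow> real"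
    by (simp add: numeral_eq_Suc)
  have key: "distr M borel (\<lambda>x. a * scaled_increment T H Z n i x + b * scaled_increment T H Z n j x)
        = normal_law 0 (sqrt (a\<^sup>2 + b\<^sup>2 + 2 * a * b * fgn_cov H i j)) \<and> 0 \<le> a\<^sup>2 + b\<^sup>2 + 2 * a * b * fgn_cov H i j" for a b
  proof -
    define d where "d m = [a * \<kappa>, - (a * \<kappa>), b * \<kappa>, - (b * \<kappa>)] ! m" for m
    define R where "R s t = (s powr (2 * H) + t powr (2 * H) - \<bar>s - t\<bar> powr (2 * H)) / 2" for s t
    have "(\<Sum>m<4. d m * Z (t m) x) = a * scaled_increment T H Z n i x + b * scaled_increment T H Z n j x" for x
      unfolding sum4 by (simp add: d_def t_def scaled_increment_def \<kappa>_def h_def numeral_eq_Suc algebra_simps)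
    moreover have "(\<Sum>m<4. \<Sum>l<4. d m * d l * R (t m) (t l)) = a\<^sup>2 + b\<^sup>2 + 2 * a * b * fgn_cov H i j"
    proof -
      have t: "t 0 = h * real i" "t 1 = h * (real i - 1)" "t 2 = h * real j" "t 3 = h * (real j - 1)"
        and d: "d 0 = a * \<kappa>" "d 1 = - (a * \<kappa>)" "d 2 = b * \<kappa>" "d 3 = - (b * \<kappa>)"
        by (simp_all add: t_def d_def numeral_eq_Suc)
      \<comment> \<open>In a rectangular increment of the covariance the powers of single times
        cancel, which is the stationarity of the increments.\<close>
      have inc: "R u1 v1 - R u1 v2 - R u2 v1 + R u2 v2
          = (\<bar>u1 - v2\<bar> powr (2 * H) + \<bar>u2 - v1\<bar> powr (2 * H) - \<bar>u1 - v1\<bar> powr (2 * H) - \<bar>u2 - v2\<bar> powr (2 * H)) / 2" for u1 u2 v1 v2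
        by (simp add: R_def field_simps)
      have inc': "R (h * y) (h * z) - R (h * y) (h * (z - 1)) - R (h * (y - 1)) (h * z) + R (h * (y - 1)) (h * (z - 1))
          = h powr (2 * H) * ((D (y - z + 1) + D (y - z - 1) - 2 * D (y - z)) / 2)" for y z
        unfolding inc D by (simp add: algebra_simps)
      have D01: "D 0 = 0" "D 1 = 1" "D (- 1) = 1"
        by (simp_all add: D_def)
      have ii: "R (h * y) (h * y) - R (h * y) (h * (y - 1)) - R (h * (y - 1)) (h * y) + R (h * (y - 1)) (h * (y - 1)) = h powr (2 * H)" for y
        unfolding inc' by (simp add: D01)
      have ij: "R (h * real i) (h * real j) - R (h * real i) (h * (real j - 1)) - R (h * (real i - 1)) (h * real j) + R (h * (real i - 1)) (h * (real j - 1))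
          = h powr (2 * H) * fgn_cov H i j"
        unfolding inc' by (simp add: D_def fgn_cov_def)
      have R_sym: "R u v = R v u" for u v
        by (simp add: R_def abs_minus_commute)
      have expand: "(a * \<kappa> * (a * \<kappa>) * r11 + a * \<kappa> * - (a * \<kappa>) * r12 + a * \<kappa> * (b * \<kappa>) * r13 + a * \<kappa> * - (b * \<kappa>) * r14)
          + (- (a * \<kappa>) * (a * \<kappa>) * r21 + - (a * \<kappa>) * - (a * \<kappa>) * r22 + - (a * \<kappa>) * (b * \<kappa>) * r23 + - (a * \<kappa>) * - (b * \<kappa>) * r24)
          + (b * \<kappa> * (a * \<kappa>) * r13 + b * \<kappa> * - (a * \<kappa>) * r23 + b * \<kappa> * (b * \<kappa>) * r33 + b * \<kappa> * - (b * \<kappa>) * r34)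
          + (- (b * \<kappa>) * (a * \<kappa>) * r14 + - (b * \<kappa>) * - (a * \<kappa>) * r24 + - (b * \<kappa>) * (b * \<kappa>) * r43 + - (b * \<kappa>) * - (b * \<kappa>) * r44)
        = (\<kappa> * \<kappa>) * (a\<^sup>2 * (r11 - r12 - r21 + r22) + b\<^sup>2 * (r33 - r34 - r43 + r44) + 2 * a * b * (r13 - r14 - r23 + r24))"
        for r11 r12 r13 r14 r21 r22 r23 r24 r33 r34 r43 r44 :: real
        by (simp add: power2_eq_square algebra_simps)
      have "(\<Sum>m<4. \<Sum>l<4. d m * d l * R (t m) (t l))
        = (\<kappa> * \<kappa>) * (a\<^sup>2 * (R (h * real i) (h * real i) - R (h * real i) (h * (real i - 1)) - R (h * (real i - 1)) (h * real i) + R (h * (real i - 1)) (h * (real i - 1)))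
         + b\<^sup>2 * (R (h * real j) (h * real j) - R (h * real j) (h * (real j - 1)) - R (h * (real j - 1)) (h * real j) + R (h * (real j - 1)) (h * (real j - 1)))
         + 2 * a * b * (R (h * real i) (h * real j) - R (h * real i) (h * (real j - 1)) - R (h * (real i - 1)) (h * real j) + R (h * (real i - 1)) (h * (real j - 1))))"
        unfolding sum4 t d R_sym[of "h * real j" "h * real i"] R_sym[of "h * real j" "h * (real i - 1)"]
          R_sym[of "h * (real j - 1)" "h * real i"] R_sym[of "h * (real j - 1)" "h * (real i - 1)"]
        by (rule expand)
      also have "\<dots> = (\<kappa> * \<kappa> * h powr (2 * H)) * (a\<^sup>2 + b\<^sup>2 + 2 * a * b * fgn_cov H i j)"
        unfolding ii ij by (simp add: algebra_simps)
      finally show ?thesis by (simp add: \<kappa>)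
    qed
    ultimately show ?thesis
      using fBm_combination[OF Z finite_lessThan tT, of d] unfolding R_def by simp
  qed
  \<comment> \<open>The variances of the sum and the difference, \<open>2 + 2 \<rho>\<close> and
    \<open>2 - 2 \<rho>\<close>, are nonnegative.\<close>
  have "\<bar>fgn_cov H i j\<bar> \<le> 1"
    using key[of 1 1] key[of 1 "- 1"] by (auto simp: abs_le_iff)
  moreover have "scaled_increment T H Z n k \<in> borel_measurable M" if "k \<in> {1..n}" for k
  proof -
    have "T * y / real n \<in> {0..T}" if "0 \<le> y" "y \<le> real n" for y
      using T that by (auto simp: divide_le_eq mult_left_mono)
    then have "T * real k / real n \<in> {0..T}" "T * (real k - 1) / real n \<in> {0..T}"
      using that by auto
    then have "Z (T * real k / real n) \<in> borel_measurable M" "Z (T * (real k - 1) / real n) \<in> borel_measurable M"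
      using Z by (auto simp: standard_fBm_def gaussian_process_def)
    then show ?thesis
      unfolding scaled_increment_def[abs_def] by measurable
  qed
  ultimately show ?thesis
    using key ij by (auto simp: gaussian_pair_def)
qed

section \<open>Signs and sums of the noise covariances\<close>

lemma powr_bernoulli_le:
  fixes x :: real
  assumes "0 < a" "a \<le> 1" "0 \<le> x"
  shows "x powr a \<le> 1 + a * (x - 1)"
proof (cases "x = 0")
  case False
  then show ?thesis
    using Youngs_inequality_0[of a "1 - a" x 1] assms by (simp add: algebra_simps)
qed (use assms in simp)

text \<open>The case of exponents at most one, applied to \<open>x powr a\<close> with exponent
  \<open>1/a\<close>.\<close>

lemma powr_bernoulli_ge:
  fixes x :: real
  assumes "1 \<le> a" "0 \<le> x"
  shows "1 + a * (x - 1) \<le> x powr a"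
proof -
  have "(x powr a) powr (1 / a) \<le> 1 + 1 / a * (x powr a - 1)"
    using assms by (intro powr_bernoulli_le) auto
  then have "x \<le> 1 + 1 / a * (x powr a - 1)"
    using assms by (simp add: powr_powr)
  then have "a * x \<le> a * (1 + 1 / a * (x powr a - 1))"
    using assms by (intro mult_left_mono) auto
  then show ?thesis using assms by (simp add: algebra_simps)
qed

text \<open>After division by \<open>d powr a\<close>, the Bernoulli inequalities at
  \<open>1 + 1/d\<close> and \<open>1 - 1/d\<close> have opposite linear terms, which cancel in the
  sum. \<open>d \<ge> 1\<close> keeps the second point nonnegative.\<close>

lemma powr_second_difference:
  fixes d :: real
  assumes "1 \<le> d" "0 < a"
  shows "a \<le> 1 \<Longrightarrow> (d + 1) powr a + (d - 1) powr a - 2 * d powr a \<le> 0"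
    and "1 \<le> a \<Longrightarrow> 0 \<le> (d + 1) powr a + (d - 1) powr a - 2 * d powr a"
proof -
  have "(d + 1) powr a + (d - 1) powr a - 2 * d powr a
      = d powr a * ((1 + 1 / d) powr a + (1 - 1 / d) powr a - 2)"
  proof -
    have "d * (1 + 1 / d) = d + 1" "d * (1 - 1 / d) = d - 1"
      using assms by (auto simp: algebra_simps)
    then have "(d + 1) powr a = d powr a * (1 + 1 / d) powr a" "(d - 1) powr a = d powr a * (1 - 1 / d) powr a"
      using assms powr_mult[of d "1 + 1 / d" a] powr_mult[of d "1 - 1 / d" a] by auto
    then show ?thesis by (simp add: algebra_simps)
  qed
  moreover have "a \<le> 1 \<Longrightarrow> (1 + 1 / d) powr a + (1 - 1 / d) powr a - 2 \<le> 0"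
    using powr_bernoulli_le[of a "1 + 1 / d"] powr_bernoulli_le[of a "1 - 1 / d"] assms by simp
  moreover have "1 \<le> a \<Longrightarrow> 0 \<le> (1 + 1 / d) powr a + (1 - 1 / d) powr a - 2"
    using powr_bernoulli_ge[of a "1 + 1 / d"] powr_bernoulli_ge[of a "1 - 1 / d"] assms by simp
  ultimately show "a \<le> 1 \<Longrightarrow> (d + 1) powr a + (d - 1) powr a - 2 * d powr a \<le> 0"
    and "1 \<le> a \<Longrightarrow> 0 \<le> (d + 1) powr a + (d - 1) powr a - 2 * d powr a"
    by (auto simp: mult_nonneg_nonpos)
qed

text \<open>The sum of the unit-step increments up to \<open>n\<close> is the process at time
  \<open>n\<close>, whose variance is \<open>n^(2H)\<close>. Analytically, each entry is a mixed
  difference of the covariance \<open>c\<close>, and the double sum telescopes in both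
  indices.\<close>

lemma sum_fgn_cov: "(\<Sum>i=1..n. \<Sum>j=1..n. fgn_cov H i j) = real n powr (2 * H)"
proof -
  define c where "c i j = (real i powr (2 * H) + real j powr (2 * H) - \<bar>real i - real j\<bar> powr (2 * H)) / 2" for i j
  have tele: "(\<Sum>k=1..n. f k - f (k - 1)) = f n - f (0::nat)" for f :: "nat \<Rightarrow> real"
    by (induction n) auto
  have "fgn_cov H i j = (c i j - c (i - 1) j) - (c i (j - 1) - c (i - 1) (j - 1))"
    if "i \<in> {1..n}" "j \<in> {1..n}" for i j
  proof -
    have r: "real (i - 1) = real i - 1" "real (j - 1) = real j - 1"
      using that by auto
    show ?thesis
      unfolding c_def r fgn_cov_def by (simp add: field_simps)
  qed
  then have "(\<Sum>i=1..n. \<Sum>j=1..n. fgn_cov H i j)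
      = (\<Sum>i=1..n. \<Sum>j=1..n. (c i j - c (i - 1) j) - (c i (j - 1) - c (i - 1) (j - 1)))"
    by (intro sum.cong) auto
  also have "\<dots> = (\<Sum>i=1..n. (c i n - c (i - 1) n) - (c i 0 - c (i - 1) 0))"
    by (intro sum.cong refl tele)
  also have "\<dots> = (\<Sum>i=1..n. (c i n - c i 0) - (c (i - 1) n - c (i - 1) 0))"
    by (intro sum.cong refl) simp
  also have "\<dots> = (c n n - c n 0) - (c 0 n - c 0 0)"
    by (rule tele)
  also have "\<dots> = real n powr (2 * H)"
    by (simp add: c_def)
  finally show ?thesis .
qed

text \<open>Off the diagonal the covariances are all nonpositive for \<open>H \<le> 1/2\<close> and all nonnegative for
  \<open>H \<ge> 1/2\<close>, so the absolute values can be removed.\<close>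

lemma sum_abs_fgn_cov_le:
  assumes "0 < H" "1 \<le> n"
  shows "(\<Sum>i=1..n. \<Sum>j=1..n. \<bar>fgn_cov H i j\<bar>) \<le> 2 * real n powr (max 1 (2 * H))"
proof -
  have diag: "fgn_cov H i i = 1" for i
    by (simp add: fgn_cov_def)
  define d where "d i j = \<bar>real i - real j\<bar>" for i j
  have off: "1 \<le> d i j \<and> fgn_cov H i j = ((d i j + 1) powr (2 * H) + (d i j - 1) powr (2 * H) - 2 * d i j powr (2 * H)) / 2"
    if "i \<noteq> j" for i j
  proof (cases "i < j")
    case True
    then have "\<bar>real i - real j\<bar> = d i j" "\<bar>real i - real j + 1\<bar> = d i j - 1" "\<bar>real i - real j - 1\<bar> = d i j + 1" "1 \<le> d i j"
      by (auto simp: d_def)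
    then show ?thesis by (simp only: fgn_cov_def) simp
  next
    case False
    with that have "\<bar>real i - real j\<bar> = d i j" "\<bar>real i - real j + 1\<bar> = d i j + 1" "\<bar>real i - real j - 1\<bar> = d i j - 1" "1 \<le> d i j"
      by (auto simp: d_def)
    then show ?thesis by (simp only: fgn_cov_def)
  qed
  show ?thesis
  proof (cases "2 * H \<le> 1")
    case True
    \<comment> \<open>The sign of the whole matrix is flipped and the diagonal entries 1 are
      restored as \<open>2 - 1\<close>, so that the telescoped total can be used.\<close>
    have "\<bar>fgn_cov H i j\<bar> = (if i = j then 2 else 0) - fgn_cov H i j" for i j
    proof (cases "i = j")
      case False
      then have "fgn_cov H i j \<le> 0"
        using off[OF False] powr_second_difference(1)[of "d i j" "2 * H"] True \<open>0 < H\<close> by auto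
      with False show ?thesis by simp
    qed (simp add: diag)
    then have "(\<Sum>i=1..n. \<Sum>j=1..n. \<bar>fgn_cov H i j\<bar>) = 2 * real n - real n powr (2 * H)"
      by (simp add: sum_subtractf sum_fgn_cov[simplified])
    also have "\<dots> \<le> 2 * real n powr (max 1 (2 * H))"
      using True assms by (simp add: max_def)
    finally show ?thesis .
  next
    case False
    have "\<bar>fgn_cov H i j\<bar> = fgn_cov H i j" for i j
    proof (cases "i = j")
      case neq: False
      then show ?thesis
        using off[OF neq] powr_second_difference(2)[of "d i j" "2 * H"] False by auto
    qed (simp add: diag)
    then have "(\<Sum>i=1..n. \<Sum>j=1..n. \<bar>fgn_cov H i j\<bar>) = real n powr (2 * H)"
      by (simp add: sum_fgn_cov[simplified])
    then show ?thesis using False by (simp add: max_def)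
  qed
qed

text \<open>The exponent \<open>max 1 (2H) - 2\<close> is twice the negative of
  \<open>min (1 - H) (1/2)\<close>; for \<open>H > 1/2\<close> long memory makes it slower than
  independent sampling.\<close>

lemma (in prob_space) fgn_expected_cdf_sqdist_le:
  assumes Z: "standard_fBm M T H Z" and "0 < T" "0 < H" "1 \<le> n"
  shows "(\<integral>\<^sup>+\<omega>. cdf_sqdist n (\<lambda>k. scaled_increment T H Z n k \<omega>) \<partial>M)
    \<le> ennreal (4 * (real n powr (- min (1 - H) (1 / 2)))\<^sup>2)"
proof -
  have "(\<integral>\<^sup>+\<omega>. cdf_sqdist n (\<lambda>k. scaled_increment T H Z n k \<omega>) \<partial>M)
     \<le> ennreal (2 * (\<Sum>i=1..n. \<Sum>j=1..n. \<bar>fgn_cov H i j\<bar>) / (real n)\<^sup>2)"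
    by (intro expected_cdf_sqdist_le fgn_gaussian_pair[OF Z \<open>0 < T\<close>] \<open>1 \<le> n\<close>)
  also have "\<dots> \<le> ennreal (2 * (2 * real n powr (max 1 (2 * H))) / (real n)\<^sup>2)"
    by (intro ennreal_leI divide_right_mono mult_left_mono sum_abs_fgn_cov_le assms) auto
  also have "2 * (2 * real n powr (max 1 (2 * H))) / (real n)\<^sup>2 = 4 * real n powr (max 1 (2 * H) - 2)"
    using \<open>1 \<le> n\<close> by (simp add: powr_diff)
  also have "max 1 (2 * H) - 2 = - min (1 - H) (1 / 2) + - min (1 - H) (1 / 2)"
    by (auto simp: min_def max_def)
  also have "real n powr \<dots> = (real n powr (- min (1 - H) (1 / 2)))\<^sup>2"
    by (simp only: powr_add power2_eq_square)
  finally show ?thesis .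
qed

text \<open>The same estimate with the identity as correlation matrix, whose absolute entries add up
  to \<open>n\<close>.\<close>

lemma (in prob_space) iid_expected_cdf_sqdist_le:
  assumes indep: "indep_vars (\<lambda>_. borel) \<xi> {1..n}"
    and distr: "\<And>k. k \<in> {1..n} \<Longrightarrow> distr M borel (\<xi> k) = std_normal_distribution" and n: "1 \<le> n"
  shows "(\<integral>\<^sup>+\<omega>. cdf_sqdist n (\<lambda>k. \<xi> k \<omega>) \<partial>M) \<le> ennreal (2 / real n)"
proof -
  have meas: "\<xi> k \<in> borel_measurable M" if "k \<in> {1..n}" for k
    using indep that by (auto simp: indep_vars_def)
  have "gaussian_pair M (\<xi> i) (\<xi> j) (if i = j then 1 else 0)" if ij: "i \<in> {1..n}" "j \<in> {1..n}" for i j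
  proof (cases "i = j")
    case True
    have "distr M borel (\<lambda>x. a * \<xi> i x + b * \<xi> i x) = normal_law 0 (sqrt (a\<^sup>2 + b\<^sup>2 + 2 * a * b * 1))" for a b
    proof -
      have "a\<^sup>2 + b\<^sup>2 + 2 * a * b * 1 = (a + b)\<^sup>2"
        by (simp add: power2_sum)
      then show ?thesis
        using normal_law_scale[OF prob_space_axioms meas[OF ij(1)] distr[OF ij(1)], of "a + b"]
        by (simp add: distrib_right)
    qed
    with True meas[OF ij(1)] show ?thesis by (simp add: gaussian_pair_def)
  next
    case False
    have "indep_var borel ((\<lambda>f. f i) \<circ> (\<lambda>x. \<lambda>k\<in>{i}. \<xi> k x)) borel ((\<lambda>f. f j) \<circ> (\<lambda>x. \<lambda>k\<in>{j}. \<xi> k x))"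
      by (rule indep_var_compose[OF indep_var_restrict[OF indep, of "{i}" "{j}"]]) (use ij False in auto)
    then have "indep_var borel (\<xi> i) borel (\<xi> j)"
      by (simp add: comp_def)
    with False show ?thesis
      using gaussian_pair_indep[of "\<xi> i" "\<xi> j"] distr ij by simp
  qed
  then have "(\<integral>\<^sup>+\<omega>. cdf_sqdist n (\<lambda>k. \<xi> k \<omega>) \<partial>M)
      \<le> ennreal (2 * (\<Sum>i=1..n. \<Sum>j=1..n. \<bar>if i = j then 1 else 0\<bar>) / (real n)\<^sup>2)"
    by (intro expected_cdf_sqdist_le n)
  also have "(\<Sum>i=1..n. \<Sum>j=1..n. \<bar>if i = j then 1 else 0\<bar>) = real n"
    by (simp add: if_distrib[of abs] cong: if_cong)
  finally show ?thesis
    using n by (simp add: power2_eq_square)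
qed

text \<open>The free parameter of \<open>cdf_dist_le\<close> is set to the root mean square rate
  \<open>d\<close> itself, which balances its two terms; the constant comes from
  \<open>pi/2 + 2 \<le> 4\<close>.\<close>

lemma (in prob_space) expected_cdf_dist_le:
  assumes meas: "\<And>k. k \<in> {1..n} \<Longrightarrow> G k \<in> borel_measurable M"
    and le: "(\<integral>\<^sup>+\<omega>. cdf_sqdist n (\<lambda>k. G k \<omega>) \<partial>M) \<le> ennreal (4 * d\<^sup>2)" and d: "0 < d"
  shows "(\<integral>\<^sup>+\<omega>. cdf_dist n (\<lambda>k. G k \<omega>) \<partial>M) \<le> ennreal (4 * d)"
proof -
  have [measurable]: "(\<lambda>\<omega>. cdf_sqdist n (\<lambda>k. G k \<omega>)) \<in> borel_measurable M"
    unfolding cdf_sqdist_def using meas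
    by (intro lborel.borel_measurable_nn_integral) (auto simp: case_prod_beta' intro!: borel_measurable_ecount measurable_compose[OF measurable_fst])
  have "(\<integral>\<^sup>+\<omega>. cdf_dist n (\<lambda>k. G k \<omega>) \<partial>M) \<le> (\<integral>\<^sup>+\<omega>. ennreal (d * pi / 2) + ennreal (1 / (2 * d)) * cdf_sqdist n (\<lambda>k. G k \<omega>) \<partial>M)"
    by (intro nn_integral_mono cdf_dist_le d)
  also have "\<dots> = ennreal (d * pi / 2) + ennreal (1 / (2 * d)) * (\<integral>\<^sup>+\<omega>. cdf_sqdist n (\<lambda>k. G k \<omega>) \<partial>M)"
    by (subst nn_integral_add) (auto simp: nn_integral_cmult emeasure_space_1)
  also have "\<dots> \<le> ennreal (d * pi / 2) + ennreal (1 / (2 * d)) * ennreal (4 * d\<^sup>2)"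
    by (intro add_left_mono mult_left_mono le) auto
  also have "\<dots> = ennreal (d * pi / 2 + 1 / (2 * d) * (4 * d\<^sup>2))"
    using d by (simp add: ennreal_mult'[symmetric])
  also have "d * pi / 2 + 1 / (2 * d) * (4 * d\<^sup>2) \<le> 4 * d"
    using d pi_less_4 by (simp add: power2_eq_square field_simps)
  finally show ?thesis by (simp add: ennreal_leI)
qed

section \<open>Pathwise error bound\<close>

text \<open>Triangle inequality through \<open>\<Phi>\<close>, after the sorted vectors have been
  replaced by their counting functions.\<close>

lemma sum_abs_diff_le_cdf_dist:
  assumes "mono_on {1..n} a" "mono_on {1..n} b" "0 \<le> A" "0 \<le> B"
    and "cdf_dist n a \<le> ennreal A" "cdf_dist n b \<le> ennreal B"
  shows "(\<Sum>k=1..n. \<bar>a k - b k\<bar>) \<le> real n * (A + B)"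
proof (cases "n = 0")
  case False
  then have n: "0 < real n" by simp
  have "ennreal (\<Sum>k=1..n. \<bar>a k - b k\<bar>) = (\<integral>\<^sup>+x. ennreal \<bar>ecount n a x - ecount n b x\<bar> \<partial>lborel)"
    by (rule sum_abs_diff_mono_on) fact+
  also have "\<dots> \<le> (\<integral>\<^sup>+x. ennreal (real n) * (ennreal \<bar>ecount n a x / real n - \<Phi> x\<bar> + ennreal \<bar>ecount n b x / real n - \<Phi> x\<bar>) \<partial>lborel)"
  proof (intro nn_integral_mono)
    fix x
    have "\<bar>ecount n a x - ecount n b x\<bar> = real n * \<bar>(ecount n a x / real n - \<Phi> x) - (ecount n b x / real n - \<Phi> x)\<bar>"
      using n by (simp add: diff_divide_distrib[symmetric])
    also have "\<dots> \<le> real n * (\<bar>ecount n a x / real n - \<Phi> x\<bar> + \<bar>ecount n b x / real n - \<Phi> x\<bar>)"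
      by (intro mult_left_mono abs_triangle_ineq4) auto
    finally show "ennreal \<bar>ecount n a x - ecount n b x\<bar>
      \<le> ennreal (real n) * (ennreal \<bar>ecount n a x / real n - \<Phi> x\<bar> + ennreal \<bar>ecount n b x / real n - \<Phi> x\<bar>)"
      by (simp add: ennreal_mult'[symmetric] ennreal_plus[symmetric] ennreal_leI del: ennreal_plus)
  qed
  also have "\<dots> = ennreal (real n) * (cdf_dist n a + cdf_dist n b)"
    by (subst nn_integral_cmult) (auto simp: nn_integral_add cdf_dist_def)
  also have "\<dots> \<le> ennreal (real n) * (ennreal A + ennreal B)"
    by (intro mult_left_mono add_mono assms) auto
  also have "\<dots> = ennreal (real n * (A + B))"
    using assms by (simp add: ennreal_mult)
  finally show ?thesis
    using assms by (subst (asm) ennreal_le_iff) auto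
qed simp

section \<open>From the L1 distance to a lower bound for the weighted moments\<close>

lemma cdf_dist_ge:
  assumes "0 \<le> c" "p \<le> q" and "\<And>x. x \<in> {p..q} \<Longrightarrow> c \<le> \<bar>ecount n v x / real n - \<Phi> x\<bar>"
  shows "ennreal (c * (q - p)) \<le> cdf_dist n v"
proof -
  have "ennreal (c * (q - p)) = (\<integral>\<^sup>+x. ennreal c * indicator {p..q} x \<partial>lborel)"
    using assms by (subst nn_integral_cmult_indicator) (auto simp: ennreal_mult')
  also have "\<dots> \<le> cdf_dist n v"
    unfolding cdf_dist_def using assms(3)
    by (intro nn_integral_mono) (auto simp: indicator_def intro!: ennreal_leI)
  finally show ?thesis .
qed

text \<open>An L1 bound does not control single values, but both functions are monotone: a deficit
  at \<open>q\<close> relative to the value of \<open>\<Phi>\<close> at \<open>p\<close> persists on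
  all of \<open>[p, q]\<close> and so costs at least its size times the length.\<close>

lemma ecount_ge_of_cdf_dist:
  assumes I: "cdf_dist n v \<le> ennreal I" "0 \<le> I" and "p < q"
  shows "\<Phi> p - I / (q - p) \<le> ecount n v q / real n"
proof (rule ccontr)
  define c where "c = \<Phi> p - ecount n v q / real n"
  assume "\<not> ?thesis"
  then have c: "I / (q - p) < c" by (simp add: c_def)
  moreover have "0 \<le> I / (q - p)" using assms by simp
  ultimately have "0 < c" by linarith
  have "ennreal (c * (q - p)) \<le> cdf_dist n v"
  proof (rule cdf_dist_ge)
    fix x assume "x \<in> {p..q}"
    then have "\<Phi> p \<le> \<Phi> x" "ecount n v x / real n \<le> ecount n v q / real n"
      by (auto intro: Phi_mono divide_right_mono ecount_mono)
    then show "c \<le> \<bar>ecount n v x / real n - \<Phi> x\<bar>"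
      by (simp add: c_def)
  qed (use \<open>0 < c\<close> \<open>p < q\<close> in auto)
  then have "ennreal (c * (q - p)) \<le> ennreal I" using I by order
  then have "c * (q - p) \<le> I" using I by simp
  with c \<open>p < q\<close> show False by (simp add: field_simps)
qed

lemma ecount_le_of_cdf_dist:
  assumes I: "cdf_dist n v \<le> ennreal I" "0 \<le> I" and "p < q"
  shows "ecount n v p / real n \<le> \<Phi> q + I / (q - p)"
proof (rule ccontr)
  define c where "c = ecount n v p / real n - \<Phi> q"
  assume "\<not> ?thesis"
  then have c: "I / (q - p) < c" by (simp add: c_def)
  moreover have "0 \<le> I / (q - p)" using assms by simp
  ultimately have "0 < c" by linarith
  have "ennreal (c * (q - p)) \<le> cdf_dist n v"
  proof (rule cdf_dist_ge)
    fix x assume "x \<in> {p..q}"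
    then have "\<Phi> x \<le> \<Phi> q" "ecount n v p / real n \<le> ecount n v x / real n"
      by (auto intro: Phi_mono divide_right_mono ecount_mono)
    then show "c \<le> \<bar>ecount n v x / real n - \<Phi> x\<bar>"
      by (simp add: c_def)
  qed (use \<open>0 < c\<close> \<open>p < q\<close> in auto)
  then have "ennreal (c * (q - p)) \<le> ennreal I" using I by order
  then have "c * (q - p) \<le> I" using I by simp
  with c \<open>p < q\<close> show False by (simp add: field_simps)
qed

lemma weight_bounded_below_on_interval:
  fixes \<omega> :: "real \<Rightarrow> real"
  assumes cont: "continuous_on UNIV \<omega>" and nonneg: "\<And>u. 0 \<le> \<omega> u" and nz: "\<omega> u0 \<noteq> 0"
  obtains a b c where "a < b" "0 < c" "\<And>x. x \<in> {a..b} \<Longrightarrow> c \<le> \<omega> x * \<bar>x\<bar> ^ r"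
proof -
  have near: "\<exists>\<delta>>0. \<forall>x. \<bar>x - u\<bar> < \<delta> \<longrightarrow> f u / 2 < f x" if "continuous_on UNIV f" "0 < f u" for f :: "real \<Rightarrow> real" and u
  proof -
    have "isCont f u"
      using that by (simp add: continuous_on_eq_continuous_at)
    then have "\<forall>\<^sub>F x in at u. f u / 2 < f x"
      unfolding isCont_def by (rule order_tendstoD(1)) (use that in simp)
    then obtain \<delta> where "0 < \<delta>" and \<delta>: "\<And>x. x \<noteq> u \<Longrightarrow> dist x u < \<delta> \<Longrightarrow> f u / 2 < f x"
      by (auto simp: eventually_at)
    moreover have "f u / 2 < f u" using that by simp
    ultimately have "f u / 2 < f x" if "\<bar>x - u\<bar> < \<delta>" for x
      using \<delta>[of x] that by (cases "x = u") (auto simp: dist_real_def)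
    with \<open>0 < \<delta>\<close> show ?thesis by blast
  qed
  have "0 < \<omega> u0" using nonneg[of u0] nz by simp
  then obtain \<delta> where \<delta>: "0 < \<delta>" "\<And>x. \<bar>x - u0\<bar> < \<delta> \<Longrightarrow> \<omega> u0 / 2 < \<omega> x"
    using near[OF cont] by blast
  \<comment> \<open>The factor \<open>|x|^r\<close> vanishes at the origin, so a weight that is
    positive there is used at a nearby nonzero point.\<close>
  define u1 where "u1 = (if u0 = 0 then \<delta> / 2 else u0)"
  have "u1 \<noteq> 0" "\<bar>u1 - u0\<bar> < \<delta>" using \<delta> by (auto simp: u1_def)
  with \<delta> \<open>0 < \<omega> u0\<close> have "0 < \<omega> u1 * \<bar>u1\<bar> ^ r"
    by (smt (verit) mult_pos_pos zero_less_power field_sum_of_halves)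
  moreover have "continuous_on UNIV (\<lambda>x. \<omega> x * \<bar>x\<bar> ^ r)"
    by (intro continuous_intros cont)
  ultimately obtain \<epsilon> where \<epsilon>: "0 < \<epsilon>" "\<And>x. \<bar>x - u1\<bar> < \<epsilon> \<Longrightarrow> \<omega> u1 * \<bar>u1\<bar> ^ r / 2 < \<omega> x * \<bar>x\<bar> ^ r"
    using near[of "\<lambda>x. \<omega> x * \<bar>x\<bar> ^ r" u1] by blast
  show thesis
  proof (rule that[of "u1 - \<epsilon> / 2" "u1 + \<epsilon> / 2" "\<omega> u1 * \<bar>u1\<bar> ^ r / 2"])
    fix x assume "x \<in> {u1 - \<epsilon> / 2..u1 + \<epsilon> / 2}"
    then have "\<bar>x - u1\<bar> < \<epsilon>" using \<open>0 < \<epsilon>\<close> by (auto simp: abs_less_iff)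
    from \<epsilon>(2)[OF this] show "\<omega> u1 * \<bar>u1\<bar> ^ r / 2 \<le> \<omega> x * \<bar>x\<bar> ^ r" by simp
  qed (use \<open>0 < \<epsilon>\<close> \<open>0 < \<omega> u1 * \<bar>u1\<bar> ^ r\<close> in auto)
qed

text \<open>This moment is the denominator of the estimator error and must grow linearly in
  \<open>n\<close>. An interval where the integrand is at least \<open>c\<close> receives a fixed
  share of the points as soon as their empirical law is close to the normal one.\<close>

lemma weighted_moment_bounded_below:
  fixes \<omega> :: "real \<Rightarrow> real"
  assumes cont: "continuous_on UNIV \<omega>" and nonneg: "\<And>u. 0 \<le> \<omega> u" and nz: "\<omega> u0 \<noteq> 0"
  obtains c \<eta> where "0 < c" "0 < \<eta>"
    "\<And>n v. 1 \<le> n \<Longrightarrow> cdf_dist n v \<le> ennreal \<eta> \<Longrightarrow> c * real n \<le> (\<Sum>k=1..n. \<omega> (v k) * \<bar>v k\<bar> ^ r)"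
proof -
  obtain a b c where ab: "a < b" and c: "0 < c" "\<And>x. x \<in> {a..b} \<Longrightarrow> c \<le> \<omega> x * \<bar>x\<bar> ^ r"
    using weight_bounded_below_on_interval[OF cont nonneg nz] by metis
  \<comment> \<open>A third of the interval is given up at each end for the shifts in the pointwise
    bounds. The threshold \<open>l * \<Delta> / 4\<close> makes each end lose
    \<open>\<Delta> / 4\<close>, so that half of the normal mass \<open>\<Delta>\<close> of the
    middle third remains.\<close>
  define l where "l = (b - a) / 3"
  define \<Delta> where "\<Delta> = \<Phi> (b - l) - \<Phi> (a + l)"
  have l: "0 < l" "a + l < b - l" using ab by (auto simp: l_def field_simps)
  then have "0 < \<Delta>" by (simp add: \<Delta>_def Phi_strict_mono)
  show thesis
  proof (rule that[of "c * (\<Delta> / 2)" "l * \<Delta> / 4"])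
    fix n v assume n: "1 \<le> n" and I: "cdf_dist n v \<le> ennreal (l * \<Delta> / 4)"
    have I0: "0 \<le> l * \<Delta> / 4" using l \<open>0 < \<Delta>\<close> by simp
    have eq: "l * \<Delta> / 4 / l = \<Delta> / 4" using l by simp
    have "\<Phi> (b - l) - \<Delta> / 4 \<le> ecount n v b / real n"
      using ecount_ge_of_cdf_dist[OF I I0, of "b - l" b] l by (simp add: eq)
    moreover have "ecount n v a / real n \<le> \<Phi> (a + l) + \<Delta> / 4"
      using ecount_le_of_cdf_dist[OF I I0, of a "a + l"] l by (simp add: eq)
    ultimately have "\<Phi> (b - l) - \<Delta> / 4 - (\<Phi> (a + l) + \<Delta> / 4) \<le> ecount n v b / real n - ecount n v a / real n"
      by (rule diff_mono)
    moreover have "\<Phi> (b - l) - \<Delta> / 4 - (\<Phi> (a + l) + \<Delta> / 4) = \<Delta> / 2"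
      by (simp add: \<Delta>_def field_simps)
    ultimately have "\<Delta> / 2 \<le> ecount n v b / real n - ecount n v a / real n"
      by simp
    then have "\<Delta> / 2 * real n \<le> ecount n v b - ecount n v a"
      using n by (simp add: diff_divide_distrib[symmetric] field_simps)
    then have "c * (\<Delta> / 2) * real n \<le> c * (ecount n v b - ecount n v a)"
      using c by (simp add: mult_left_mono)
    also have "\<dots> = (\<Sum>k=1..n. c * (indicator {v k..} b - indicator {v k..} a))"
      by (simp only: ecount_def sum_subtractf[symmetric] sum_distrib_left)
    also have "\<dots> \<le> (\<Sum>k=1..n. \<omega> (v k) * \<bar>v k\<bar> ^ r)"
      using c ab nonneg by (intro sum_mono) (auto simp: indicator_def)
    finally show "c * (\<Delta> / 2) * real n \<le> (\<Sum>k=1..n. \<omega> (v k) * \<bar>v k\<bar> ^ r)" .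
  qed (use c l \<open>0 < \<Delta>\<close> in auto)
qed

text \<open>For \<open>r = 1\<close>, comparison with the competitor \<open>\<sigma>\<close> costs a
  factor 2. For \<open>r = 2\<close>, comparing objective values would bring in squared errors; the
  first-order condition keeps them to the first power, with influence at most \<open>B\<close>. The
  factor \<open>max 2 B\<close> serves both cases.\<close>

lemma argmin_error:
  fixes w v \<psi> :: "nat \<Rightarrow> real"
  assumes w: "\<And>k. k \<in> {1..n} \<Longrightarrow> w k \<in> {0..1}" and B: "\<And>k. k \<in> {1..n} \<Longrightarrow> w k * \<bar>\<psi> k\<bar> \<le> B"
    and r: "r \<in> {1, 2}" and s: "is_arg_min (objective r n w v \<psi>) (\<lambda>_. True) s"
  shows "\<bar>s - \<sigma>\<bar> * (\<Sum>k=1..n. w k * \<bar>\<psi> k\<bar> ^ r) \<le> max 2 B * (\<Sum>k=1..n. \<bar>rearr n v k - \<sigma> * \<psi> k\<bar>)"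
proof -
  define x where "x = rearr n v"
  define E where "E = (\<Sum>k=1..n. \<bar>x k - \<sigma> * \<psi> k\<bar>)"
  have E0: "0 \<le> E" by (auto simp: E_def intro: sum_nonneg)
  have min: "(\<Sum>k=1..n. w k * \<bar>x k - s * \<psi> k\<bar> ^ r) \<le> (\<Sum>k=1..n. w k * \<bar>x k - y * \<psi> k\<bar> ^ r)" for y
    using s by (auto simp: is_arg_min_def objective_def x_def not_less)
  have "\<bar>s - \<sigma>\<bar> * (\<Sum>k=1..n. w k * \<bar>\<psi> k\<bar> ^ r) \<le> max 2 B * E"
  proof (cases "r = 1")
    case True
    have "\<bar>s - \<sigma>\<bar> * (\<Sum>k=1..n. w k * \<bar>\<psi> k\<bar> ^ r) = (\<Sum>k=1..n. w k * \<bar>(x k - \<sigma> * \<psi> k) - (x k - s * \<psi> k)\<bar>)"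
      using True by (simp add: sum_distrib_left left_diff_distrib[symmetric] abs_mult mult_ac)
    also have "\<dots> \<le> (\<Sum>k=1..n. w k * \<bar>x k - \<sigma> * \<psi> k\<bar> + w k * \<bar>x k - s * \<psi> k\<bar>)"
      using w unfolding distrib_left[symmetric] by (intro sum_mono mult_left_mono abs_triangle_ineq4) auto
    also have "\<dots> \<le> 2 * (\<Sum>k=1..n. w k * \<bar>x k - \<sigma> * \<psi> k\<bar>)"
      using min[of \<sigma>] True by (simp add: sum.distrib)
    also have "\<dots> \<le> 2 * E"
      unfolding E_def using w by (intro mult_left_mono sum_mono mult_left_le_one_le) auto
    also have "\<dots> \<le> max 2 B * E"
      using E0 by (intro mult_right_mono) auto
    finally show ?thesis .
  next
    case False
    with r have "r = 2" by simp
    define D N where "D = (\<Sum>k=1..n. w k * (\<psi> k)\<^sup>2)" and "N = (\<Sum>k=1..n. w k * \<psi> k * (x k - s * \<psi> k))"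
    have D0: "0 \<le> D" unfolding D_def using w by (intro sum_nonneg) auto
    have quad: "0 \<le> h * h * D - 2 * h * N" for h
    proof -
      have "w k * (x k - (s + h) * \<psi> k)\<^sup>2 = w k * (x k - s * \<psi> k)\<^sup>2 + h * h * (w k * (\<psi> k)\<^sup>2) - 2 * h * (w k * \<psi> k * (x k - s * \<psi> k))" for k
        by (simp add: power2_eq_square algebra_simps)
      then have "(\<Sum>k=1..n. w k * (x k - (s + h) * \<psi> k)\<^sup>2) = (\<Sum>k=1..n. w k * (x k - s * \<psi> k)\<^sup>2) + h * h * D - 2 * h * N"
        by (simp add: sum.distrib sum_subtractf sum_distrib_left[symmetric] D_def N_def)
      then show ?thesis using min[of "s + h"] \<open>r = 2\<close> by simp
    qed
    have "N = 0"
    proof (rule ccontr)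
      assume "N \<noteq> 0"
      \<comment> \<open>A step in the direction of descent; the summand 1 keeps the quotient
        meaningful when \<open>D = 0\<close>, and the resulting change \<open>- h^2 (D + 2)\<close>
        contradicts minimality.\<close>
      define h where "h = N / (D + 1)"
      have "h * (D + 1) = N" using D0 by (simp add: h_def)
      then have "h * h * D - 2 * h * N = - (h * h * (D + 2))" by (auto simp: algebra_simps)
      moreover have "h \<noteq> 0"
        using D0 \<open>N \<noteq> 0\<close> by (simp add: h_def)
      then have "0 < h * h"
        using not_real_square_gt_zero[of h] by blast
      then have "0 < h * h * (D + 2)"
        by (rule mult_pos_pos) (use D0 in simp)
      ultimately show False using quad[of h] by linarith
    qed
    \<comment> \<open>Replacing \<open>s\<close> by \<open>\<sigma>\<close> in the normal equation
      leaves exactly \<open>(s - \<sigma>) D\<close>.\<close>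
    have "w k * \<psi> k * (x k - \<sigma> * \<psi> k) = w k * \<psi> k * (x k - s * \<psi> k) + (s - \<sigma>) * (w k * (\<psi> k)\<^sup>2)" for k
      by (simp add: power2_eq_square algebra_simps)
    then have "(\<Sum>k=1..n. w k * \<psi> k * (x k - \<sigma> * \<psi> k)) = N + (s - \<sigma>) * D"
      by (simp add: sum.distrib N_def D_def sum_distrib_left)
    then have "\<bar>s - \<sigma>\<bar> * D = \<bar>\<Sum>k=1..n. w k * \<psi> k * (x k - \<sigma> * \<psi> k)\<bar>"
      using D0 \<open>N = 0\<close> by (simp add: abs_mult)
    also have "\<dots> \<le> (\<Sum>k=1..n. \<bar>w k * \<psi> k * (x k - \<sigma> * \<psi> k)\<bar>)"
      by (rule sum_abs)
    also have "\<dots> \<le> (\<Sum>k=1..n. B * \<bar>x k - \<sigma> * \<psi> k\<bar>)"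
    proof (intro sum_mono)
      fix k assume k: "k \<in> {1..n}"
      have "\<bar>w k * \<psi> k * (x k - \<sigma> * \<psi> k)\<bar> = w k * \<bar>\<psi> k\<bar> * \<bar>x k - \<sigma> * \<psi> k\<bar>"
        using w[OF k] by (simp add: abs_mult)
      also have "\<dots> \<le> B * \<bar>x k - \<sigma> * \<psi> k\<bar>"
        by (intro mult_right_mono B k) auto
      finally show "\<bar>w k * \<psi> k * (x k - \<sigma> * \<psi> k)\<bar> \<le> B * \<bar>x k - \<sigma> * \<psi> k\<bar>" .
    qed
    also have "\<dots> = B * E" by (simp add: E_def sum_distrib_left)
    also have "\<dots> \<le> max 2 B * E"
      using E0 by (intro mult_right_mono) auto
    finally show ?thesis using \<open>r = 2\<close> by (simp add: D_def)
  qed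
  then show ?thesis by (simp add: E_def x_def)
qed

text \<open>On the unit interval around zero the bound on the weight suffices; outside it,
  \<open>|u|\<close> is at most \<open>u^2\<close>.\<close>

lemma weight_times_abs_bounded:
  fixes \<omega> :: "real \<Rightarrow> real"
  assumes "\<And>u. \<omega> u \<in> {0..1}" and "bdd_above (range (\<lambda>u. u\<^sup>2 * \<omega> u))"
  obtains B where "\<And>u. \<omega> u * \<bar>u\<bar> \<le> B"
proof -
  obtain C where C: "\<And>u. u\<^sup>2 * \<omega> u \<le> C"
    using assms(2) by (auto simp: bdd_above_def)
  have "\<omega> u * \<bar>u\<bar> \<le> max 1 C" for u
  proof (cases "\<bar>u\<bar> \<le> 1")
    case True
    then have "\<omega> u * \<bar>u\<bar> \<le> 1 * 1" using assms(1)[of u] by (intro mult_mono) auto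
    then show ?thesis by simp
  next
    case False
    then have "\<bar>u\<bar> * 1 \<le> \<bar>u\<bar> * \<bar>u\<bar>" by (intro mult_left_mono) auto
    then have "\<omega> u * \<bar>u\<bar> \<le> \<omega> u * u\<^sup>2"
      using assms(1)[of u] by (intro mult_left_mono) (auto simp: power2_eq_square)
    with C[of u] show ?thesis by (simp add: mult.commute)
  qed
  then show thesis by (rule that)
qed

text \<open>A deterministic statement, whose constants are chosen before \<open>n\<close> and all
  vectors. \<open>g\<close> is a reference vector, later the fractional noise; the restriction
  \<open>b \<le> \<eta>\<close> is what keeps the denominator of order \<open>n\<close>.\<close>

lemma estimator_error_bound:
  fixes \<omega> :: "real \<Rightarrow> real"
  assumes cont: "continuous_on UNIV \<omega>" and \<omega>: "\<And>u. \<omega> u \<in> {0..1}"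
    and bdd: "bdd_above (range (\<lambda>u. u\<^sup>2 * \<omega> u))" and nz: "\<exists>u. \<omega> u \<noteq> 0"
    and r: "r \<in> {1, 2}" and \<sigma>: "0 < \<sigma>"
  obtains C \<eta> where "0 < C" "0 < \<eta>"
    "\<And>n v g \<psi> s a b. 1 \<le> n \<Longrightarrow> mono_on {1..n} \<psi> \<Longrightarrow>
      is_arg_min (objective r n (\<lambda>k. \<omega> (\<psi> k)) v \<psi>) (\<lambda>_. True) s \<Longrightarrow>
      0 \<le> a \<Longrightarrow> 0 \<le> b \<Longrightarrow> b \<le> \<eta> \<Longrightarrow> cdf_dist n g \<le> ennreal a \<Longrightarrow> cdf_dist n \<psi> \<le> ennreal b \<Longrightarrow>
      \<bar>s - \<sigma>\<bar> \<le> C * ((\<Sum>k=1..n. \<bar>v k - \<sigma> * g k\<bar>) / real n + a + b)"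
proof -
  obtain u0 where u0: "\<omega> u0 \<noteq> 0" using nz by blast
  obtain B where B: "\<And>u. \<omega> u * \<bar>u\<bar> \<le> B"
    using weight_times_abs_bounded[OF \<omega> bdd] by blast
  obtain c \<eta> where c: "0 < c" and \<eta>: "0 < \<eta>"
    and low: "\<And>n v. 1 \<le> n \<Longrightarrow> cdf_dist n v \<le> ennreal \<eta> \<Longrightarrow> c * real n \<le> (\<Sum>k=1..n. \<omega> (v k) * \<bar>v k\<bar> ^ r)"
    using weighted_moment_bounded_below[OF cont _ u0, of r] \<omega> by (metis atLeastAtMost_iff)
  define C where "C = max 2 B / c * max 1 \<sigma>"
  have m: "0 < max 2 B" by simp
  have C: "0 < C" using c by (auto simp: C_def)
  show thesis
  proof (rule that[OF C \<eta>])
    fix n v g \<psi> s a b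
    assume n: "1 \<le> n" and mono: "mono_on {1..n} \<psi>"
      and s: "is_arg_min (objective r n (\<lambda>k. \<omega> (\<psi> k)) v \<psi>) (\<lambda>_. True) s"
      and ab: "0 \<le> a" "0 \<le> b" "b \<le> \<eta>" and g: "cdf_dist n g \<le> ennreal a" and \<psi>: "cdf_dist n \<psi> \<le> ennreal b"
    have n0: "0 < real n" using n by simp
    have "cdf_dist n \<psi> \<le> ennreal \<eta>"
      using \<psi> ab(3) by (meson ennreal_leI order_trans)
    from low[OF n this] have "\<bar>s - \<sigma>\<bar> * (c * real n) \<le> \<bar>s - \<sigma>\<bar> * (\<Sum>k=1..n. \<omega> (\<psi> k) * \<bar>\<psi> k\<bar> ^ r)"
      by (intro mult_left_mono) auto
    also have "\<dots> \<le> max 2 B * (\<Sum>k=1..n. \<bar>rearr n v k - \<sigma> * \<psi> k\<bar>)"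
      using \<omega> B by (intro argmin_error[OF _ _ r s]) auto
    \<comment> \<open>The sorted reference vector is inserted in between: optimal coupling handles
      the distance to the data, the passage through \<open>\<Phi>\<close> the distance to the
      proxy.\<close>
    also have "(\<Sum>k=1..n. \<bar>rearr n v k - \<sigma> * \<psi> k\<bar>)
       \<le> (\<Sum>k=1..n. \<bar>rearr n v k - \<sigma> * rearr n g k\<bar> + \<sigma> * \<bar>rearr n g k - \<psi> k\<bar>)"
    proof (intro sum_mono)
      fix k
      have "\<bar>rearr n v k - \<sigma> * \<psi> k\<bar> \<le> \<bar>rearr n v k - \<sigma> * rearr n g k\<bar> + \<bar>\<sigma> * (rearr n g k - \<psi> k)\<bar>"
        by (simp add: right_diff_distrib)
      then show "\<bar>rearr n v k - \<sigma> * \<psi> k\<bar> \<le> \<bar>rearr n v k - \<sigma> * rearr n g k\<bar> + \<sigma> * \<bar>rearr n g k - \<psi> k\<bar>"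
        using \<sigma> by (simp add: abs_mult)
    qed
    also have "\<dots> = (\<Sum>k=1..n. \<bar>rearr n v k - \<sigma> * rearr n g k\<bar>) + \<sigma> * (\<Sum>k=1..n. \<bar>rearr n g k - \<psi> k\<bar>)"
      by (simp add: sum.distrib sum_distrib_left)
    also have "\<dots> \<le> (\<Sum>k=1..n. \<bar>v k - \<sigma> * g k\<bar>) + \<sigma> * (real n * (a + b))"
      using g \<psi> ab mono \<sigma>
      by (intro add_mono sum_abs_diff_rearr_le mult_left_mono sum_abs_diff_le_cdf_dist mono_on_rearr)
         (auto simp: cdf_dist_rearr)
    also have "\<dots> \<le> max 1 \<sigma> * (\<Sum>k=1..n. \<bar>v k - \<sigma> * g k\<bar>) + max 1 \<sigma> * (real n * (a + b))"
    proof (intro add_mono mult_right_mono)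
      have "1 * (\<Sum>k=1..n. \<bar>v k - \<sigma> * g k\<bar>) \<le> max 1 \<sigma> * (\<Sum>k=1..n. \<bar>v k - \<sigma> * g k\<bar>)"
        by (intro mult_right_mono sum_nonneg) auto
      then show "(\<Sum>k=1..n. \<bar>v k - \<sigma> * g k\<bar>) \<le> max 1 \<sigma> * (\<Sum>k=1..n. \<bar>v k - \<sigma> * g k\<bar>)" by simp
    qed (use ab in auto)
    also have "\<dots> = max 1 \<sigma> * real n * ((\<Sum>k=1..n. \<bar>v k - \<sigma> * g k\<bar>) / real n + a + b)"
      using n0 by (simp add: field_simps)
    finally have "\<bar>s - \<sigma>\<bar> * (c * real n) \<le> C * ((\<Sum>k=1..n. \<bar>v k - \<sigma> * g k\<bar>) / real n + a + b) * (c * real n)"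
      using c m by (simp add: C_def mult_ac)
    then show "\<bar>s - \<sigma>\<bar> \<le> C * ((\<Sum>k=1..n. \<bar>v k - \<sigma> * g k\<bar>) / real n + a + b)"
      using c n0 by simp
  qed
qed

section \<open>Bounds in probability\<close>

lemma measurable_cdf_dist:
  assumes "\<And>k. k \<in> {1..n} \<Longrightarrow> G k \<in> borel_measurable M"
  shows "(\<lambda>\<omega>. cdf_dist n (\<lambda>k. G k \<omega>)) \<in> borel_measurable M"
  unfolding cdf_dist_def using assms
  by (intro lborel.borel_measurable_nn_integral)
     (auto simp: case_prod_beta' intro!: borel_measurable_ecount measurable_compose[OF measurable_fst])

lemma cdf_dist_cong: "(\<And>k. k \<in> {1..n} \<Longrightarrow> u k = v k) \<Longrightarrow> cdf_dist n u = cdf_dist n v"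
  unfolding cdf_dist_def ecount_def by simp

lemma (in prob_space) markov_tail:
  assumes [measurable]: "f \<in> borel_measurable M" and f: "(\<integral>\<^sup>+x. f x \<partial>M) \<le> ennreal m" and "0 < t" "0 \<le> m"
  shows "prob {x \<in> space M. ennreal t < f x} \<le> m / t"
proof -
  let ?A = "{x \<in> space M. ennreal t < f x}"
  have "ennreal (t * prob ?A) = (\<integral>\<^sup>+x. ennreal t * indicator ?A x \<partial>M)"
    using \<open>0 < t\<close> by (subst nn_integral_cmult_indicator) (auto simp: emeasure_eq_measure ennreal_mult')
  also have "\<dots> \<le> (\<integral>\<^sup>+x. f x \<partial>M)"
    by (intro nn_integral_mono) (auto simp: indicator_def)
  finally have "ennreal (t * prob ?A) \<le> ennreal m"
    using f by order
  then have "t * prob ?A \<le> m"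
    using \<open>0 \<le> m\<close> by simp
  then show ?thesis
    using \<open>0 < t\<close> by (simp add: field_simps)
qed

text \<open>The events that some \<open>f n\<close> exceeds \<open>m\<close> decrease in
  \<open>m\<close> to a null set. Continuity from above gives one level that works for all
  \<open>n\<close> at once.\<close>

lemma (in prob_space) tail_small_of_AE_bounded:
  fixes f :: "nat \<Rightarrow> 'a \<Rightarrow> real"
  assumes meas [measurable]: "\<And>n. f n \<in> borel_measurable M" and bdd: "AE x in M. \<exists>c. \<forall>n. f n x \<le> c" and "0 < \<epsilon>"
  obtains Q where "0 \<le> Q" "\<And>n. prob {x \<in> space M. Q < f n x} \<le> \<epsilon>"
proof -
  define A where "A m = {x \<in> space M. \<exists>n. real m < f n x}" for m :: nat
  have [measurable]: "A m \<in> sets M" for m unfolding A_def by measurable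
  have "AE x in M. x \<notin> (\<Inter>m. A m)"
    using bdd
  proof eventually_elim
    case (elim x)
    then obtain c where c: "\<And>n. f n x \<le> c" by blast
    obtain m :: nat where "c \<le> real m" using real_arch_simple by blast
    with c have "x \<notin> A m" by (auto simp: A_def not_less intro: order_trans)
    then show ?case by blast
  qed
  then have "prob (\<Inter>m. A m) = 0"
    by (subst prob_eq_0) auto
  moreover have "(\<lambda>m. prob (A m)) \<longlonglongrightarrow> prob (\<Inter>m. A m)"
  proof (rule finite_Lim_measure_decseq)
    show "decseq A"
      unfolding decseq_def A_def by safe (meson le_less_trans of_nat_le_iff)
  qed auto
  ultimately have "\<forall>\<^sub>F m in sequentially. prob (A m) < \<epsilon>"
    using \<open>0 < \<epsilon>\<close> by (auto dest: order_tendstoD)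
  then obtain m where m: "prob (A m) < \<epsilon>"
    by (auto simp: eventually_sequentially)
  show thesis
  proof (rule that[of "real m"])
    fix n
    have "prob {x \<in> space M. real m < f n x} \<le> prob (A m)"
      by (rule finite_measure_mono) (auto simp: A_def)
    with m show "prob {x \<in> space M. real m < f n x} \<le> \<epsilon>" by simp
  qed simp
qed

text \<open>Tightness concerns every index, the hypothesis only large ones. The finitely many others
  are tight individually, and the largest of the levels is taken. Halving \<open>\<epsilon>\<close>
  provides the strict inequality in \<open>tight\<close>.\<close>

lemma (in prob_space) bigO_probI:
  assumes meas [measurable]: "\<And>n. \<zeta> n \<in> borel_measurable M"
    and ev: "\<And>\<epsilon>. 0 < \<epsilon> \<Longrightarrow> \<exists>K N. \<forall>n\<ge>N. prob {x \<in> space M. K < \<bar>\<zeta> n x / \<beta> n\<bar>} \<le> \<epsilon>"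
  shows "bigO_prob M \<zeta> \<beta>"
  unfolding bigO_prob_def tight_def
proof (intro conjI allI impI)
  show "real_distribution (distr M borel (\<lambda>x. \<zeta> n x / \<beta> n))" for n
    by (rule real_distribution_distr) measurable
  fix \<epsilon> :: real assume "0 < \<epsilon>"
  then have "0 < \<epsilon> / 2" by simp
  from ev[OF this] obtain K N where K: "\<And>n. N \<le> n \<Longrightarrow> prob {x \<in> space M. K < \<bar>\<zeta> n x / \<beta> n\<bar>} \<le> \<epsilon> / 2"
    by blast
  \<comment> \<open>A single real variable is treated as a constant sequence, which is trivially
    bounded at each point.\<close>
  have "\<exists>Q. prob {x \<in> space M. Q < \<bar>\<zeta> n x / \<beta> n\<bar>} \<le> \<epsilon> / 2" for n
    using tail_small_of_AE_bounded[of "\<lambda>_ x. \<bar>\<zeta> n x / \<beta> n\<bar>", OF _ _ \<open>0 < \<epsilon> / 2\<close>] by auto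
  then obtain Q where Q: "\<And>n. prob {x \<in> space M. Q n < \<bar>\<zeta> n x / \<beta> n\<bar>} \<le> \<epsilon> / 2"
    by metis
  define R where "R = Max (insert 0 (insert K (Q ` {..<N})))"
  have R: "0 \<le> R" "K \<le> R" "n < N \<Longrightarrow> Q n \<le> R" for n
    unfolding R_def by (auto intro!: Max_ge simp del: Max_insert)
  have small: "prob {x \<in> space M. R < \<bar>\<zeta> n x / \<beta> n\<bar>} \<le> \<epsilon> / 2" for n
  proof (cases "n < N")
    case True
    have "prob {x \<in> space M. R < \<bar>\<zeta> n x / \<beta> n\<bar>} \<le> prob {x \<in> space M. Q n < \<bar>\<zeta> n x / \<beta> n\<bar>}"
      using R(3)[OF True] by (intro finite_measure_mono) auto
    with Q[of n] show ?thesis by simp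
  next
    case False
    have "prob {x \<in> space M. R < \<bar>\<zeta> n x / \<beta> n\<bar>} \<le> prob {x \<in> space M. K < \<bar>\<zeta> n x / \<beta> n\<bar>}"
      using R(2) by (intro finite_measure_mono) auto
    with K[of n] False show ?thesis by simp
  qed
  show "\<exists>a b. a < b \<and> (\<forall>n. 1 - \<epsilon> < measure (distr M borel (\<lambda>x. \<zeta> n x / \<beta> n)) {a<..b})"
  proof (intro exI conjI allI)
    \<comment> \<open>The interval in \<open>tight\<close> is open on the left, so its left end is
      moved beyond \<open>- R\<close>.\<close>
    show "- (R + 1) < R" using R(1) by simp
    fix n
    have "1 - prob {x \<in> space M. R < \<bar>\<zeta> n x / \<beta> n\<bar>} = prob (space M - {x \<in> space M. R < \<bar>\<zeta> n x / \<beta> n\<bar>})"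
      by (rule prob_compl[symmetric]) measurable
    also have "\<dots> \<le> prob ((\<lambda>x. \<zeta> n x / \<beta> n) -` {- (R + 1)<..R} \<inter> space M)"
    proof (intro finite_measure_mono)
      have "- (R + 1) < u \<and> u \<le> R" if "\<not> R < \<bar>u\<bar>" for u
        using that by linarith
      then show "space M - {x \<in> space M. R < \<bar>\<zeta> n x / \<beta> n\<bar>} \<subseteq> (\<lambda>x. \<zeta> n x / \<beta> n) -` {- (R + 1)<..R} \<inter> space M"
        by (auto simp del: abs_divide)
    qed measurable
    also have "\<dots> = measure (distr M borel (\<lambda>x. \<zeta> n x / \<beta> n)) {- (R + 1)<..R}"
      by (rule measure_distr[symmetric]) auto
    finally show "1 - \<epsilon> < measure (distr M borel (\<lambda>x. \<zeta> n x / \<beta> n)) {- (R + 1)<..R}"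
      using small[of n] \<open>0 < \<epsilon>\<close> by linarith
  qed
qed

text \<open>With the entries divided by their mean \<open>m\<close>, the tangent line of
  \<open>x powr p\<close> at 1 sums to exactly \<open>n\<close>, and Bernoulli places the powers
  above it.\<close>

lemma power_mean_le:
  fixes a :: "nat \<Rightarrow> real"
  assumes "1 \<le> p" "1 \<le> n" and a: "\<And>k. k \<in> {1..n} \<Longrightarrow> 0 \<le> a k"
  shows "(\<Sum>k=1..n. a k) / real n \<le> real n powr (- (1 / p)) * (\<Sum>k=1..n. a k powr p) powr (1 / p)"
proof -
  define m where "m = (\<Sum>k=1..n. a k) / real n"
  have n: "0 < real n" using assms by simp
  have "0 \<le> m" unfolding m_def using a by (intro divide_nonneg_nonneg sum_nonneg) auto
  show ?thesis
  proof (cases "m = 0")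
    case True
    then show ?thesis unfolding m_def by (metis mult_nonneg_nonneg powr_ge_zero)
  next
    case False
    with \<open>0 \<le> m\<close> have "0 < m" by simp
    have "real n = (\<Sum>k=1..n. 1 + p * (a k / m - 1))"
    proof -
      have "(\<Sum>k=1..n. a k / m) = real n"
      proof -
        have "(\<Sum>k=1..n. a k) = m * real n" using n by (simp add: m_def)
        then show ?thesis
          unfolding sum_divide_distrib[symmetric] using \<open>0 < m\<close> by simp
      qed
      then show ?thesis
        by (simp add: sum.distrib sum_distrib_left[symmetric] sum_subtractf)
    qed
    also have "\<dots> \<le> (\<Sum>k=1..n. (a k / m) powr p)"
      using assms \<open>0 < m\<close> by (intro sum_mono powr_bernoulli_ge) auto
    also have "\<dots> = (\<Sum>k=1..n. a k powr p) / m powr p"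
      using a \<open>0 < m\<close> by (simp add: powr_divide sum_divide_distrib)
    finally have "real n * m powr p \<le> (\<Sum>k=1..n. a k powr p)"
      using \<open>0 < m\<close> by (simp add: pos_le_divide_eq)
    then have "m powr p \<le> (\<Sum>k=1..n. a k powr p) / real n"
      using n by (simp add: pos_le_divide_eq mult.commute)
    then have "(m powr p) powr (1 / p) \<le> ((\<Sum>k=1..n. a k powr p) / real n) powr (1 / p)"
      using assms(1) by (intro powr_mono2) auto
    then have "m \<le> ((\<Sum>k=1..n. a k powr p) / real n) powr (1 / p)"
      using assms(1) \<open>0 < m\<close> by (simp add: powr_powr)
    also have "\<dots> = real n powr (- (1 / p)) * (\<Sum>k=1..n. a k powr p) powr (1 / p)"
      using n by (simp add: powr_divide powr_minus_divide sum_nonneg)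
    finally show ?thesis by (simp add: m_def)
  qed
qed

lemma converges_in_probI:
  assumes "prob_space M" and [measurable]: "\<And>n. S n \<in> borel_measurable M" and \<beta>: "\<beta> \<longlonglongrightarrow> 0"
    and ev: "\<And>\<epsilon>. 0 < \<epsilon> \<Longrightarrow> \<exists>K N. \<forall>n\<ge>N. measure M {x \<in> space M. K * \<beta> n < \<bar>S n x - l\<bar>} \<le> \<epsilon>"
  shows "converges_in_prob M S l"
  unfolding converges_in_prob_def
proof (intro allI impI)
  interpret prob_space M by fact
  fix \<delta> :: real assume "0 < \<delta>"
  show "(\<lambda>n. prob {x \<in> space M. \<delta> < \<bar>S n x - l\<bar>}) \<longlonglongrightarrow> 0"
  proof (rule order_tendstoI)
    fix y :: real assume "0 < y"
    then have "0 < y / 2" by simp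
    from ev[OF this] obtain K N where K: "\<And>n. N \<le> n \<Longrightarrow> prob {x \<in> space M. K * \<beta> n < \<bar>S n x - l\<bar>} \<le> y / 2"
      by blast
    have "(\<lambda>n. K * \<beta> n) \<longlonglongrightarrow> K * 0"
      by (intro tendsto_mult tendsto_const \<beta>)
    then have "\<forall>\<^sub>F n in sequentially. K * \<beta> n < \<delta>"
      using \<open>0 < \<delta>\<close> by (intro order_tendstoD(2)) auto
    moreover have "\<forall>\<^sub>F n in sequentially. N \<le> n"
      by (rule eventually_ge_at_top)
    ultimately show "\<forall>\<^sub>F n in sequentially. prob {x \<in> space M. \<delta> < \<bar>S n x - l\<bar>} < y"
    proof eventually_elim
      case (elim n)
      then have "prob {x \<in> space M. \<delta> < \<bar>S n x - l\<bar>} \<le> prob {x \<in> space M. K * \<beta> n < \<bar>S n x - l\<bar>}"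
        by (intro finite_measure_mono) auto
      with K[OF elim(2)] \<open>0 < y\<close> show ?case by simp
    qed
  next
    fix y :: real assume "y < 0"
    then show "\<forall>\<^sub>F n in sequentially. y < prob {x \<in> space M. \<delta> < \<bar>S n x - l\<bar>}"
      by (intro always_eventually allI less_le_trans[OF _ measure_nonneg])
  qed
qed

section \<open>Boundedness of the variation sums, quality of the proxies, and conclusion\<close>

lemma AE_bounded_of_limsup:
  fixes f :: "nat \<Rightarrow> 'a \<Rightarrow> real"
  assumes "AE x in M. limsup (\<lambda>n. ereal (f n x)) < \<infinity>"
  shows "AE x in M. \<exists>c. \<forall>n. f n x \<le> c"
  using assms
proof eventually_elim
  case (elim x)
  then obtain c :: nat where "limsup (\<lambda>n. ereal (f n x)) < ereal (real c)"
    using less_PInf_Ex_of_nat by auto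
  then have "\<forall>\<^sub>F n in sequentially. ereal (f n x) < ereal (real c)"
    by (rule Limsup_lessD)
  then obtain N where N: "\<And>n. N \<le> n \<Longrightarrow> f n x < real c"
    by (auto simp: eventually_sequentially)
  have "f n x \<le> Max (insert (real c) ((\<lambda>n. f n x) ` {..<N}))" for n
  proof (cases "n < N")
    case False
    then have "f n x \<le> real c" using N[of n] by simp
    then show ?thesis by (rule order_trans) simp
  qed simp
  then show ?case by blast
qed

text \<open>The deterministic proxy is regarded as a constant random vector, and the random one is
  replaced by its unsorted sample, since \<open>cdf_dist\<close> ignores the order. Both then have
  rate \<open>n^(-1/2)\<close>.\<close>

lemma (in prob_space) proxy_expected_cdf_dist_le:
  assumes proxy: "deterministic_proxy M \<psi> \<or> random_proxy M X \<psi>" and n: "1 \<le> n"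
  shows "(\<lambda>x. cdf_dist n (\<lambda>k. \<psi> n k x)) \<in> borel_measurable M"
    and "(\<integral>\<^sup>+x. cdf_dist n (\<lambda>k. \<psi> n k x) \<partial>M) \<le> ennreal (4 * real n powr (- 1 / 2))"
    and "\<And>x. x \<in> space M \<Longrightarrow> mono_on {1..n} (\<lambda>k. \<psi> n k x)"
proof -
  have two: "2 / real n \<le> 4 * (real n powr (- 1 / 2))\<^sup>2"
    using n by (simp add: power2_eq_square powr_add[symmetric] powr_minus_divide divide_right_mono)
  have d: "0 < real n powr (- 1 / 2)" using n by simp
  have "(\<lambda>x. cdf_dist n (\<lambda>k. \<psi> n k x)) \<in> borel_measurable M \<and>
    (\<integral>\<^sup>+x. cdf_dist n (\<lambda>k. \<psi> n k x) \<partial>M) \<le> ennreal (4 * real n powr (- 1 / 2)) \<and>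
    (\<forall>x\<in>space M. mono_on {1..n} (\<lambda>k. \<psi> n k x))"
    using proxy
  proof
    assume det: "deterministic_proxy M \<psi>"
    define v where "v k = inv \<Phi> (real k / real (n + 1))" for k :: nat
    have \<psi>: "\<psi> n k x = v k" if "k \<in> {1..n}" "x \<in> space M" for k x
      using det that unfolding deterministic_proxy_def v_def by blast
    then have eq: "cdf_dist n (\<lambda>k. \<psi> n k x) = cdf_dist n v" if "x \<in> space M" for x
      using that by (intro cdf_dist_cong) auto
    have "(\<integral>\<^sup>+x. cdf_sqdist n v \<partial>M) \<le> ennreal (4 * (real n powr (- 1 / 2))\<^sup>2)"
    proof -
      have "cdf_sqdist n v \<le> ennreal (4 * (real n powr (- 1 / 2))\<^sup>2)"
        using deterministic_cdf_sqdist_le[OF n v_def] ennreal_leI[OF two] by (rule order_trans)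
      then show ?thesis by (simp add: emeasure_space_1)
    qed
    then have "(\<integral>\<^sup>+x. cdf_dist n v \<partial>M) \<le> ennreal (4 * real n powr (- 1 / 2))"
      by (intro expected_cdf_dist_le[where G = "\<lambda>k _. v k"] d) auto
    moreover have "mono_on {1..n} v"
    proof (rule mono_onI)
      fix i j assume ij: "i \<in> {1..n}" "j \<in> {1..n}" "i \<le> j"
      then have "real j / real (n + 1) \<le> \<Phi> (v j)"
        by (simp add: v_def Phi_inv)
      moreover have "real i / real (n + 1) \<le> real j / real (n + 1)"
        using ij by (intro divide_right_mono) auto
      ultimately have "real i / real (n + 1) \<le> \<Phi> (v j)" by linarith
      then show "v i \<le> v j"
        unfolding v_def[of i] using ij by (subst inv_Phi_le_iff) auto
    qed
    ultimately show ?thesis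
      using \<psi> eq by (auto cong: measurable_cong nn_integral_cong simp: mono_on_def)
  next
    assume "random_proxy M X \<psi>"
    then obtain \<xi> where indep: "indep_vars (\<lambda>_. borel) (\<xi> n) {1..n}"
      and distr: "\<And>k. k \<in> {1..n} \<Longrightarrow> distr M borel (\<xi> n k) = std_normal_distribution"
      and \<psi>: "\<And>k x. k \<in> {1..n} \<Longrightarrow> x \<in> space M \<Longrightarrow> \<psi> n k x = rearr n (\<lambda>j. \<xi> n j x) k"
      unfolding random_proxy_def by metis
    have meas: "\<xi> n k \<in> borel_measurable M" if "k \<in> {1..n}" for k
      using indep that by (auto simp: indep_vars_def)
    have eq: "cdf_dist n (\<lambda>k. \<psi> n k x) = cdf_dist n (\<lambda>k. \<xi> n k x)" if "x \<in> space M" for x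
      using cdf_dist_cong[of n "\<lambda>k. \<psi> n k x" "rearr n (\<lambda>j. \<xi> n j x)"] \<psi> that
      by (simp add: cdf_dist_rearr)
    have "(\<integral>\<^sup>+x. cdf_sqdist n (\<lambda>k. \<xi> n k x) \<partial>M) \<le> ennreal (4 * (real n powr (- 1 / 2))\<^sup>2)"
      by (rule order_trans[OF iid_expected_cdf_sqdist_le ennreal_leI[OF two]]) (use indep distr n in auto)
    then have "(\<integral>\<^sup>+x. cdf_dist n (\<lambda>k. \<xi> n k x) \<partial>M) \<le> ennreal (4 * real n powr (- 1 / 2))"
      by (intro expected_cdf_dist_le meas d)
    moreover have "mono_on {1..n} (\<lambda>k. \<psi> n k x)" if "x \<in> space M" for x
      using mono_on_rearr[of n "\<lambda>j. \<xi> n j x"] \<psi> that by (simp add: mono_on_def)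
    ultimately show ?thesis
      using eq measurable_cdf_dist[OF meas] by (simp cong: measurable_cong nn_integral_cong)
  qed
  then show "(\<lambda>x. cdf_dist n (\<lambda>k. \<psi> n k x)) \<in> borel_measurable M"
    and "(\<integral>\<^sup>+x. cdf_dist n (\<lambda>k. \<psi> n k x) \<partial>M) \<le> ennreal (4 * real n powr (- 1 / 2))"
    and "\<And>x. x \<in> space M \<Longrightarrow> mono_on {1..n} (\<lambda>k. \<psi> n k x)"
    by auto
qed

theorem corollary5p1:
  fixes M :: "'a measure"
    and T \<sigma> H p :: real
    and r :: nat
    and XX Y Z :: "real \<Rightarrow> 'a \<Rightarrow> real"
    and X \<psi> :: "nat \<Rightarrow> nat \<Rightarrow> 'a \<Rightarrow> real"
    and \<omega> :: "real \<Rightarrow> real"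
    and S :: "nat \<Rightarrow> 'a \<Rightarrow> real"
  assumes "prob_space M"
    and "0 < T" and "0 < \<sigma>" and "0 < H" and "H < 1"
    and "1 \<le> p" and "p < 1 / H"
    and "\<And>t. t \<in> {0..T} \<Longrightarrow> Y t \<in> borel_measurable M"
    and "standard_fBm M T H Z"
    and "\<And>t x. t \<in> {0..T} \<Longrightarrow> x \<in> space M \<Longrightarrow> XX t x = Y t x + \<sigma> * Z t x"
    and "AE x in M. limsup (\<lambda>n. ereal (\<Sum>k=1..n.
           \<bar>Y (T * real k / real n) x - Y (T * (real k - 1) / real n) x\<bar> powr p)) < \<infinity>"
    and "X = scaled_increment T H XX"
    and "deterministic_proxy M \<psi> \<or> random_proxy M X \<psi>"
    and "continuous_on UNIV \<omega>" and "\<And>u. \<omega> u \<in> {0..1}"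
    and "bdd_above (range (\<lambda>u. u\<^sup>2 * \<omega> u))" and "\<exists>u. \<omega> u \<noteq> 0"
    and "r \<in> {1, 2}"
    and "\<And>n. S n \<in> borel_measurable M"
    and "\<And>n x. 1 \<le> n \<Longrightarrow> x \<in> space M \<Longrightarrow>
           is_arg_min (objective r n (\<lambda>k. \<omega> (\<psi> n k x)) (\<lambda>k. X n k x) (\<lambda>k. \<psi> n k x)) (\<lambda>_. True) (S n x)"
  shows "converges_in_prob M S \<sigma> \<and>
    bigO_prob M (\<lambda>n x. \<bar>S n x - \<sigma>\<bar>)
      (\<lambda>n. real n powr (- (min ((1 / p - H) * real r) (min (1 - H) (1 / 2)) / real r)))"
proof -
  note T = \<open>0 < T\<close> and \<sigma> = \<open>0 < \<sigma>\<close> and H = \<open>0 < H\<close> \<open>H < 1\<close> and p = \<open>1 \<le> p\<close> \<open>p < 1 / H\<close>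
    and Ymeas = assms(8) and Z = \<open>standard_fBm M T H Z\<close> and XX = assms(10) and variation = assms(11)
    and X = \<open>X = scaled_increment T H XX\<close> and proxy = assms(13) and \<omega> = assms(14-17) and r = \<open>r \<in> {1, 2}\<close>
    and Smeas [measurable] = assms(19) and argmin = assms(20)
  interpret prob_space M by fact
  define \<gamma> where "\<gamma> = min (1 - H) (1 / 2)"
  define \<theta> where "\<theta> = min ((1 / p - H) * real r) (min (1 - H) (1 / 2)) / real r"
  define g where "g n = real n powr (- \<gamma>)" for n :: nat
  define \<beta> where "\<beta> n = real n powr (- \<theta>)" for n :: nat
  define G where "G = scaled_increment T H Z"
  define \<Delta>Y where "\<Delta>Y n k x = Y (T * real k / real n) x - Y (T * (real k - 1) / real n) x" for n k :: nat and x
  define V where "V n x = (\<Sum>k=1..n. \<bar>\<Delta>Y n k x\<bar> powr p)" for n :: nat and x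
  have "H < 1 / p"
    using p H by (simp add: field_simps)
  have "0 < \<gamma>" using H by (simp add: \<gamma>_def)
  have r1: "1 \<le> real r" using r by auto
  \<comment> \<open>The estimate below produces the exponents \<open>1 / p - H\<close> and
    \<open>\<gamma>\<close>. Multiplying \<open>\<theta>\<close> by \<open>r \<ge> 1\<close> shows
    that it lies below both.\<close>
  have \<theta>: "0 < \<theta>" "\<theta> \<le> 1 / p - H" "\<theta> \<le> \<gamma>"
  proof -
    show "0 < \<theta>"
      using \<open>H < 1 / p\<close> H r1 by (simp add: \<theta>_def)
    have "\<theta> * real r = min ((1 / p - H) * real r) \<gamma>"
      using r1 by (simp add: \<theta>_def \<gamma>_def)
    then have "\<theta> * real r \<le> (1 / p - H) * real r" "\<theta> * real r \<le> \<gamma>"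
      by simp_all
    moreover have "\<theta> * 1 \<le> \<theta> * real r"
      using r1 \<open>0 < \<theta>\<close> by (intro mult_left_mono) auto
    ultimately show "\<theta> \<le> 1 / p - H" "\<theta> \<le> \<gamma>"
      using r1 by (auto simp: mult_le_cancel_right)
  qed
  have powr_anti: "real n powr (- a) \<le> real n powr (- b)" if "1 \<le> n" "b \<le> a" for n a b
    using that by (intro powr_mono) auto
  have times: "T * real k / real n \<in> {0..T}" "T * (real k - 1) / real n \<in> {0..T}" if "k \<in> {1..n}" for k n
    using that T by (auto simp: divide_le_eq mult_left_mono)
  have \<Delta>Ym [measurable]: "\<Delta>Y n k \<in> borel_measurable M" if "k \<in> {1..n}" for n k
    unfolding \<Delta>Y_def[abs_def] using Ymeas[OF times(1)[OF that]] Ymeas[OF times(2)[OF that]] by measurable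
  have Vm: "V n \<in> borel_measurable M" for n
    unfolding V_def[abs_def] by measurable
  have Gm: "G n k \<in> borel_measurable M" if "k \<in> {1..n}" for n k
    using fgn_gaussian_pair[OF Z T that that] by (simp add: G_def gaussian_pair_def)
  have G: "(\<integral>\<^sup>+x. cdf_dist n (\<lambda>k. G n k x) \<partial>M) \<le> ennreal (4 * g n)" if "1 \<le> n" for n
    using fgn_expected_cdf_sqdist_le[OF Z T H(1) that] that Gm
    unfolding G_def g_def \<gamma>_def by (intro expected_cdf_dist_le) auto
  have \<psi>: "(\<integral>\<^sup>+x. cdf_dist n (\<lambda>k. \<psi> n k x) \<partial>M) \<le> ennreal (4 * g n)" if "1 \<le> n" for n
  proof -
    have "4 * real n powr (- 1 / 2) \<le> 4 * g n"
      using powr_anti[OF that, of \<gamma> "1 / 2"] min.cobounded2[of "1 - H" "1 / 2"]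
      unfolding g_def \<gamma>_def[symmetric] by simp
    then show ?thesis
      using proxy_expected_cdf_dist_le(2)[OF proxy that] by (meson ennreal_leI order_trans)
  qed
  have noise: "(\<Sum>k=1..n. \<bar>X n k x - \<sigma> * G n k x\<bar>) / real n \<le> T powr (- H) * V n x powr (1 / p) * real n powr (- (1 / p - H))"
    if "1 \<le> n" "x \<in> space M" for n x
  proof -
    \<comment> \<open>\<open>X\<close> and \<open>G\<close> carry the same normalisation, so the
      fractional part cancels exactly and only the increments of \<open>Y\<close> remain.\<close>
    have "X n k x - \<sigma> * G n k x = (T / real n) powr (- H) * \<Delta>Y n k x" if "k \<in> {1..n}" for k
      using times[OF that] XX \<open>x \<in> space M\<close>
      by (simp add: X G_def \<Delta>Y_def scaled_increment_def algebra_simps)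
    then have "(\<Sum>k=1..n. \<bar>X n k x - \<sigma> * G n k x\<bar>) / real n = (T / real n) powr (- H) * ((\<Sum>k=1..n. \<bar>\<Delta>Y n k x\<bar>) / real n)"
      by (simp add: abs_mult sum_distrib_left)
    also have "\<dots> \<le> (T / real n) powr (- H) * (real n powr (- (1 / p)) * V n x powr (1 / p))"
      unfolding V_def using p that by (intro mult_left_mono power_mean_le) auto
    also have "(T / real n) powr (- H) = T powr (- H) * real n powr H"
      using T that by (simp add: powr_divide powr_minus_divide)
    also have "T powr (- H) * real n powr H * (real n powr (- (1 / p)) * V n x powr (1 / p))
        = T powr (- H) * V n x powr (1 / p) * (real n powr H * real n powr (- (1 / p)))"
      by simp
    also have "real n powr H * real n powr (- (1 / p)) = real n powr (- (1 / p - H))"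
      by (simp add: powr_add[symmetric])
    finally show ?thesis .
  qed
  obtain C \<eta> where C: "0 < C" and \<eta>: "0 < \<eta>" and error:
    "\<And>n v u \<psi> s a b. 1 \<le> n \<Longrightarrow> mono_on {1..n} \<psi> \<Longrightarrow>
      is_arg_min (objective r n (\<lambda>k. \<omega> (\<psi> k)) v \<psi>) (\<lambda>_. True) s \<Longrightarrow>
      0 \<le> a \<Longrightarrow> 0 \<le> b \<Longrightarrow> b \<le> \<eta> \<Longrightarrow> cdf_dist n u \<le> ennreal a \<Longrightarrow> cdf_dist n \<psi> \<le> ennreal b \<Longrightarrow>
      \<bar>s - \<sigma>\<bar> \<le> C * ((\<Sum>k=1..n. \<bar>v k - \<sigma> * u k\<bar>) / real n + a + b)"
    using estimator_error_bound[OF \<omega> r \<sigma>] by blast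
  have "AE x in M. \<exists>c. \<forall>n. V n x \<le> c"
    using variation unfolding V_def \<Delta>Y_def by (rule AE_bounded_of_limsup)
  note V_tail = tail_small_of_AE_bounded[OF Vm this]
  have g0: "g \<longlonglongrightarrow> 0"
    unfolding g_def using \<open>0 < \<gamma>\<close> by (intro tendsto_neg_powr filterlim_real_sequentially) auto
  have \<beta>0: "\<beta> \<longlonglongrightarrow> 0"
    unfolding \<beta>_def using \<theta>(1) by (intro tendsto_neg_powr filterlim_real_sequentially) auto
  \<comment> \<open>The conclusion includes \<open>1 \<le> n\<close>, so that
    \<open>\<beta> n\<close> is positive when it becomes a divisor.\<close>
  have key: "\<exists>K N. \<forall>n\<ge>N. 1 \<le> n \<and> prob {x \<in> space M. K * \<beta> n < \<bar>S n x - \<sigma>\<bar>} \<le> \<epsilon>" if "0 < \<epsilon>" for \<epsilon>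
  proof -
    \<comment> \<open>Markov's inequality for a mean of at most \<open>4 * g n\<close> at level
      \<open>A * g n\<close> gives \<open>4 / A = \<epsilon> / 3\<close>, one third of the budget
      for each of the three exceptional events.\<close>
    define A where "A = 12 / \<epsilon>"
    have A: "0 < A" using that by (simp add: A_def)
    from that have "0 < \<epsilon> / 3" by simp
    from V_tail[OF this] obtain Q where Q: "0 \<le> Q" "\<And>n. prob {x \<in> space M. Q < V n x} \<le> \<epsilon> / 3"
      by blast
    define K where "K = C * (T powr (- H) * Q powr (1 / p) + A + A)"
    \<comment> \<open>For large \<open>n\<close> the level for the proxy drops below
      \<open>\<eta>\<close>, as the deterministic error bound demands.\<close>
    have "(\<lambda>n. A * g n) \<longlonglongrightarrow> A * 0"
      by (intro tendsto_mult tendsto_const g0)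
    then have "\<forall>\<^sub>F n in sequentially. A * g n < \<eta>"
      using \<eta> by (intro order_tendstoD(2)) auto
    then obtain N where N: "\<And>n. N \<le> n \<Longrightarrow> A * g n < \<eta>"
      by (auto simp: eventually_sequentially)
    have "prob {x \<in> space M. K * \<beta> n < \<bar>S n x - \<sigma>\<bar>} \<le> \<epsilon>" if n: "max 1 N \<le> n" for n
    proof -
      have n1: "1 \<le> n" and "A * g n \<le> \<eta>" using n N[of n] by auto
      have gn: "0 < g n" using n1 by (simp add: g_def)
      note \<psi>m [measurable] = proxy_expected_cdf_dist_le(1)[OF proxy n1]
      have Gdm [measurable]: "(\<lambda>x. cdf_dist n (\<lambda>k. G n k x)) \<in> borel_measurable M"
        by (intro measurable_cdf_dist Gm)
      define E1 where "E1 = {x \<in> space M. ennreal (A * g n) < cdf_dist n (\<lambda>k. G n k x)}"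
      define E2 where "E2 = {x \<in> space M. ennreal (A * g n) < cdf_dist n (\<lambda>k. \<psi> n k x)}"
      define E3 where "E3 = {x \<in> space M. Q < V n x}"
      have [measurable]: "E1 \<in> events" "E2 \<in> events" "E3 \<in> events"
        unfolding E1_def E2_def E3_def using Vm[of n] by measurable
      have tail: "4 * g n / (A * g n) = \<epsilon> / 3"
        using gn by (simp add: A_def)
      have "prob E1 \<le> \<epsilon> / 3" "prob E2 \<le> \<epsilon> / 3"
        unfolding E1_def E2_def tail[symmetric] using A gn
        by (intro markov_tail G[OF n1] \<psi>[OF n1] Gdm \<psi>m; simp)+
      have "\<bar>S n x - \<sigma>\<bar> \<le> K * \<beta> n" if x: "x \<in> space M" "x \<notin> E1" "x \<notin> E2" "x \<notin> E3" for x
      proof -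
        have "\<bar>S n x - \<sigma>\<bar> \<le> C * ((\<Sum>k=1..n. \<bar>X n k x - \<sigma> * G n k x\<bar>) / real n + A * g n + A * g n)"
          using x A gn \<open>A * g n \<le> \<eta>\<close>
          by (intro error[OF n1 proxy_expected_cdf_dist_le(3)[OF proxy n1] argmin[OF n1]])
             (auto simp: E1_def E2_def not_less)
        also have "\<dots> \<le> C * (T powr (- H) * Q powr (1 / p) * \<beta> n + A * \<beta> n + A * \<beta> n)"
        proof (intro mult_left_mono add_mono)
          have "V n x powr (1 / p) \<le> Q powr (1 / p)"
            using x p by (intro powr_mono2) (auto simp: E3_def V_def intro: sum_nonneg)
          then have "T powr (- H) * V n x powr (1 / p) * real n powr (- (1 / p - H)) \<le> T powr (- H) * Q powr (1 / p) * \<beta> n"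
            unfolding \<beta>_def by (intro mult_mono powr_anti n1 \<theta>) auto
          with noise[OF n1 x(1)]
          show "(\<Sum>k=1..n. \<bar>X n k x - \<sigma> * G n k x\<bar>) / real n \<le> T powr (- H) * Q powr (1 / p) * \<beta> n"
            by (rule order_trans)
          show "g n \<le> \<beta> n" "g n \<le> \<beta> n"
            unfolding g_def \<beta>_def by (intro powr_anti n1 \<theta>)+
        qed (use A C in auto)
        also have "\<dots> = K * \<beta> n"
          by (simp add: K_def algebra_simps)
        finally show ?thesis .
      qed
      then have "{x \<in> space M. K * \<beta> n < \<bar>S n x - \<sigma>\<bar>} \<subseteq> E1 \<union> E2 \<union> E3"
        by (auto simp flip: not_le)
      then have "prob {x \<in> space M. K * \<beta> n < \<bar>S n x - \<sigma>\<bar>} \<le> prob (E1 \<union> E2 \<union> E3)"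
        by (intro finite_measure_mono) auto
      also have "\<dots> \<le> prob E1 + prob E2 + prob E3"
        using measure_Un_le[of "E1 \<union> E2" M E3] measure_Un_le[of E1 M E2] by simp
      also have "\<dots> \<le> \<epsilon>"
        using \<open>prob E1 \<le> \<epsilon> / 3\<close> \<open>prob E2 \<le> \<epsilon> / 3\<close> Q(2)[of n] by (simp add: E3_def)
      finally show ?thesis .
    qed
    then show ?thesis by (intro exI[of _ K] exI[of _ "max 1 N"]) auto
  qed
  have "converges_in_prob M S \<sigma>"
    using key by (intro converges_in_probI[OF prob_space_axioms Smeas \<beta>0]) blast
  moreover have "bigO_prob M (\<lambda>n x. \<bar>S n x - \<sigma>\<bar>) \<beta>"
  proof (rule bigO_probI)
    fix \<epsilon> :: real assume "0 < \<epsilon>"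
    from key[OF this] obtain K N where K: "\<And>n. N \<le> n \<Longrightarrow> 1 \<le> n \<and> prob {x \<in> space M. K * \<beta> n < \<bar>S n x - \<sigma>\<bar>} \<le> \<epsilon>"
      by blast
    have "prob {x \<in> space M. K < \<bar>\<bar>S n x - \<sigma>\<bar> / \<beta> n\<bar>} \<le> \<epsilon>" if "N \<le> n" for n
    proof -
      have "0 < \<beta> n" using K[OF that] by (simp add: \<beta>_def)
      then show ?thesis using K[OF that] by (simp add: pos_less_divide_eq)
    qed
    then show "\<exists>K N. \<forall>n\<ge>N. prob {x \<in> space M. K < \<bar>\<bar>S n x - \<sigma>\<bar> / \<beta> n\<bar>} \<le> \<epsilon>"
      by blast
  qed measurable
  ultimately show ?thesis
    by (simp add: \<beta>_def[abs_def] \<theta>_def)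
qed

end
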